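(* Let $(\mathcal M,g)$ be a closed connected Riemannian manifold of dimension $n$, and let $p\in\{1,\dots,n\}$. Assume that $A(\alpha,t)$ and $\varphi(\alpha,t)$ are both independent of $t$, that for every $(x,t)\in\mathcal M\times\mathbb R$ and $\alpha\in T_x^*\mathcal M$, $$\Bigl(D_\alpha^2\bigl[(A(\cdot,t))(v,v)\bigr]\Bigr)(\beta,\beta)\le0,\qquad\forall(\beta,v)\in T_x^*\mathcal M\times T_x\mathcal M,$$ that $u\in C^2(\mathcal M)$ satisfies the general $p$-Hessian equation, and that $\underline u\in C^2(\mathcal M)$ is a classical subsolution to it, i.e. for all $x\in\mathcal M$, $$\sigma_p^{1/p}\bigl(\lambda(g^{-1}(A(\mathrm d\underline u,\underline u)+\nabla^2\underline u))(x)\bigr)\ge\varphi(\mathrm d\underline u(x),\underline u(x)),\qquad\lambda(g^{-1}(A(\mathrm d\underline u,\underline u)+\nabla^2\underline u))(x)\in\Gamma_p .$$ Then $u-\underline u$ is a constant function on $\mathcal M$. In particular, $\underline u$ also satisfies the general $p$-Hessian equation.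
   Context: Notation. $\sigma_p(\mu)=\sum_{1\le j_1<\dots<j_p\le n}\mu_{j_1}\cdots\mu_{j_p}$ for $\mu\in\mathbb R^n$; $\Gamma_p=\{\mu\in\mathbb R^n:\sigma_q(\mu)>0\ \forall q\in\{1,\dots,p\}\}$. "Closed" means compact without boundary. $\pi:T^*\mathcal M\to\mathcal M$ is the projection. $A$ is a smooth map assigning to each $(\alpha,t)\in T^*\mathcal M\times\mathbb R$ a symmetric bilinear form $A(\alpha,t)$ on $T_{\pi(\alpha)}\mathcal M$; $\varphi(\alpha,t)$ is a positive smooth function on $T^*\mathcal M\times\mathbb R$. For $u\in C^2(\mathcal M)$, $\mathrm du$ is its differential, $\nabla^2u$ its Hessian for the Levi-Civita connection, and $A(\mathrm du,u)$ is the tensor field $x\mapsto A(\mathrm du(x),u(x))$. For a symmetric $(0,2)$-tensor field $B$, $\lambda(g^{-1}B)(x)\in\mathbb R^n$ is the vector of eigenvalues, in non-decreasing order, of the matrix product $(g^{jk}(x))(B_{jk}(x))$ in any local coordinates, where $(g^{jk})=(g_{jk})^{-1}$. For $\psi\in C^2(T_x^*\mathcal M)$, $D^2_\alpha[\psi](\beta,\gamma)$ denotes the second (Fréchet) derivative of $\psi$ at $\alpha$ on the vector space $T_x^*\mathcal M$; $(A(\cdot,t))(v,v)$ is regarded as the function $\alpha\mapsto(A(\alpha,t))(v,v)$ on $T_x^*\mathcal M$. The general $p$-Hessian equation for $u\in C^2(\mathcal M)$ is: for all $x\in\mathcal M$, $$\sigma_p^{1/p}\bigl(\lambda(g^{-1}(A(\mathrm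 du,u)+\nabla^2u))(x)\bigr)=\varphi(\mathrm du(x),u(x)),\qquad \lambda(g^{-1}(A(\mathrm du,u)+\nabla^2u))(x)\in\Gamma_p .$$ *)

theory Defs
  imports
    "HOL-Analysis.Analysis"
    "HOL-Computational_Algebra.Computational_Algebra"
begin

section \<open>Differentiability classes on open sets\<close>

text \<open>Only used for finite-dimensional domains and open sets, where \<open>Ck_on k f S\<close> says that
  \<open>f\<close> is \<open>k\<close> times continuously differentiable on \<open>S\<close>.\<close>

primrec Ck_on :: "nat \<Rightarrow> ('a::real_normed_vector \<Rightarrow> 'b::real_normed_vector) \<Rightarrow> 'a set \<Rightarrow> bool" where
  "Ck_on 0 f S \<longleftrightarrow> continuous_on S f"
| "Ck_on (Suc k) f S \<longleftrightarrow>
     (\<forall>x\<in>S. f differentiable (at x)) \<and> (\<forall>v. Ck_on k (\<lambda>x. frechet_derivative f (at x) v) S)"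

definition smooth_on :: "('a::real_normed_vector \<Rightarrow> 'b::real_normed_vector) \<Rightarrow> 'a set \<Rightarrow> bool" where
  "smooth_on f S \<longleftrightarrow> (\<forall>k. Ck_on k f S)"

definition partial_deriv :: "'n::finite \<Rightarrow> (real^'n \<Rightarrow> real) \<Rightarrow> real^'n \<Rightarrow> real" where
  "partial_deriv i f y = frechet_derivative f (at y) (axis i 1)"

definition second_deriv ::
  "('a::real_normed_vector \<Rightarrow> 'b::real_normed_vector) \<Rightarrow> 'a \<Rightarrow> 'a \<Rightarrow> 'a \<Rightarrow> 'b" where
  "second_deriv f a b c = frechet_derivative (\<lambda>y. frechet_derivative f (at y) c) (at a) b"


section \<open>Smooth manifolds\<close>

text \<open>A chart is a pair of its domain and its coordinate map; the values of the map outside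
  the domain are irrelevant. The dimension of the manifold is \<open>CARD('n)\<close>.\<close>

type_synonym ('a, 'n) chart = "'a set \<times> ('a \<Rightarrow> real^'n)"

definition chart_image :: "('a, 'n::finite) chart \<Rightarrow> (real^'n) set" where
  "chart_image c = snd c ` fst c"

definition chart_inv :: "('a, 'n::finite) chart \<Rightarrow> real^'n \<Rightarrow> 'a" where
  "chart_inv c = inv_into (fst c) (snd c)"

text \<open>Charts take values in open subsets of Euclidean space, so there is no boundary.
  The atlas is not required to be maximal: it generates the smooth structure.\<close>

definition smooth_manifold :: "'a topology \<Rightarrow> ('a, 'n::finite) chart set \<Rightarrow> bool" where
  "smooth_manifold X Atl \<longleftrightarrow>
     Hausdorff_space X \<and> second_countable X \<and>
     (\<Union>c\<in>Atl. fst c) = topspace X \<and>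
     (\<forall>c\<in>Atl. openin X (fst c) \<and> open (chart_image c) \<and>
        homeomorphic_map (subtopology X (fst c)) (top_of_set (chart_image c)) (snd c)) \<and>
     (\<forall>c\<in>Atl. \<forall>d\<in>Atl. smooth_on (snd d \<circ> chart_inv c) (snd c ` (fst c \<inter> fst d)))"

definition C2_function :: "('a, 'n::finite) chart set \<Rightarrow> ('a \<Rightarrow> real) \<Rightarrow> bool" where
  "C2_function Atl u \<longleftrightarrow> (\<forall>c\<in>Atl. Ck_on 2 (u \<circ> chart_inv c) (chart_image c))"

definition charts_at :: "('a, 'n::finite) chart set \<Rightarrow> 'a \<Rightarrow> ('a, 'n) chart set" where
  "charts_at Atl x = {c \<in> Atl. x \<in> fst c}"

text \<open>An arbitrary chart around \<open>x\<close>, used only to evaluate expressions that do not depend on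
  the chart.\<close>

definition chart_at :: "('a, 'n::finite) chart set \<Rightarrow> 'a \<Rightarrow> ('a, 'n) chart" where
  "chart_at Atl x = (SOME c. c \<in> charts_at Atl x)"


section \<open>Tangent and cotangent spaces\<close>

text \<open>A tangent vector at \<open>x\<close> is a family of coordinate vectors, one for each chart around \<open>x\<close>,
  related by the differentials of the transition maps. The value \<open>0\<close> at all other charts makes
  tangent vectors extensional. Vector space operations are pointwise.\<close>

type_synonym ('a, 'n) tvec = "('a, 'n) chart \<Rightarrow> real^'n"

definition tangent_space :: "('a, 'n::finite) chart set \<Rightarrow> 'a \<Rightarrow> ('a, 'n) tvec set" where
  "tangent_space Atl x =
     {v. (\<forall>c. c \<notin> charts_at Atl x \<longrightarrow> v c = 0) \<and>
         (\<forall>c\<in>charts_at Atl x. \<forall>d\<in>charts_at Atl x.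
            v d = frechet_derivative (snd d \<circ> chart_inv c) (at (snd c x)) (v c))}"

definition tlincomb ::
  "real \<Rightarrow> ('a, 'n::finite) tvec \<Rightarrow> real \<Rightarrow> ('a, 'n) tvec \<Rightarrow> ('a, 'n) tvec" where
  "tlincomb a v b w = (\<lambda>c. a *\<^sub>R v c + b *\<^sub>R w c)"

text \<open>The tangent vector \<open>\<Sum>i. w $ i \<partial>/\<partial>x\<^sup>i\<close> at \<open>x\<close>, for the coordinates of the chart \<open>c\<close>.\<close>

definition coord_vec ::
  "('a, 'n::finite) chart set \<Rightarrow> ('a, 'n) chart \<Rightarrow> 'a \<Rightarrow> real^'n \<Rightarrow> ('a, 'n) tvec" where
  "coord_vec Atl c x w =
     (\<lambda>d. if d \<in> charts_at Atl x
          then frechet_derivative (snd d \<circ> chart_inv c) (at (snd c x)) w else 0)"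

text \<open>The cotangent space is the dual space of the tangent space; functionals are extended by
  \<open>0\<close> to be determined by their values on the tangent space.\<close>

type_synonym ('a, 'n) covec = "('a, 'n) tvec \<Rightarrow> real"

definition cotangent_space :: "('a, 'n::finite) chart set \<Rightarrow> 'a \<Rightarrow> ('a, 'n) covec set" where
  "cotangent_space Atl x =
     {\<alpha>. (\<forall>v. v \<notin> tangent_space Atl x \<longrightarrow> \<alpha> v = 0) \<and>
         (\<forall>v\<in>tangent_space Atl x. \<forall>w\<in>tangent_space Atl x. \<forall>a b.
            \<alpha> (tlincomb a v b w) = a * \<alpha> v + b * \<alpha> w)}"

text \<open>The bundle projection is \<open>fst\<close>.\<close>

definition cotangent_bundle ::
  "'a topology \<Rightarrow> ('a, 'n::finite) chart set \<Rightarrow> ('a \<times> ('a, 'n) covec) set" where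
  "cotangent_bundle X Atl = Sigma (topspace X) (cotangent_space Atl)"

text \<open>The covector \<open>\<Sum>i. \<xi> $ i dx\<^sup>i\<close> at \<open>x\<close>, for the coordinates of the chart \<open>c\<close>, and the inverse
  map sending a covector to its components.\<close>

definition coord_covec ::
  "('a, 'n::finite) chart set \<Rightarrow> ('a, 'n) chart \<Rightarrow> 'a \<Rightarrow> real^'n \<Rightarrow> ('a, 'n) covec" where
  "coord_covec Atl c x \<xi> = (\<lambda>v. if v \<in> tangent_space Atl x then \<xi> \<bullet> v c else 0)"

definition covec_coords ::
  "('a, 'n::finite) chart set \<Rightarrow> ('a, 'n) chart \<Rightarrow> 'a \<Rightarrow> ('a, 'n) covec \<Rightarrow> real^'n" where
  "covec_coords Atl c x \<alpha> = (\<chi> i. \<alpha> (coord_vec Atl c x (axis i 1)))"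

definition differential ::
  "('a, 'n::finite) chart set \<Rightarrow> ('a \<Rightarrow> real) \<Rightarrow> 'a \<Rightarrow> ('a, 'n) covec" where
  "differential Atl u x =
     (let c = chart_at Atl x in
      (\<lambda>v. if v \<in> tangent_space Atl x
           then frechet_derivative (u \<circ> chart_inv c) (at (snd c x)) (v c) else 0))"

text \<open>The second Frechet derivative at \<open>\<alpha>\<close> of a function \<open>\<psi>\<close> on the finite-dimensional vector space
  \<open>T\<^sub>x\<^sup>*M\<close>, computed after identifying this space linearly with \<open>real^'n\<close>; the result does not
  depend on the linear identification.\<close>

definition fiber_second_deriv ::
  "('a, 'n::finite) chart set \<Rightarrow> 'a \<Rightarrow> (('a, 'n) covec \<Rightarrow> real) \<Rightarrow>
   ('a, 'n) covec \<Rightarrow> ('a, 'n) covec \<Rightarrow> ('a, 'n) covec \<Rightarrow> real" where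
  "fiber_second_deriv Atl x \<psi> \<alpha> \<beta> \<gamma> =
     (let c = chart_at Atl x; \<kappa> = covec_coords Atl c x in
      second_deriv (\<lambda>\<xi>. \<psi> (coord_covec Atl c x \<xi>)) (\<kappa> \<alpha>) (\<kappa> \<beta>) (\<kappa> \<gamma>))"


section \<open>Bilinear forms, coefficients and the metric\<close>

type_synonym ('a, 'n) bform = "('a, 'n) tvec \<Rightarrow> ('a, 'n) tvec \<Rightarrow> real"

definition sym_bilinear_at ::
  "('a, 'n::finite) chart set \<Rightarrow> 'a \<Rightarrow> ('a, 'n) bform \<Rightarrow> bool" where
  "sym_bilinear_at Atl x B \<longleftrightarrow>
     (\<forall>v\<in>tangent_space Atl x. \<forall>w\<in>tangent_space Atl x. B v w = B w v) \<and>
     (\<forall>v\<in>tangent_space Atl x. \<forall>v'\<in>tangent_space Atl x. \<forall>w\<in>tangent_space Atl x. \<forall>a b.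
        B (tlincomb a v b v') w = a * B v w + b * B v' w)"

definition components ::
  "('a, 'n::finite) chart set \<Rightarrow> ('a, 'n) chart \<Rightarrow> 'a \<Rightarrow> ('a, 'n) bform \<Rightarrow> real^'n^'n" where
  "components Atl c x B =
     (\<chi> j k. B (coord_vec Atl c x (axis j 1)) (coord_vec Atl c x (axis k 1)))"

definition riemannian_metric ::
  "'a topology \<Rightarrow> ('a, 'n::finite) chart set \<Rightarrow> ('a \<Rightarrow> ('a, 'n) bform) \<Rightarrow> bool" where
  "riemannian_metric X Atl g \<longleftrightarrow>
     (\<forall>x\<in>topspace X. sym_bilinear_at Atl x (g x) \<and>
        (\<forall>v\<in>tangent_space Atl x. v \<noteq> (\<lambda>_. 0) \<longrightarrow> g x v v > 0)) \<and>
     (\<forall>c\<in>Atl. smooth_on (\<lambda>y. components Atl c (chart_inv c y) (g (chart_inv c y)))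
                (chart_image c))"

text \<open>Smoothness on \<open>T\<^sup>*M \<times> \<real>\<close> is smoothness in the induced coordinates \<open>(y, \<xi>, t)\<close>.\<close>

definition smooth_cotangent_scalar ::
  "('a, 'n::finite) chart set \<Rightarrow> ('a \<times> ('a, 'n) covec \<Rightarrow> real \<Rightarrow> real) \<Rightarrow> bool" where
  "smooth_cotangent_scalar Atl \<phi> \<longleftrightarrow>
     (\<forall>c\<in>Atl. smooth_on
        (\<lambda>(y, \<xi>, t). let x = chart_inv c y in \<phi> (x, coord_covec Atl c x \<xi>) t)
        (chart_image c \<times> UNIV \<times> UNIV))"

definition smooth_cotangent_bform ::
  "('a, 'n::finite) chart set \<Rightarrow> ('a \<times> ('a, 'n) covec \<Rightarrow> real \<Rightarrow> ('a, 'n) bform) \<Rightarrow> bool" where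
  "smooth_cotangent_bform Atl A \<longleftrightarrow>
     (\<forall>c\<in>Atl. smooth_on
        (\<lambda>(y, \<xi>, t). let x = chart_inv c y in
           components Atl c x (A (x, coord_covec Atl c x \<xi>) t))
        (chart_image c \<times> UNIV \<times> UNIV))"

definition metric_matrix ::
  "('a, 'n::finite) chart set \<Rightarrow> ('a \<Rightarrow> ('a, 'n) bform) \<Rightarrow> ('a, 'n) chart \<Rightarrow> 'a \<Rightarrow> real^'n^'n" where
  "metric_matrix Atl g c x = components Atl c x (g x)"

text \<open>The Christoffel symbol \<open>\<Gamma>\<^sup>k\<^sub>i\<^sub>j\<close> of the Levi-Civita connection in the chart \<open>c\<close>.\<close>

definition christoffel ::
  "('a, 'n::finite) chart set \<Rightarrow> ('a \<Rightarrow> ('a, 'n) bform) \<Rightarrow> ('a, 'n) chart \<Rightarrow> 'a \<Rightarrow>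
   'n \<Rightarrow> 'n \<Rightarrow> 'n \<Rightarrow> real" where
  "christoffel Atl g c x k i j =
     (let y = snd c x; G = (\<lambda>z. metric_matrix Atl g c (chart_inv c z)) in
      (1/2) * (\<Sum>l\<in>UNIV. matrix_inv (G y) $ k $ l *
        (partial_deriv i (\<lambda>z. G z $ j $ l) y + partial_deriv j (\<lambda>z. G z $ i $ l) y
         - partial_deriv l (\<lambda>z. G z $ i $ j) y)))"

text \<open>Components of the Hessian \<open>\<nabla>\<^sup>2u = \<nabla>du\<close> at \<open>x\<close> in the chart \<open>c\<close>.\<close>

definition hessian ::
  "('a, 'n::finite) chart set \<Rightarrow> ('a \<Rightarrow> ('a, 'n) bform) \<Rightarrow> ('a \<Rightarrow> real) \<Rightarrow>
   ('a, 'n) chart \<Rightarrow> 'a \<Rightarrow> real^'n^'n" where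
  "hessian Atl g u c x =
     (let y = snd c x; f = u \<circ> chart_inv c in
      (\<chi> i j. partial_deriv i (partial_deriv j f) y
         - (\<Sum>k\<in>UNIV. christoffel Atl g c x k i j * partial_deriv k f y)))"


section \<open>Eigenvalues, elementary symmetric functions and the equation\<close>

text \<open>Vectors \<open>\<mu>\<close> of \<open>\<real>\<^sup>n\<close> whose entries have to be ordered are lists of length \<open>n\<close>.\<close>

definition sigma :: "nat \<Rightarrow> real list \<Rightarrow> real" where
  "sigma p \<mu> = (\<Sum>J | J \<subseteq> {..<length \<mu>} \<and> card J = p. \<Prod>j\<in>J. \<mu> ! j)"

definition Gamma_cone :: "nat \<Rightarrow> nat \<Rightarrow> real list set" where
  "Gamma_cone n p = {\<mu>. length \<mu> = n \<and> (\<forall>q\<in>{1..p}. sigma q \<mu> > 0)}"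

definition char_polynomial :: "real^'n^'n \<Rightarrow> real poly" where
  "char_polynomial B = det (\<chi> i j. (if i = j then [:0, 1:] else 0) - [:B $ i $ j:])"

text \<open>Real eigenvalues with algebraic multiplicity, in non-decreasing order.\<close>

definition eigenvalues :: "real^'n^'n \<Rightarrow> real list" where
  "eigenvalues B = sorted_list_of_multiset (proots (char_polynomial B))"

text \<open>\<open>\<lambda>(g\<^sup>-\<^sup>1(A(du,u) + \<nabla>\<^sup>2u))(x)\<close> computed in the chart \<open>c\<close>.\<close>

definition hessian_eigenvalues ::
  "('a, 'n::finite) chart set \<Rightarrow> ('a \<Rightarrow> ('a, 'n) bform) \<Rightarrow>
   ('a \<times> ('a, 'n) covec \<Rightarrow> real \<Rightarrow> ('a, 'n) bform) \<Rightarrow> ('a \<Rightarrow> real) \<Rightarrow>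
   ('a, 'n) chart \<Rightarrow> 'a \<Rightarrow> real list" where
  "hessian_eigenvalues Atl g A u c x =
     eigenvalues (matrix_inv (metric_matrix Atl g c x) **
       (components Atl c x (A (x, differential Atl u x) (u x)) + hessian Atl g u c x))"

text \<open>The equation and the inequality are required in every chart around every point; as the
  eigenvalues do not depend on the chart, it is the same to require them in one chart.\<close>

definition p_hessian_solution ::
  "nat \<Rightarrow> ('a, 'n::finite) chart set \<Rightarrow> ('a \<Rightarrow> ('a, 'n) bform) \<Rightarrow>
   ('a \<times> ('a, 'n) covec \<Rightarrow> real \<Rightarrow> ('a, 'n) bform) \<Rightarrow>
   ('a \<times> ('a, 'n) covec \<Rightarrow> real \<Rightarrow> real) \<Rightarrow> ('a \<Rightarrow> real) \<Rightarrow> bool" where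
  "p_hessian_solution p Atl g A \<phi> u \<longleftrightarrow>
     (\<forall>c\<in>Atl. \<forall>x\<in>fst c.
        root p (sigma p (hessian_eigenvalues Atl g A u c x)) = \<phi> (x, differential Atl u x) (u x) \<and>
        hessian_eigenvalues Atl g A u c x \<in> Gamma_cone CARD('n) p)"

definition p_hessian_subsolution ::
  "nat \<Rightarrow> ('a, 'n::finite) chart set \<Rightarrow> ('a \<Rightarrow> ('a, 'n) bform) \<Rightarrow>
   ('a \<times> ('a, 'n) covec \<Rightarrow> real \<Rightarrow> ('a, 'n) bform) \<Rightarrow>
   ('a \<times> ('a, 'n) covec \<Rightarrow> real \<Rightarrow> real) \<Rightarrow> ('a \<Rightarrow> real) \<Rightarrow> bool" where
  "p_hessian_subsolution p Atl g A \<phi> u \<longleftrightarrow>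
     (\<forall>c\<in>Atl. \<forall>x\<in>fst c.
        root p (sigma p (hessian_eigenvalues Atl g A u c x)) \<ge> \<phi> (x, differential Atl u x) (u x) \<and>
        hessian_eigenvalues Atl g A u c x \<in> Gamma_cone CARD('n) p)"

end

theory Submission
  imports Defs
begin

text \<open>
  Let \<open>w\<close> be the subsolution minus the solution. On the compact manifold \<open>w\<close> attains its maximum,
  and the contact set where it does so is closed; if it is also open, connectedness makes \<open>w\<close>
  constant. Openness is local, so it is proved in one chart (\<open>contact_set_open\<close>), by the barrier
  argument of Hopf applied directly to the nonlinear equation rather than to a linear equation for
  \<open>w\<close>.

  In a chart the equation reads \<open>F(y, Df, D\<^sup>2f) = 0\<close>, where \<open>F\<close> is the \<open>p\<close>-th symmetric function of
  the eigenvalues minus the \<open>p\<close>-th power of the right-hand side. Because \<open>A\<close> and \<open>\<phi>\<close> are independent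
  of \<open>t\<close>, only derivatives of the unknown enter, so that the equation does not distinguish \<open>f\<close> from
  \<open>f + K\<close>, where \<open>K\<close> is the maximum of \<open>w\<close>. Suppose the contact set is not open.
  Then some closed ball touches it in exactly one boundary point \<open>y\<^sub>0\<close>. For a barrier \<open>b\<close> which
  vanishes on the sphere and has large Hessian in the radial direction, \<open>w + \<epsilon>b\<close> has an interior
  local maximum near \<open>y\<^sub>0\<close>. There the subsolution has the gradient of \<open>f - \<epsilon>b\<close> and a Hessian that is
  at most that of \<open>f - \<epsilon>b\<close>, so \<open>F\<close> is nonnegative at the 2-jet of \<open>f - \<epsilon>b\<close> by monotonicity in
  the Hessian. On the other hand \<open>F\<close> vanishes at the 2-jet of \<open>f\<close>, and strictly decreases along
  \<open>f - sb\<close> since its derivative in the direction of the radial Hessian is strictly positive and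
  outweighs all other terms.

  What has to be known about \<open>F\<close> is therefore ellipticity: monotonicity under adding a positive
  semidefinite matrix to an admissible one, with strictly positive derivative in nonzero rank-one
  directions. The metric and the augmented Hessian are diagonalized simultaneously, and a rank-one
  perturbation changes the \<open>p\<close>-th symmetric function by an exactly linear amount whose slope is a
  nonnegative combination of the numbers \<open>\<sigma>\<^sub>p\<^sub>-\<^sub>1(\<lambda>|i)\<close>, where \<open>\<lambda>|i\<close> omits the \<open>i\<close>-th eigenvalue
  (\<open>matrix_sigma_rank_one\<close>). On the cone \<open>\<Gamma>\<^sub>p\<close> these numbers are positive, which is an induction on
  the number of variables carried out together with Newton's inequality (\<open>elem_sym_cone\<close>). Every
  positive semidefinite matrix is a sum of rank-one ones, so monotonicity follows
  (\<open>matrix_sigma_mono_psd\<close>).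
\<close>

section \<open>Elementary symmetric functions and their positivity cones\<close>

text \<open>The elementary symmetric function of the numbers \<open>x j\<close>, \<open>j \<in> J\<close>, as a coefficient of
  \<open>\<Prod>j. (1 + x j t)\<close>: removing a variable then is division by a linear factor, which gives the
  recursion below, and the same generating function appears as a determinant for matrices.\<close>

definition elem_sym :: "('i \<Rightarrow> real) \<Rightarrow> 'i set \<Rightarrow> nat \<Rightarrow> real" where
  "elem_sym x J q = coeff (\<Prod>j\<in>J. [:1, x j:]) q"

lemma elem_sym_0 [simp]: "elem_sym x J 0 = 1"
  by (induction J rule: infinite_finite_induct) (auto simp: elem_sym_def)

lemma elem_sym_empty: "elem_sym x {} (Suc q) = 0"
  by (simp add: elem_sym_def)

lemma elem_sym_remove:
  assumes "finite J" "i \<in> J"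
  shows "elem_sym x J (Suc q) = elem_sym x (J - {i}) (Suc q) + x i * elem_sym x (J - {i}) q"
proof -
  have "(\<Prod>j\<in>J. [:1, x j:]) = [:1, x i:] * (\<Prod>j\<in>J - {i}. [:1, x j:])"
    using assms by (rule prod.remove)
  then show ?thesis
    by (simp add: elem_sym_def)
qed

lemma elem_sym_insert:
  assumes "finite J" "i \<notin> J"
  shows "elem_sym x (insert i J) (Suc q) = elem_sym x J (Suc q) + x i * elem_sym x J q"
  using elem_sym_remove[of "insert i J" i x q] assms by simp

lemma elem_sym_1: "finite J \<Longrightarrow> elem_sym x J (Suc 0) = sum x J"
  by (induction J rule: finite_induct) (auto simp: elem_sym_empty elem_sym_insert)

lemma elem_sym_nonneg:
  assumes "finite J" "\<forall>j\<in>J. 0 \<le> x j"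
  shows "0 \<le> elem_sym x J q"
  using assms
proof (induction J arbitrary: q rule: finite_induct)
  case empty
  then show ?case by (cases q) (auto simp: elem_sym_empty)
next
  case (insert i J)
  then show ?case by (cases q) (auto simp: elem_sym_insert)
qed

text \<open>If all variables are nonnegative, some product of \<open>q + 1\<close> of them is positive, hence so is a
  product of \<open>q\<close> of them.\<close>

lemma elem_sym_pos_decrease:
  assumes "finite J" "\<forall>j\<in>J. 0 \<le> x j" "0 < elem_sym x J (Suc q)"
  shows "0 < elem_sym x J q"
  using assms
proof (induction J arbitrary: q rule: finite_induct)
  case empty
  then show ?case by (auto simp: elem_sym_empty)
next
  case (insert i J)
  have nn: "0 \<le> elem_sym x J r" for r
    using insert.prems insert.hyps(1) by (intro elem_sym_nonneg) auto
  have "0 < elem_sym x J q"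
  proof (rule ccontr)
    assume "\<not> 0 < elem_sym x J q"
    then have "elem_sym x J q = 0" "elem_sym x J (Suc q) = 0"
      using nn[of q] nn[of "Suc q"] insert.IH[of q] insert.prems by (auto simp: less_le)
    then show False
      using insert.prems insert.hyps by (simp add: elem_sym_insert)
  qed
  then show ?case
    using nn insert.prems insert.hyps by (cases q) (auto simp: elem_sym_insert intro!: add_pos_nonneg)
qed

text \<open>Solving the recursion for the smaller index set gives
  \<open>\<sigma>\<^sub>q\<^sub>+\<^sub>1(x|i) = \<sigma>\<^sub>q\<^sub>+\<^sub>1(x) - x\<^sub>i \<sigma>\<^sub>q(x|i)\<close>, and subtracting the last term is a gain because \<open>x\<^sub>i \<le> 0\<close>.\<close>

lemma elem_sym_remove_nonpos_ge:
  assumes "finite J" "i \<in> J" "x i \<le> 0" "\<forall>q\<le>k. 0 < elem_sym x J q" "q \<le> k"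
  shows "elem_sym x J q \<le> elem_sym x (J - {i}) q"
  using \<open>q \<le> k\<close>
proof (induction q)
  case (Suc q)
  have "0 < elem_sym x (J - {i}) q"
    using Suc assms(4) by (meson Suc_leD less_le_trans)
  then show ?case
    using elem_sym_remove[OF assms(1,2), of x q] assms(3) by (simp add: mult_nonpos_nonneg)
qed simp

text \<open>The two statements support each other in an induction on the number of variables. Removing a
  positive variable in the presence of a negative one uses Newton's inequality for fewer variables,
  and Newton's inequality is inherited when a positive variable is added back because the cone
  condition, of order lower by one, survives its removal. For arbitrary
  real numbers Newton's inequality is usually deduced from Rolle's theorem.\<close>

lemma elem_sym_cone:
  assumes "finite J" "\<forall>q\<le>k. 0 < elem_sym x J q"
  shows "(\<forall>i\<in>J. \<forall>q<k. 0 < elem_sym x (J - {i}) q) \<and>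
         (\<forall>q. Suc q < k \<longrightarrow> elem_sym x J q * elem_sym x J (Suc (Suc q)) \<le> (elem_sym x J (Suc q))\<^sup>2)"
  using assms
proof (induction "card J" arbitrary: J k rule: less_induct)
  case less
  note fin = \<open>finite J\<close> and pos = \<open>\<forall>q\<le>k. 0 < elem_sym x J q\<close>
  \<comment> \<open>If the second factor on the left is not positive, the inequality is trivial; otherwise \<open>K\<close> lies in the
    cone of one order higher and the induction hypothesis applies.\<close>
  have newton: "elem_sym x K q * elem_sym x K (Suc (Suc q)) \<le> (elem_sym x K (Suc q))\<^sup>2"
    if "K \<subset> J" and "\<forall>r\<le>Suc q. 0 < elem_sym x K r" for K q
  proof (cases "0 < elem_sym x K (Suc (Suc q))")
    case True
    then have "\<forall>r\<le>Suc (Suc q). 0 < elem_sym x K r"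
      using that(2) le_Suc_eq by blast
    moreover have "card K < card J"
      using that(1) fin by (rule psubset_card_mono[rotated])
    moreover have "finite K"
      using that(1) fin finite_subset by blast
    ultimately show ?thesis
      using less.hyps[of K "Suc (Suc q)"] by simp
  next
    case False
    then have "elem_sym x K q * elem_sym x K (Suc (Suc q)) \<le> 0"
      using that(2) by (intro mult_nonneg_nonpos) (auto intro!: less_imp_le)
    also have "0 \<le> (elem_sym x K (Suc q))\<^sup>2" by simp
    finally show ?thesis .
  qed
  have remove_pos: "0 < elem_sym x (J - {i}) q" if "i \<in> J" "q < k" for i q
  proof (cases "x i \<le> 0")
    case True
    then show ?thesis
      using elem_sym_remove_nonpos_ge[OF fin that(1) True pos, of q] pos[rule_format, of q] that(2)
      by linarith
  next
    case False
    then have xi: "0 < x i" by simp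
    show ?thesis
    proof (cases "\<forall>j\<in>J - {i}. 0 \<le> x j")
      case True
      have "0 < elem_sym x J (Suc q)"
        using pos that(2) by simp
      then have "0 < elem_sym x J q"
        by (rule elem_sym_pos_decrease[OF fin, rotated]) (metis DiffI True less_imp_le singletonD xi)
      have nn: "0 \<le> elem_sym x (J - {i}) r" for r
        using True fin by (intro elem_sym_nonneg) auto
      show ?thesis
      proof (rule ccontr)
        assume "\<not> 0 < elem_sym x (J - {i}) q"
        then have "elem_sym x (J - {i}) q = 0" "elem_sym x (J - {i}) (Suc q) = 0"
          using nn[of q] nn[of "Suc q"] elem_sym_pos_decrease[of "J - {i}" x q] True fin
          by (auto simp: less_le)
        then show False
          using \<open>0 < elem_sym x J (Suc q)\<close> elem_sym_remove[OF fin that(1), of x q] by simp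
      qed
    next
      case False
      then obtain j where j: "j \<in> J" "j \<noteq> i" "x j < 0"
        by (auto simp: not_le)
      define K where "K = J - {j}"
      have "K \<subset> J" using j unfolding K_def by blast
      then have K: "finite K" "i \<in> K" "card K < card J" "K - {i} \<subset> J" "J - {i} - {j} = K - {i}"
        using j that fin psubset_card_mono[OF fin] unfolding K_def by blast+
      have "\<forall>r\<le>k. 0 < elem_sym x K r"
      proof (intro allI impI)
        fix r assume "r \<le> k"
        then show "0 < elem_sym x K r"
          using elem_sym_remove_nonpos_ge[OF fin j(1) less_imp_le[OF j(3)] pos, of r]
            pos[rule_format, of r] unfolding K_def by linarith
      qed
      then have b: "0 < elem_sym x (K - {i}) r" if "r < k" for r
        using less.hyps[OF K(3) K(1), of k] K(2) that by blast
      show ?thesis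
      proof (cases q)
        case (Suc r)
        define b where "b = elem_sym x (K - {i})"
        have bpos: "0 < b r" "0 < b (Suc r)"
          using b that(2) Suc unfolding b_def by auto
        have a: "elem_sym x (J - {i}) (Suc s) = b (Suc s) + x j * b s" for s
          using elem_sym_remove[of "J - {i}" j x s] j fin K(5) unfolding b_def by simp
        have e: "0 < b (Suc (Suc r)) + x j * b (Suc r) + x i * (b (Suc r) + x j * b r)"
          using elem_sym_remove[OF fin that(1), of x "Suc r"] a pos[rule_format, of "Suc (Suc r)"] that(2) Suc
          by simp
        have N: "b r * b (Suc (Suc r)) \<le> (b (Suc r))\<^sup>2"
          unfolding b_def
          by (rule newton[OF K(4)]) (use b that(2) Suc in auto)
        have "0 < b (Suc r) + x j * b r"
        proof (rule ccontr)
          assume neg: "\<not> 0 < b (Suc r) + x j * b r"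
          then have "x i * (b (Suc r) + x j * b r) \<le> 0"
            using xi by (intro mult_nonneg_nonpos) auto
          then have "- x j * b (Suc r) < b (Suc (Suc r))"
            using e by simp
          then have "b r * (- x j * b (Suc r)) < b r * b (Suc (Suc r))"
            using bpos(1) by (rule mult_strict_left_mono)
          moreover have "b (Suc r) * b (Suc r) \<le> b (Suc r) * (- x j * b r)"
            using neg bpos by (intro mult_left_mono) auto
          ultimately show False
            using N by (simp add: power2_eq_square algebra_simps)
        qed
        then show ?thesis using a Suc by simp
      qed simp
    qed
  qed
  have "elem_sym x J q * elem_sym x J (Suc (Suc q)) \<le> (elem_sym x J (Suc q))\<^sup>2" if q: "Suc q < k" for q
  proof -
    have "0 < sum x J"
      using pos[rule_format, of "Suc 0"] q elem_sym_1[OF fin, of x] by simp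
    then obtain i where i: "i \<in> J" "0 < x i"
      by (meson not_le sum_nonpos)
    define a where "a = elem_sym x (J - {i})"
    have psub: "J - {i} \<subset> J" using i by auto
    have apos: "0 < a r" if "r \<le> Suc q" for r
      using remove_pos[OF i(1), of r] that q unfolding a_def by simp
    have e: "elem_sym x J (Suc s) = a (Suc s) + x i * a s" for s
      using elem_sym_remove[OF fin i(1)] unfolding a_def by simp
    have N: "a s * a (Suc (Suc s)) \<le> (a (Suc s))\<^sup>2" if "s \<le> q" for s
      unfolding a_def by (rule newton[OF psub]) (use apos that in \<open>auto simp: a_def\<close>)
    show ?thesis
    proof (cases q)
      case 0
      have "0 \<le> x i * x i + x i * a (Suc 0)"
        using apos[of "Suc 0"] 0 i by simp
      then show ?thesis
        using N[of 0] 0 e[of 0] e[of "Suc 0"]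
        by (simp add: power2_eq_square algebra_simps a_def)
    next
      case (Suc r)
      have mixed: "a r * a (Suc (Suc (Suc r))) \<le> a (Suc r) * a (Suc (Suc r))"
      proof (cases "0 < a (Suc (Suc (Suc r)))")
        case True
        have "(a r * a (Suc (Suc r))) * (a (Suc r) * a (Suc (Suc (Suc r))))
              \<le> (a (Suc r))\<^sup>2 * (a (Suc (Suc r)))\<^sup>2"
          using N[of r] N[of "Suc r"] Suc apos[of r] apos[of "Suc r"] apos[of "Suc (Suc r)"] True
          by (intro mult_mono) auto
        then have "(a (Suc r) * a (Suc (Suc r))) * (a r * a (Suc (Suc (Suc r))))
              \<le> (a (Suc r) * a (Suc (Suc r))) * (a (Suc r) * a (Suc (Suc r)))"
          by (simp add: power2_eq_square algebra_simps)
        then show ?thesis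
          using apos[of "Suc r"] apos[of "Suc (Suc r)"] Suc by simp
      next
        case False
        then have "a r * a (Suc (Suc (Suc r))) \<le> 0"
          using apos[of r] Suc by (intro mult_nonneg_nonpos) auto
        also have "0 \<le> a (Suc r) * a (Suc (Suc r))"
          using apos[of "Suc r"] apos[of "Suc (Suc r)"] Suc by simp
        finally show ?thesis .
      qed
      have "0 \<le> ((a (Suc (Suc r)))\<^sup>2 - a (Suc r) * a (Suc (Suc (Suc r))))
              + x i * (a (Suc r) * a (Suc (Suc r)) - a r * a (Suc (Suc (Suc r))))
              + (x i)\<^sup>2 * ((a (Suc r))\<^sup>2 - a r * a (Suc (Suc r)))"
        using N[of r] N[of "Suc r"] Suc mixed i by (intro add_nonneg_nonneg mult_nonneg_nonneg) auto
      also have "\<dots> = (elem_sym x J (Suc q))\<^sup>2 - elem_sym x J q * elem_sym x J (Suc (Suc q))"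
        unfolding Suc e by (simp add: power2_eq_square algebra_simps)
      finally show ?thesis by simp
    qed
  qed
  with remove_pos show ?case by blast
qed

lemma sigma_eq_elem_sym: "sigma p xs = elem_sym (\<lambda>j. xs ! j) {..<length xs} p"
proof -
  let ?A = "{..<length xs}"
  have "(\<Prod>j\<in>?A. [:1, xs ! j:]) = (\<Prod>j\<in>?A. [:0, xs ! j:] + 1)"
    by (intro prod.cong refl poly_eqI) (simp add: coeff_pCons split: nat.split)
  also have "\<dots> = (\<Sum>B\<in>Pow ?A. (\<Prod>j\<in>B. [:0, xs ! j:]) * (\<Prod>j\<in>?A - B. 1))"
    by (intro prod_add) simp
  also have "\<dots> = (\<Sum>B\<in>Pow ?A. monom (\<Prod>j\<in>B. xs ! j) (card B))"
  proof (intro sum.cong refl)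
    fix B assume "B \<in> Pow ?A"
    have *: "[:0, c:] = monom c 1" for c :: real
      by (simp add: monom_Suc monom_0)
    have "(\<Prod>j\<in>B. [:0, xs ! j:]) = monom (\<Prod>j\<in>B. xs ! j) (card B)"
      unfolding *
      by (induction B rule: infinite_finite_induct) (auto simp: mult_monom)
    then show "(\<Prod>j\<in>B. [:0, xs ! j:]) * (\<Prod>j\<in>?A - B. 1) = monom (\<Prod>j\<in>B. xs ! j) (card B)"
      by simp
  qed
  finally have "elem_sym (\<lambda>j. xs ! j) ?A p = (\<Sum>B\<in>Pow ?A. if card B = p then \<Prod>j\<in>B. xs ! j else 0)"
    unfolding elem_sym_def by (simp add: coeff_sum)
  also have "\<dots> = sigma p xs"
    unfolding sigma_def by (simp add: sum.If_cases Int_def Pow_def conj_commute)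
  finally show ?thesis by simp
qed

text \<open>Eigenvalues are listed in non-decreasing order, but symmetric functions see only the multiset.\<close>

lemma sigma_mset:
  assumes "finite J" "mset xs = image_mset x (mset_set J)"
  shows "sigma p xs = elem_sym x J p"
proof -
  have "(\<Prod>j\<in>{..<length xs}. [:1, xs ! j:]) = prod_list (map (\<lambda>y. [:1, y:]) xs)"
    by (simp add: prod.list_conv_set_nth atLeast0LessThan)
  also have "\<dots> = prod_mset (image_mset (\<lambda>y. [:1, y:]) (mset xs))"
    by (metis mset_map prod_mset_prod_list)
  also have "\<dots> = (\<Prod>j\<in>J. [:1, x j:])"
    unfolding assms(2) by (simp add: prod_unfold_prod_mset comp_def image_mset.compositionality)
  finally show ?thesis
    by (simp add: sigma_eq_elem_sym elem_sym_def)
qed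

section \<open>Spectral theorem and simultaneous diagonalization\<close>

text \<open>A maximizer \<open>x\<close> of the quadratic form on the unit sphere of \<open>S\<close> is an eigenvector, and its
  orthogonal complement in \<open>S\<close> is again invariant; induction on the dimension yields an orthonormal
  eigenbasis.\<close>

lemma spectral_subspace:
  fixes f :: "'a::euclidean_space \<Rightarrow> 'a"
  assumes f: "linear f" and sym: "\<And>x y. x \<bullet> f y = f x \<bullet> y"
    and S: "subspace S" "f ` S \<subseteq> S"
  shows "\<exists>B\<subseteq>S. finite B \<and> card B = dim S \<and> pairwise orthogonal B \<and>
           (\<forall>b\<in>B. norm b = 1 \<and> (\<exists>l. f b = l *\<^sub>R b))"
  using S
proof (induction "dim S" arbitrary: S)
  case 0
  then show ?case by (intro exI[of _ "{}"]) auto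
next
  case (Suc d)
  note subS = \<open>subspace S\<close>
  interpret f: linear f by fact
  have "\<not> S \<subseteq> {0}"
    using Suc.hyps(2) dim_eq_0[of S] by (metis Zero_not_Suc)
  then obtain x0 where x0: "x0 \<in> S" "x0 \<noteq> 0" by blast
  have "x0 /\<^sub>R norm x0 \<in> sphere 0 1 \<inter> S"
    using x0 subS by (simp add: subspace_scale)
  moreover have "compact (sphere 0 1 \<inter> S)"
    using closed_subspace[OF subS] by (intro compact_Int_closed) auto
  moreover have "continuous_on (sphere 0 1 \<inter> S) (\<lambda>x. x \<bullet> f x)"
    using linear_continuous_on[of f] f by (intro continuous_intros) (auto simp: linear_linear)
  ultimately obtain x where x: "x \<in> sphere 0 1 \<inter> S"
    and max: "\<And>y. y \<in> sphere 0 1 \<inter> S \<Longrightarrow> y \<bullet> f y \<le> x \<bullet> f x"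
    using continuous_attains_sup[of "sphere 0 1 \<inter> S" "\<lambda>x. x \<bullet> f x"] by blast
  define l where "l = x \<bullet> f x"
  have xS: "x \<in> S" and xx: "x \<bullet> x = 1" "norm x = 1"
    using x by (auto simp: norm_eq_1)
  have ray: "z \<bullet> f z \<le> l * (z \<bullet> z)" if "z \<in> S" for z
  proof (cases "z = 0")
    case False
    have "z /\<^sub>R norm z \<in> sphere 0 1 \<inter> S"
      using that False subS by (simp add: subspace_scale)
    from max[OF this] show ?thesis
      using False unfolding l_def
      by (simp add: f.scaleR dot_square_norm field_simps power2_eq_square)
  qed (simp add: f.zero)
  \<comment> \<open>First variation: comparing \<open>x\<close> with \<open>x + t y\<close>, the term linear in \<open>t\<close> has to vanish.\<close>
  have orth: "x \<bullet> f y = 0" if y: "y \<in> S" "x \<bullet> y = 0" for y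
  proof (rule ccontr)
    define b where "b = x \<bullet> f y"
    define c where "c = l * (y \<bullet> y) - y \<bullet> f y"
    assume "x \<bullet> f y \<noteq> 0"
    then have b: "b\<^sup>2 > 0" by (simp add: b_def)
    have c: "c \<ge> 0" using ray[OF y(1)] by (simp add: c_def)
    have "2 * t * b \<le> t\<^sup>2 * c" for t
    proof -
      have "x + t *\<^sub>R y \<in> S"
        using subS xS y by (intro subspace_add subspace_scale)
      from ray[OF this] show ?thesis
        using y(2) sym[of y x] xx unfolding b_def c_def l_def
        by (simp add: f.add f.scaleR algebra_simps power2_eq_square inner_commute)
    qed
    moreover define t where "t = b / (c + 1)"
    moreover have "b = t * (c + 1)" using c by (simp add: t_def)
    ultimately have "t\<^sup>2 * (2 * (c + 1)) \<le> t\<^sup>2 * c"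
      by (metis mult.assoc mult.commute power2_eq_square)
    moreover have "0 < t\<^sup>2"
      using b c by (simp add: t_def)
    ultimately have "2 * (c + 1) \<le> c" by (simp only: mult_le_cancel_left_pos)
    then show False using c by simp
  qed
  define w where "w = f x - l *\<^sub>R x"
  have "w \<in> S"
    unfolding w_def using xS Suc.prems by (intro subspace_diff subspace_scale) auto
  moreover have xw: "x \<bullet> w = 0"
    unfolding w_def l_def using xx by (simp add: inner_diff_right)
  ultimately have "w \<bullet> w = 0"
    using orth[of w] sym[of x w] unfolding w_def
    by (simp add: inner_diff_left inner_diff_right inner_commute)
  then have eig: "f x = l *\<^sub>R x" by (simp add: w_def)
  define S' where "S' = {y \<in> S. \<forall>z\<in>span {x}. orthogonal z y}"
  have S'_iff: "y \<in> S' \<longleftrightarrow> y \<in> S \<and> x \<bullet> y = 0" for y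
    unfolding S'_def by (auto simp: span_singleton orthogonal_def)
  have "dim S' + dim (span {x}) = dim S"
    unfolding S'_def using xS subS
    by (intro dim_subspace_orthogonal_to_vectors) (auto simp: span_minimal)
  moreover have "dim (span {x}) = 1"
    using xx by (auto simp: dim_insert)
  ultimately have d: "d = dim S'" "dim S = Suc (dim S')" using Suc.hyps(2) by simp_all
  have "subspace S'"
    using subS by (auto simp: subspace_def S'_iff inner_add_right)
  moreover have "f ` S' \<subseteq> S'"
    using orth Suc.prems by (auto simp: S'_iff image_subset_iff)
  ultimately obtain B where B: "B \<subseteq> S'" "finite B" "card B = dim S'" "pairwise orthogonal B"
      "\<forall>b\<in>B. norm b = 1 \<and> (\<exists>l. f b = l *\<^sub>R b)"
    using Suc.hyps(1)[OF d(1)] by blast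
  have "x \<notin> B" using B(1) xx by (auto simp: S'_iff)
  moreover have "pairwise orthogonal (insert x B)"
    using B(1,4) by (auto simp: pairwise_insert S'_iff orthogonal_def inner_commute)
  ultimately show ?case
    using B xS eig xx d by (intro exI[of _ "insert x B"]) (auto simp: S'_iff)
qed

definition diag :: "('n \<Rightarrow> 'a::zero) \<Rightarrow> 'a^'n^'n" where
  "diag d = (\<chi> i j. if i = j then d i else 0)"

definition outer :: "'a::times^'n \<Rightarrow> 'a^'n^'n" where
  "outer v = (\<chi> i j. v $ i * v $ j)"

lemma congruence_component:
  fixes Q X :: "real^'n^'n"
  shows "(transpose Q ** X ** Q) $ i $ j = column i Q \<bullet> (X *v column j Q)"
proof -
  have "(transpose Q ** X ** Q) $ i $ j = (\<Sum>k\<in>UNIV. (\<Sum>l\<in>UNIV. Q $ l $ i * X $ l $ k) * Q $ k $ j)"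
    by (simp add: matrix_matrix_mult_def transpose_def)
  also have "\<dots> = (\<Sum>l\<in>UNIV. Q $ l $ i * (\<Sum>k\<in>UNIV. X $ l $ k * Q $ k $ j))"
    unfolding sum_distrib_left sum_distrib_right by (subst sum.swap) (simp add: mult_ac)
  also have "\<dots> = column i Q \<bullet> (X *v column j Q)"
    by (simp add: inner_vec_def column_def matrix_vector_mult_def)
  finally show ?thesis .
qed

lemma spectral_theorem:
  fixes W :: "real^'n^'n"
  assumes "transpose W = W"
  obtains Q l where "orthogonal_matrix Q" "transpose Q ** W ** Q = diag l"
proof -
  have sym: "x \<bullet> (W *v y) = (W *v x) \<bullet> y" for x y
    using assms by (metis dot_lmul_matrix transpose_matrix_vector)
  obtain B where B: "finite B" "card B = CARD('n)" "pairwise orthogonal B"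
      "\<forall>b\<in>B. norm b = 1 \<and> (\<exists>l. W *v b = l *\<^sub>R b)"
    using spectral_subspace[of "(*v) W" UNIV] sym by auto
  obtain f where f: "bij_betw f (UNIV :: 'n set) B"
    using B finite_same_card_bij[of "UNIV :: 'n set" B] by auto
  have fB: "f i \<in> B" for i using f by (auto simp: bij_betw_def)
  have orth: "f i \<bullet> f j = (if i = j then 1 else 0)" for i j
  proof (cases "i = j")
    case True
    then show ?thesis using B(4) fB by (simp add: norm_eq_1)
  next
    case False
    then have "f i \<noteq> f j" using f by (auto simp: bij_betw_def inj_on_def)
    then show ?thesis using B(3) fB False by (simp add: pairwise_def orthogonal_def)
  qed
  have "\<forall>i. \<exists>l. W *v f i = l *\<^sub>R f i" using B(4) fB by blast
  then obtain l where l: "W *v f i = l i *\<^sub>R f i" for i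
    unfolding choice_iff by blast
  define Q where "Q = (\<chi> i j. f j $ i)"
  have col: "column j Q = f j" for j by (simp add: Q_def column_def vec_eq_iff)
  have "transpose Q ** Q = mat 1"
    by (simp add: matrix_mult_transpose_dot_column col orth mat_def vec_eq_iff)
  moreover have "transpose Q ** W ** Q = diag l"
    by (simp add: vec_eq_iff congruence_component col l orth diag_def)
  ultimately show thesis using that by (simp add: orthogonal_matrix)
qed

text \<open>Scaling the orthonormal eigenvectors by the square roots of the eigenvalues decomposes a positive
  semidefinite matrix into rank-one matrices; this reduces monotonicity to rank-one perturbations.\<close>

lemma psd_eq_sum_outer:
  fixes P :: "real^'n^'n"
  assumes "transpose P = P" and psd: "\<And>v. 0 \<le> v \<bullet> (P *v v)"
  obtains f where "P = (\<Sum>k\<in>(UNIV :: 'n set). outer (f k))"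
proof -
  obtain Q l where Q: "orthogonal_matrix Q" and D: "transpose Q ** P ** Q = diag l"
    using spectral_theorem[OF assms(1)] by blast
  have l: "0 \<le> l k" for k
    using psd[of "column k Q"] arg_cong[OF D, of "\<lambda>X. X $ k $ k"]
    by (simp add: congruence_component diag_def)
  have "P = Q ** diag l ** transpose Q"
    using Q unfolding D[symmetric] orthogonal_matrix_def
    by (metis matrix_mul_assoc matrix_mul_lid matrix_mul_rid)
  also have "\<dots> = (\<Sum>k\<in>UNIV. outer (sqrt (l k) *\<^sub>R column k Q))"
  proof -
    have "sqrt (l k) * a * (sqrt (l k) * b) = a * l k * b" for k a b
    proof -
      have "sqrt (l k) * a * (sqrt (l k) * b) = (sqrt (l k) * sqrt (l k)) * (a * b)"
        by (simp only: mult_ac)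
      then show ?thesis using l[of k] by simp
    qed
    then have "outer (sqrt (l k) *\<^sub>R column k Q) = (\<chi> i j. Q $ i $ k * l k * Q $ j $ k)" for k
      by (simp only: outer_def vector_scaleR_component column_def vec_lambda_beta real_scaleR_def)
    then show ?thesis
      by (simp add: vec_eq_iff matrix_matrix_mult_def diag_def transpose_def if_distrib cong: if_cong)
  qed
  finally show thesis by (rule that)
qed

text \<open>Diagonalize \<open>G\<close>, rescale to turn it into the identity, and diagonalize the transformed \<open>W\<close> by an
  orthogonal matrix, which leaves the identity unchanged.\<close>

lemma simultaneous_diagonalization:
  fixes G W :: "real^'n^'n"
  assumes G: "transpose G = G" "\<And>v. v \<noteq> 0 \<Longrightarrow> 0 < v \<bullet> (G *v v)" and W: "transpose W = W"
  obtains C :: "real^'n^'n" and l where "transpose C ** G ** C = mat 1" "transpose C ** W ** C = diag l"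
proof -
  obtain Q m where Q: "orthogonal_matrix Q" and D: "transpose Q ** G ** Q = diag m"
    using spectral_theorem[OF G(1)] by blast
  have m: "0 < m k" for k
  proof -
    have "column k Q \<noteq> 0"
      using Q by (metis norm_zero orthogonal_matrix_orthonormal_columns zero_neq_one)
    then show ?thesis
      using G(2)[of "column k Q"] arg_cong[OF D, of "\<lambda>X. X $ k $ k"]
      by (simp add: congruence_component diag_def)
  qed
  define R where "R = Q ** diag (\<lambda>k. 1 / sqrt (m k))"
  have tdiag: "transpose (diag d) = diag d" for d :: "'n \<Rightarrow> real"
    by (simp add: diag_def transpose_def vec_eq_iff)
  have mdiag: "diag d ** diag e = diag (\<lambda>k. d k * e k)" for d e :: "'n \<Rightarrow> real"
  proof -
    have "(if i = k then d i else 0) * (if k = j then e k else 0) =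
        (if k = i then if i = j then d i * e i else 0 else 0)" for i j k
      by simp
    then show ?thesis by (simp add: diag_def matrix_matrix_mult_def vec_eq_iff)
  qed
  have "transpose R ** G ** R = diag (\<lambda>k. 1 / sqrt (m k)) ** (transpose Q ** G ** Q) ** diag (\<lambda>k. 1 / sqrt (m k))"
    by (simp add: R_def matrix_transpose_mul tdiag matrix_mul_assoc)
  also have "\<dots> = mat 1"
  proof -
    have "1 / sqrt (m k) * m k * (1 / sqrt (m k)) = 1" for k
      using m[of k] by (simp add: less_imp_le)
    then show ?thesis unfolding D mdiag by (simp add: diag_def mat_def)
  qed
  finally have R: "transpose R ** G ** R = mat 1" .
  have "transpose (transpose R ** W ** R) = transpose R ** W ** R"
    by (simp add: matrix_transpose_mul W matrix_mul_assoc)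
  then obtain U l where U: "orthogonal_matrix U" "transpose U ** (transpose R ** W ** R) ** U = diag l"
    using spectral_theorem by blast
  have "transpose (R ** U) ** X ** (R ** U) = transpose U ** (transpose R ** X ** R) ** U" for X :: "real^'n^'n"
    by (simp add: matrix_transpose_mul matrix_mul_assoc)
  then show thesis
    using that[of "R ** U" l] R U by (simp add: orthogonal_matrix)
qed

section \<open>Symmetric functions of eigenvalues as functions of the matrix\<close>

text \<open>A permutation other than the identity moves an index outside row \<open>k\<close>, where it meets a zero of the
  diagonal part.\<close>

lemma det_diag_replace_row:
  fixes d c :: "'n::finite \<Rightarrow> 'a::comm_ring_1"
  shows "det (\<chi> i j. if i = k then c j else if i = j then d i else 0) = c k * prod d (UNIV - {k})"
proof -
  let ?M = "(\<chi> i j. if i = k then c j else if i = j then d i else 0) :: 'a^'n^'n"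
  have vanish: "(\<Prod>i\<in>UNIV. ?M $ i $ \<pi> i) = 0" if \<pi>: "\<pi> permutes UNIV" "\<pi> \<noteq> id" for \<pi>
  proof -
    have "\<exists>i. i \<noteq> k \<and> \<pi> i \<noteq> i"
    proof (rule ccontr)
      assume "\<not> ?thesis"
      then have fixed: "\<pi> i = i" if "i \<noteq> k" for i using that by blast
      then have "\<pi> k = k" using permutes_inj[OF \<pi>(1)] by (metis injD)
      then have "\<pi> = id" using fixed by (metis eq_id_iff)
      then show False using \<pi>(2) by simp
    qed
    then obtain i where "i \<noteq> k" "\<pi> i \<noteq> i" by blast
    then have "?M $ i $ \<pi> i = 0" by simp
    then show ?thesis by (intro prod_zero bexI[of _ i]) simp_all
  qed
  have "det ?M = (\<Sum>\<pi>\<in>{id}. of_int (sign \<pi>) * (\<Prod>i\<in>UNIV. ?M $ i $ \<pi> i))"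
    unfolding det_def
    by (intro sum.mono_neutral_right) (use vanish in \<open>auto simp: permutes_id finite_permutations\<close>)
  also have "\<dots> = (\<Prod>i\<in>UNIV. if i = k then c i else d i)"
    by (simp add: sign_id cong: if_cong)
  also have "\<dots> = c k * (\<Prod>i\<in>UNIV - {k}. if i = k then c i else d i)"
    by (subst prod.remove[of UNIV k]) simp_all
  also have "(\<Prod>i\<in>UNIV - {k}. if i = k then c i else d i) = prod d (UNIV - {k})"
    by (intro prod.cong) auto
  finally show ?thesis .
qed

text \<open>The matrix determinant lemma in a form that allows zeros on the diagonal and coefficients in any
  commutative ring. By linearity in one row at a time, only terms in which at most one row is taken
  from the rank-one part survive: once the row \<open>c\<close> itself is present, its multiples can be
  subtracted from all other rows.\<close>

lemma det_diag_plus_rank_one: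
  fixes d a c :: "'n::finite \<Rightarrow> 'a::comm_ring_1"
  shows "det (\<chi> i j. (if i = j then d i else 0) + a i * c j) =
    prod d UNIV + (\<Sum>i\<in>UNIV. a i * c i * prod d (UNIV - {i}))"
proof -
  define cv :: "'a^'n" where "cv = (\<chi> j. c j)"
  define e :: "'n \<Rightarrow> 'a^'n" where "e i = (\<chi> j. if i = j then d i else 0)" for i
  have replaced: "det (\<chi> i. if i = k then cv else if i \<in> K then e i + a i *s cv else e i)
      = c k * prod d (UNIV - {k})"
    if "finite K" "k \<notin> K" for k K
    using that
  proof (induction K rule: finite_induct)
    case empty
    have "(\<chi> i. if i = k then cv else e i) = (\<chi> i j. if i = k then c j else if i = j then d i else 0)"
      by (simp add: vec_eq_iff cv_def e_def)
    then show ?case using det_diag_replace_row[of k c d] by (simp only: empty_iff if_False)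
  next
    case (insert m K)
    define M where "M = (\<chi> i. if i = k then cv else if i \<in> K then e i + a i *s cv else e i)"
    have "(\<chi> i. if i = k then cv else if i \<in> insert m K then e i + a i *s cv else e i)
        = (\<chi> i. if i = m then row m M + a m *s row k M else row i M)"
      using insert by (auto simp: vec_eq_iff M_def row_def)
    also have "det \<dots> = det M"
      by (rule det_row_operation) (use insert in auto)
    finally show ?case using insert unfolding M_def by simp
  qed
  have "det (\<chi> i. if i \<in> K then e i + a i *s cv else e i) =
      prod d UNIV + (\<Sum>i\<in>K. a i * c i * prod d (UNIV - {i}))" if "finite K" for K
    using that
  proof (induction K rule: finite_induct)
    case empty
    have "det (\<chi> i. e i) = prod d UNIV"
      by (subst det_diagonal) (auto simp: e_def)
    then show ?case by simp
  next
    case (insert m K)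
    define N where "N = (\<lambda>i. if i \<in> K then e i + a i *s cv else e i)"
    have "(\<chi> i. if i \<in> insert m K then e i + a i *s cv else e i) =
        (\<chi> i. if i = m then e i + a m *s cv else N i)"
      using insert by (auto simp: vec_eq_iff N_def)
    also have "det \<dots> = det (\<chi> i. if i = m then e i else N i) + det (\<chi> i. if i = m then a m *s cv else N i)"
      by (rule det_row_add)
    also have "(\<chi> i. if i = m then e i else N i) = (\<chi> i. N i)"
      using insert by (auto simp: vec_eq_iff N_def)
    also have "det (\<chi> i. if i = m then a m *s cv else N i) = a m * det (\<chi> i. if i = m then cv else N i)"
      by (rule det_row_mul)
    also have "det (\<chi> i. if i = m then cv else N i) = c m * prod d (UNIV - {m})"
      unfolding N_def by (rule replaced) (use insert in auto)
    also have "det (\<chi> i. N i) = prod d UNIV + (\<Sum>i\<in>K. a i * c i * prod d (UNIV - {i}))"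
      unfolding N_def by (rule insert.IH)
    finally show ?case
      using insert by (simp add: mult.assoc add_ac)
  qed
  from this[of UNIV] have "det (\<chi> i. e i + a i *s cv) =
      prod d UNIV + (\<Sum>i\<in>UNIV. a i * c i * prod d (UNIV - {i}))" by simp
  also have "(\<chi> i. e i + a i *s cv) = (\<chi> i j. (if i = j then d i else 0) + a i * c j)"
    by (simp add: vec_eq_iff e_def cv_def)
  finally show ?thesis .
qed

text \<open>The coefficient of \<open>t\<^sup>p\<close> in \<open>det (1 + t B)\<close>: the \<open>p\<close>-th elementary symmetric function of the
  eigenvalues of \<open>B\<close>, but visibly a polynomial in the entries of \<open>B\<close>.\<close>

definition matrix_sigma :: "nat \<Rightarrow> real^'n^'n \<Rightarrow> real" where
  "matrix_sigma p B = coeff (det (\<chi> i j. [:if i = j then 1 else 0, B $ i $ j:])) p"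

lemma poly_det: "poly (det (\<chi> i j. P i j)) t = det (\<chi> i j. poly (P i j) t)"
  by (simp add: det_def poly_sum poly_prod poly_mult)

lemma matrix_add_rdistrib:
  fixes A B :: "'a::semiring_1^'n^'m"
  shows "(A + B) ** C = A ** C + B ** C"
  by (simp add: matrix_matrix_mult_def vec_eq_iff distrib_right sum.distrib)

lemma scaleR_matrix_mult:
  fixes A :: "real^'n^'m"
  shows "(k *\<^sub>R A) ** B = k *\<^sub>R (A ** B)" "A ** (k *\<^sub>R C) = k *\<^sub>R (A ** C)"
  by (simp_all add: matrix_matrix_mult_def vec_eq_iff sum_distrib_left mult_ac)

lemma conjugate_affine:
  fixes C D C' :: "real^'n^'n"
  assumes "C ** C' = mat 1"
  shows "C ** (a *\<^sub>R mat 1 + b *\<^sub>R D) ** C' = a *\<^sub>R mat 1 + b *\<^sub>R (C ** D ** C')"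
  by (simp add: matrix_add_ldistrib matrix_add_rdistrib scaleR_matrix_mult assms)

text \<open>\<open>det (1 + t B)\<close> is invariant under conjugation for every \<open>t\<close>, hence so are its coefficients.\<close>

lemma matrix_sigma_similar:
  fixes B D C C' :: "real^'n^'n"
  assumes "B = C ** D ** C'" "C' ** C = mat 1"
  shows "matrix_sigma p B = matrix_sigma p D"
proof -
  have ev: "poly (det (\<chi> i j. [:if i = j then 1 else 0, X $ i $ j:])) t = det (mat 1 + t *\<^sub>R X)"
    for X :: "real^'n^'n" and t
    unfolding poly_det by (rule arg_cong[of _ _ det]) (simp add: vec_eq_iff mat_def)
  have cc: "C ** C' = mat 1" using assms(2) matrix_left_right_inverse by blast
  have "det (mat 1 + t *\<^sub>R B) = det (mat 1 + t *\<^sub>R D)" for t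
  proof -
    have "mat 1 + t *\<^sub>R B = C ** (mat 1 + t *\<^sub>R D) ** C'"
      using conjugate_affine[OF cc, of 1 t D] by (simp add: assms(1))
    then have "det (mat 1 + t *\<^sub>R B) = det C * det C' * det (mat 1 + t *\<^sub>R D)"
      by (simp add: det_mul)
    also have "det C * det C' = 1"
      using cc by (metis det_I det_mul)
    finally show ?thesis by simp
  qed
  then have "det (\<chi> i j. [:if i = j then 1 else 0, B $ i $ j:]) = det (\<chi> i j. [:if i = j then 1 else 0, D $ i $ j:])"
    by (simp add: poly_eq_poly_eq_iff[symmetric] ev fun_eq_iff)
  then show ?thesis by (simp add: matrix_sigma_def)
qed

lemma matrix_sigma_diag_plus_outer:
  fixes c :: "real^'n"
  shows "matrix_sigma (Suc p) (diag l + s *\<^sub>R outer c) =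
    elem_sym l UNIV (Suc p) + s * (\<Sum>i\<in>UNIV. (c $ i)\<^sup>2 * elem_sym l (UNIV - {i}) p)"
proof -
  have "det (\<chi> i j. [:if i = j then 1 else 0, (diag l + s *\<^sub>R outer c) $ i $ j:]) =
      det (\<chi> i j. (if i = j then [:1, l i:] else 0) + [:0, s * c $ i:] * [:c $ j:])"
    by (rule arg_cong[of _ _ det]) (simp add: vec_eq_iff diag_def outer_def)
  also have "\<dots> = (\<Prod>i\<in>UNIV. [:1, l i:]) +
      (\<Sum>i\<in>UNIV. [:0, s * c $ i:] * [:c $ i:] * (\<Prod>j\<in>UNIV - {i}. [:1, l j:]))"
    by (rule det_diag_plus_rank_one)
  finally show ?thesis
    by (simp add: matrix_sigma_def elem_sym_def coeff_sum sum_distrib_left power2_eq_square mult_ac)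
qed

lemma matrix_sigma_diag: "matrix_sigma p (diag l) = elem_sym l UNIV p"
proof -
  have "det (\<chi> i j. [:if i = j then 1 else 0, diag l $ i $ j:]) = (\<Prod>i\<in>UNIV. [:1, l i:])"
    by (subst det_diagonal) (auto simp: diag_def)
  then show ?thesis by (simp add: matrix_sigma_def elem_sym_def)
qed

lemma mset_eigenvalues_similar:
  fixes B C C' :: "real^'n^'n"
  assumes "B = C ** diag l ** C'" "C' ** C = mat 1"
  shows "mset (eigenvalues B) = image_mset l (mset_set UNIV)"
proof -
  have ev: "poly (char_polynomial X) t = det (t *\<^sub>R mat 1 - X)" for X :: "real^'n^'n" and t
    unfolding char_polynomial_def poly_det
    by (rule arg_cong[of _ _ det]) (simp add: vec_eq_iff mat_def)
  have cc: "C ** C' = mat 1" using assms(2) matrix_left_right_inverse by blast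
  have "poly (char_polynomial B) t = poly (\<Prod>i\<in>UNIV. [:- l i, 1:]) t" for t
  proof -
    have "t *\<^sub>R mat 1 - B = C ** (t *\<^sub>R mat 1 - diag l) ** C'"
      using conjugate_affine[OF cc, of t "-1" "diag l"] by (simp add: assms(1))
    then have "det (t *\<^sub>R mat 1 - B) = det C * det C' * det (t *\<^sub>R mat 1 - diag l)"
      by (simp add: det_mul)
    also have "det C * det C' = 1"
      using cc by (metis det_I det_mul)
    also have "det (t *\<^sub>R mat 1 - diag l) = (\<Prod>i\<in>UNIV. t - l i)"
      by (subst det_diagonal) (auto simp: diag_def mat_def)
    finally show ?thesis by (simp add: ev poly_prod)
  qed
  then have "char_polynomial B = (\<Prod>i\<in>UNIV. [:- l i, 1:])"
    by (simp add: poly_eq_poly_eq_iff[symmetric] fun_eq_iff)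
  also have "proots \<dots> = (\<Sum>i\<in>UNIV. {#l i#})"
    by (subst proots_prod) auto
  also have "\<dots> = image_mset l (mset_set UNIV)"
    by (simp add: sum_unfold_sum_mset)
  finally show ?thesis by (simp add: eigenvalues_def)
qed

lemma matrix_inv_unique:
  fixes A B :: "'a::semiring_1^'n^'n"
  assumes "A ** B = mat 1" "B ** A = mat 1"
  shows "matrix_inv A = B"
  unfolding matrix_inv_def
  using assms by (intro some_equality) (auto, metis matrix_mul_assoc matrix_mul_lid matrix_mul_rid)

text \<open>In a frame that is orthonormal for \<open>G\<close> and diagonalizes \<open>W\<close>, the endomorphism \<open>G\<^sup>-\<^sup>1 X\<close> becomes the
  congruence \<open>C\<^sup>T X C\<close>. The frame depends on \<open>W\<close>, but the formula is needed for every \<open>X\<close>, in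
  particular for perturbations of \<open>W\<close>.\<close>

lemma metric_frame:
  fixes G W :: "real^'n^'n"
  assumes "transpose G = G" "\<And>v. v \<noteq> 0 \<Longrightarrow> 0 < v \<bullet> (G *v v)" "transpose W = W"
  obtains C C' :: "real^'n^'n" and l where
    "C' ** C = mat 1" "transpose C ** W ** C = diag l"
    "\<And>X. matrix_inv G ** X = C ** (transpose C ** X ** C) ** C'"
proof -
  obtain C :: "real^'n^'n" and l where C: "transpose C ** G ** C = mat 1" "transpose C ** W ** C = diag l"
    using simultaneous_diagonalization[OF assms] by metis
  define C' where "C' = transpose C ** G"
  have C': "C' ** C = mat 1" "C ** C' = mat 1"
    using C(1) matrix_left_right_inverse unfolding C'_def by blast+
  then have "(C ** transpose C) ** G = mat 1"
    by (simp add: C'_def matrix_mul_assoc)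
  moreover from this have "G ** (C ** transpose C) = mat 1"
    using matrix_left_right_inverse by blast
  ultimately have "matrix_inv G = C ** transpose C"
    by (intro matrix_inv_unique)
  then have "matrix_inv G ** X = C ** (transpose C ** X ** C) ** C'" for X
    using C'(2) by (metis matrix_mul_assoc matrix_mul_rid)
  then show thesis using that C'(1) C(2) by blast
qed

lemma sigma_eigenvalues:
  fixes G W :: "real^'n^'n"
  assumes "transpose G = G" "\<And>v. v \<noteq> 0 \<Longrightarrow> 0 < v \<bullet> (G *v v)" "transpose W = W"
  shows "length (eigenvalues (matrix_inv G ** W)) = CARD('n)"
    and "sigma p (eigenvalues (matrix_inv G ** W)) = matrix_sigma p (matrix_inv G ** W)"
proof -
  obtain C C' :: "real^'n^'n" and l where C: "C' ** C = mat 1" "transpose C ** W ** C = diag l"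
    "\<And>X. matrix_inv G ** X = C ** (transpose C ** X ** C) ** C'"
    using metric_frame[OF assms] by metis
  have eq: "matrix_inv G ** W = C ** diag l ** C'"
    using C(2,3) by simp
  have m: "mset (eigenvalues (matrix_inv G ** W)) = image_mset l (mset_set UNIV)"
    by (rule mset_eigenvalues_similar[OF eq C(1)])
  from arg_cong[OF m, of size] show "length (eigenvalues (matrix_inv G ** W)) = CARD('n)"
    by simp
  show "sigma p (eigenvalues (matrix_inv G ** W)) = matrix_sigma p (matrix_inv G ** W)"
    using sigma_mset[OF _ m] matrix_sigma_similar[OF eq C(1)] by (simp add: matrix_sigma_diag)
qed

text \<open>In a frame diagonalizing \<open>W\<close> this is the determinant formula above, so the dependence on \<open>s\<close> is
  exactly linear. The slope is a sum of \<open>c\<^sub>i\<^sup>2 \<sigma>\<^sub>q\<^sub>-\<^sub>1(\<lambda>|i)\<close>, positive by \<open>elem_sym_cone\<close>.\<close>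

lemma matrix_sigma_rank_one:
  fixes G W :: "real^'n^'n"
  assumes G: "transpose G = G" "\<And>v. v \<noteq> 0 \<Longrightarrow> 0 < v \<bullet> (G *v v)" and W: "transpose W = W"
    and pos: "\<forall>q\<in>{1..p}. 0 < matrix_sigma q (matrix_inv G ** W)"
  obtains T where
    "\<And>q s. q \<in> {1..p} \<Longrightarrow>
       matrix_sigma q (matrix_inv G ** (W + s *\<^sub>R outer v)) = matrix_sigma q (matrix_inv G ** W) + s * T q"
    "\<And>q. q \<in> {1..p} \<Longrightarrow> 0 \<le> T q"
    "\<And>q. q \<in> {1..p} \<Longrightarrow> v \<noteq> 0 \<Longrightarrow> 0 < T q"
proof -
  obtain C C' :: "real^'n^'n" and l where C: "C' ** C = mat 1" "transpose C ** W ** C = diag l"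
    and inv: "\<And>X. matrix_inv G ** X = C ** (transpose C ** X ** C) ** C'"
    using metric_frame[OF G W] by metis
  define c where "c = transpose C *v v"
  define T where "T q = (\<Sum>i\<in>UNIV. (c $ i)\<^sup>2 * elem_sym l (UNIV - {i}) (q - 1))" for q
  have W_eq: "matrix_sigma q (matrix_inv G ** W) = elem_sym l UNIV q" for q
    using matrix_sigma_similar[OF inv C(1)] by (simp add: C(2) matrix_sigma_diag)
  have "transpose C ** outer v ** C = outer c"
  proof -
    have "column i C \<bullet> (outer v *v column j C) = (\<Sum>k\<in>UNIV. C $ k $ i * v $ k) * (\<Sum>k\<in>UNIV. C $ k $ j * v $ k)" for i j
      unfolding sum_product
      by (simp add: outer_def matrix_vector_mult_def inner_vec_def column_def sum_distrib_left mult_ac)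
    moreover have "c $ i = (\<Sum>k\<in>UNIV. C $ k $ i * v $ k)" for i
      by (simp add: c_def matrix_vector_mult_def transpose_def)
    moreover have "outer c $ i $ j = c $ i * c $ j" for i j
      by (simp add: outer_def)
    ultimately have "(transpose C ** outer v ** C) $ i $ j = outer c $ i $ j" for i j
      by (simp only: congruence_component)
    then show ?thesis by (simp only: vec_eq_iff) blast
  qed
  then have "transpose C ** (W + s *\<^sub>R outer v) ** C = diag l + s *\<^sub>R outer c" for s
    by (simp add: matrix_add_ldistrib matrix_add_rdistrib scaleR_matrix_mult C(2))
  then have affine: "matrix_sigma q (matrix_inv G ** (W + s *\<^sub>R outer v)) = matrix_sigma q (matrix_inv G ** W) + s * T q"
    if "q \<in> {1..p}" for q s
    using that matrix_sigma_similar[OF inv C(1), of q "W + s *\<^sub>R outer v"]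
      matrix_sigma_diag_plus_outer[of "q - 1" l s c] by (simp add: W_eq T_def)
  have "\<forall>q\<le>p. 0 < elem_sym l UNIV q"
  proof (intro allI impI)
    fix q assume "q \<le> p"
    then show "0 < elem_sym l UNIV q"
      using pos W_eq by (cases q) auto
  qed
  then have minor: "0 < elem_sym l (UNIV - {i}) (q - 1)" if "q \<in> {1..p}" for i q
    using elem_sym_cone[of UNIV p l] that by auto
  have posT: "0 < T q" if "q \<in> {1..p}" "v \<noteq> 0" for q
  proof -
    have "C ** C' = mat 1" using C(1) matrix_left_right_inverse by blast
    then have "transpose C' *v c = v"
      by (simp add: c_def matrix_vector_mul_assoc matrix_transpose_mul[symmetric] del: transpose_matrix_vector)
    then have "c \<noteq> 0" using that(2) by auto
    then obtain i where i: "c $ i \<noteq> 0" by (auto simp: vec_eq_iff)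
    have "0 < (c $ i)\<^sup>2 * elem_sym l (UNIV - {i}) (q - 1)"
      using i minor[OF that(1), of i] by simp
    also have "\<dots> \<le> T q"
      unfolding T_def using minor[OF that(1)]
      by (intro member_le_sum mult_nonneg_nonneg) (auto intro: less_imp_le)
    finally show ?thesis .
  qed
  have nnT: "0 \<le> T q" if "q \<in> {1..p}" for q
    unfolding T_def using minor[OF that] by (intro sum_nonneg mult_nonneg_nonneg) (auto intro: less_imp_le)
  show thesis
    by (rule that[of T, OF affine nnT posT])
qed

lemma transpose_outer: "transpose (outer (v :: real^'n)) = outer v"
  by (simp add: transpose_def outer_def vec_eq_iff mult.commute)

lemma transpose_add: "transpose (A + B) = transpose A + transpose (B :: 'a::plus^'n^'m)"
  by (simp add: transpose_def vec_eq_iff)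

text \<open>Rank-one summands are added one after the other. Each step preserves the cone condition, since all
  lower symmetric functions grow as well, and so permits the next step.\<close>

lemma matrix_sigma_mono_psd:
  fixes G W P :: "real^'n^'n"
  assumes G: "transpose G = G" "\<And>v. v \<noteq> 0 \<Longrightarrow> 0 < v \<bullet> (G *v v)" and W: "transpose W = W"
    and pos: "\<forall>q\<in>{1..p}. 0 < matrix_sigma q (matrix_inv G ** W)"
    and P: "transpose P = P" "\<And>v. 0 \<le> v \<bullet> (P *v v)" and q: "q \<in> {1..p}"
  shows "matrix_sigma q (matrix_inv G ** W) \<le> matrix_sigma q (matrix_inv G ** (W + P))"
proof -
  obtain f :: "'n \<Rightarrow> real^'n" where f: "P = (\<Sum>k\<in>UNIV. outer (f k))"
    using psd_eq_sum_outer[OF P] by metis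
  have "transpose (W + (\<Sum>k\<in>K. outer (f k))) = W + (\<Sum>k\<in>K. outer (f k)) \<and>
      (\<forall>q\<in>{1..p}. matrix_sigma q (matrix_inv G ** W) \<le> matrix_sigma q (matrix_inv G ** (W + (\<Sum>k\<in>K. outer (f k)))))"
    if "finite K" for K
    using that
  proof (induction K rule: finite_induct)
    case empty
    then show ?case using W by simp
  next
    case (insert k K)
    define V where "V = W + (\<Sum>k\<in>K. outer (f k))"
    have V: "transpose V = V" and ge: "\<And>q. q \<in> {1..p} \<Longrightarrow>
        matrix_sigma q (matrix_inv G ** W) \<le> matrix_sigma q (matrix_inv G ** V)"
      using insert.IH unfolding V_def by blast+
    have "\<forall>q\<in>{1..p}. 0 < matrix_sigma q (matrix_inv G ** V)"
      using ge pos by (meson less_le_trans)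
    from matrix_sigma_rank_one[OF G V this, of "f k"] obtain T where
      T: "\<And>q s. q \<in> {1..p} \<Longrightarrow> matrix_sigma q (matrix_inv G ** (V + s *\<^sub>R outer (f k)))
            = matrix_sigma q (matrix_inv G ** V) + s * T q" "\<And>q. q \<in> {1..p} \<Longrightarrow> 0 \<le> T q"
      by metis
    have eq: "W + (\<Sum>k\<in>insert k K. outer (f k)) = V + 1 *\<^sub>R outer (f k)"
      using insert.hyps by (simp add: V_def)
    have "matrix_sigma q (matrix_inv G ** W) \<le> matrix_sigma q (matrix_inv G ** (V + 1 *\<^sub>R outer (f k)))"
      if "q \<in> {1..p}" for q
      using T(1)[OF that, of 1] T(2)[OF that] ge[OF that] by simp
    then show ?case
      unfolding eq using V by (simp add: transpose_add transpose_outer)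
  qed
  from this[of UNIV] show ?thesis using q f by simp
qed

section \<open>A strong comparison principle\<close>

text \<open>Gradient \<open>g\<close> and Hessian \<open>H\<close> of a \<open>C\<^sup>2\<close> function \<open>f\<close>, the derivative of the gradient being stated
  for its components in all directions \<open>v\<close>. Jets given as data are easily added and scaled.\<close>

definition has_jet2 ::
  "(real^'n \<Rightarrow> real) \<Rightarrow> (real^'n \<Rightarrow> real^'n) \<Rightarrow> (real^'n \<Rightarrow> real^'n^'n) \<Rightarrow> (real^'n) set \<Rightarrow> bool" where
  "has_jet2 f g H S \<longleftrightarrow>
     continuous_on S g \<and> continuous_on S H \<and>
     (\<forall>y\<in>S. (f has_derivative (\<lambda>v. g y \<bullet> v)) (at y) \<and>
        (\<forall>v. ((\<lambda>y. g y \<bullet> v) has_derivative (\<lambda>u. u \<bullet> (H y *v v))) (at y)))"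

lemma has_jet2_continuous:
  assumes "has_jet2 f g H S"
  shows "continuous_on S f"
  using assms unfolding has_jet2_def
  by (meson continuous_at_imp_continuous_on has_derivative_continuous)

lemma has_jet2I:
  assumes "continuous_on S g" "continuous_on S H"
    and "\<And>y. y \<in> S \<Longrightarrow> (f has_derivative (\<lambda>v. g y \<bullet> v)) (at y)"
    and "\<And>y v. y \<in> S \<Longrightarrow> ((\<lambda>y. g y \<bullet> v) has_derivative (\<lambda>u. u \<bullet> (H y *v v))) (at y)"
  shows "has_jet2 f g H S"
  using assms unfolding has_jet2_def by blast

lemma has_jet2D:
  assumes "has_jet2 f g H S"
  shows "continuous_on S g" "continuous_on S H"
    and "y \<in> S \<Longrightarrow> (f has_derivative (\<lambda>v. g y \<bullet> v)) (at y)"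
    and "y \<in> S \<Longrightarrow> ((\<lambda>y. g y \<bullet> v) has_derivative (\<lambda>u. u \<bullet> (H y *v v))) (at y)"
  using assms unfolding has_jet2_def by blast+

lemma has_jet2_add:
  assumes "has_jet2 f g H S" "has_jet2 f' g' H' S"
  shows "has_jet2 (\<lambda>y. f y + f' y) (\<lambda>y. g y + g' y) (\<lambda>y. H y + H' y) S"
proof (rule has_jet2I)
  fix y v assume y: "y \<in> S"
  show "((\<lambda>y. f y + f' y) has_derivative (\<lambda>v. (g y + g' y) \<bullet> v)) (at y)"
    by (rule has_derivative_eq_rhs[OF has_derivative_add[OF has_jet2D(3)[OF assms(1) y] has_jet2D(3)[OF assms(2) y]]])
      (simp add: fun_eq_iff inner_add_left)
  have "((\<lambda>y. g y \<bullet> v + g' y \<bullet> v) has_derivative (\<lambda>u. u \<bullet> ((H y + H' y) *v v))) (at y)"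
    by (rule has_derivative_eq_rhs[OF has_derivative_add[OF has_jet2D(4)[OF assms(1) y] has_jet2D(4)[OF assms(2) y]]])
      (simp add: fun_eq_iff inner_add_right matrix_vector_mult_add_rdistrib)
  then show "((\<lambda>y. (g y + g' y) \<bullet> v) has_derivative (\<lambda>u. u \<bullet> ((H y + H' y) *v v))) (at y)"
    by (simp only: inner_add_left)
qed (intro continuous_intros has_jet2D(1,2)[OF assms(1)] has_jet2D(1,2)[OF assms(2)])+

lemma has_jet2_scaleR:
  assumes "has_jet2 f g H S"
  shows "has_jet2 (\<lambda>y. c * f y) (\<lambda>y. c *\<^sub>R g y) (\<lambda>y. c *\<^sub>R H y) S"
proof (rule has_jet2I)
  fix y v assume y: "y \<in> S"
  show "((\<lambda>y. c * f y) has_derivative (\<lambda>v. (c *\<^sub>R g y) \<bullet> v)) (at y)"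
    by (rule has_derivative_eq_rhs[OF has_derivative_mult_right[OF has_jet2D(3)[OF assms y]]])
      (simp add: fun_eq_iff)
  have "((\<lambda>y. c * (g y \<bullet> v)) has_derivative (\<lambda>u. u \<bullet> ((c *\<^sub>R H y) *v v))) (at y)"
    by (rule has_derivative_eq_rhs[OF has_derivative_mult_right[OF has_jet2D(4)[OF assms y]]])
      (simp add: fun_eq_iff scaleR_matrix_vector_assoc[symmetric])
  then show "((\<lambda>y. (c *\<^sub>R g y) \<bullet> v) has_derivative (\<lambda>u. u \<bullet> ((c *\<^sub>R H y) *v v))) (at y)"
    by (simp only: inner_scaleR_left)
qed (intro continuous_intros has_jet2D(1,2)[OF assms])+

text \<open>If the second derivative along a line through the maximum were positive, the first derivative,
  vanishing at the maximum, would be positive immediately after it.\<close>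

lemma jet2_local_max:
  assumes jet: "has_jet2 f g H S" and "0 < e" "ball y e \<subseteq> S"
    and max: "\<And>x. x \<in> ball y e \<Longrightarrow> f x \<le> f y"
  shows "g y = 0" and "v \<bullet> (H y *v v) \<le> 0"
proof -
  have y: "y \<in> S" using assms(2,3) by auto
  have ev: "eventually (\<lambda>x. f x \<le> f y) (at y)"
    using max \<open>0 < e\<close> by (auto simp: eventually_at dist_commute intro!: exI[of _ e])
  have "(\<lambda>v. g y \<bullet> v) = (\<lambda>v. 0)"
    using jet y ev by (intro has_derivative_local_max[of f _ y]) (auto simp: has_jet2_def)
  then show g0: "g y = 0"
    by (metis inner_eq_zero_iff)
  show "v \<bullet> (H y *v v) \<le> 0"
  proof (rule ccontr)
    assume "\<not> v \<bullet> (H y *v v) \<le> 0"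
    then have pos: "0 < v \<bullet> (H y *v v)" by simp
    have line: "((\<lambda>s. y + s *\<^sub>R v) has_derivative (\<lambda>s. s *\<^sub>R v)) (at s)" for s
      by (auto intro!: derivative_eq_intros)
    have d1: "((\<lambda>s. f (y + s *\<^sub>R v)) has_real_derivative g (y + s *\<^sub>R v) \<bullet> v) (at s)"
      if "y + s *\<^sub>R v \<in> S" for s
    proof -
      have "(f has_derivative (\<lambda>w. g (y + s *\<^sub>R v) \<bullet> w)) (at (y + s *\<^sub>R v))"
        using jet that by (simp add: has_jet2_def)
      from has_derivative_compose[OF line this] show ?thesis
        by (simp add: has_field_derivative_def mult.commute[of _ "g _ \<bullet> v"] mult_commute_abs)
    qed
    have "((\<lambda>x. g x \<bullet> v) has_derivative (\<lambda>u. u \<bullet> (H y *v v))) (at (y + 0 *\<^sub>R v))"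
      using jet y by (simp add: has_jet2_def)
    from has_derivative_compose[OF line this]
    have "((\<lambda>s. g (y + s *\<^sub>R v) \<bullet> v) has_real_derivative v \<bullet> (H y *v v)) (at 0)"
      by (simp add: has_field_derivative_def mult_commute_abs)
    from DERIV_pos_inc_right[OF this pos] g0
    obtain d where d: "0 < d" "\<And>h. 0 < h \<Longrightarrow> h < d \<Longrightarrow> 0 < g (y + h *\<^sub>R v) \<bullet> v"
      by auto
    have nv: "0 < norm v" using pos by auto
    define t where "t = min d (e / norm v) / 2"
    have t: "0 < t" "t < d" "t * norm v < e"
      using d(1) \<open>0 < e\<close> nv by (auto simp: t_def min_def field_simps)
    have in_ball: "y + s *\<^sub>R v \<in> ball y e" if "0 \<le> s" "s \<le> t" for s
    proof -
      have "s * norm v \<le> t * norm v" using that by (simp add: mult_right_mono)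
      then show ?thesis using t(3) that by (simp add: dist_norm)
    qed
    have "DERIV (\<lambda>s. f (y + s *\<^sub>R v)) s :> g (y + s *\<^sub>R v) \<bullet> v" if "0 \<le> s" "s \<le> t" for s
      using d1 in_ball[OF that] assms(3) by blast
    from MVT2[OF t(1) this] obtain z where z: "0 < z" "z < t"
        "f (y + t *\<^sub>R v) - f (y + 0 *\<^sub>R v) = (t - 0) * (g (y + z *\<^sub>R v) \<bullet> v)"
      by blast
    have "0 < t * (g (y + z *\<^sub>R v) \<bullet> v)"
      using d(2)[of z] z t by simp
    moreover have "f (y + t *\<^sub>R v) \<le> f y"
      using max in_ball[of t] t(1) by simp
    ultimately show False using z(3) by simp
  qed
qed

text \<open>A polynomial version of the barrier of Hopf. It vanishes on the sphere of radius \<open>R\<close>, where its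
  Hessian has the radial part \<open>8 k (y - z)(y - z)\<^sup>T\<close> with \<open>k\<close> at our disposal, while gradient and
  remaining Hessian do not depend on \<open>k\<close> there.\<close>

lemma has_jet2_barrier:
  fixes z :: "real^'n" and R k :: real
  defines "\<rho> \<equiv> \<lambda>y. R\<^sup>2 - (y - z) \<bullet> (y - z)"
  shows "has_jet2 (\<lambda>y. \<rho> y + k * (\<rho> y)\<^sup>2)
           (\<lambda>y. (- 2 * (1 + 2 * k * \<rho> y)) *\<^sub>R (y - z))
           (\<lambda>y. (- 2 * (1 + 2 * k * \<rho> y)) *\<^sub>R mat 1 + (8 * k) *\<^sub>R outer (y - z)) UNIV"
proof -
  have outer_vec: "outer x *v v = (x \<bullet> v) *\<^sub>R x" for x v :: "real^'n"
    by (simp add: outer_def matrix_vector_mult_def inner_vec_def vec_eq_iff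
        sum_distrib_left mult_ac)
  have \<rho>': "(\<rho> has_derivative (\<lambda>u. - 2 * ((y - z) \<bullet> u))) (at y)" for y
    unfolding \<rho>_def by (auto intro!: derivative_eq_intros simp: inner_commute)
  have cont: "continuous_on UNIV \<rho>"
    unfolding \<rho>_def by (intro continuous_intros)
  have "continuous_on UNIV (\<lambda>y. outer (y - z))"
    unfolding outer_def by (intro continuous_intros)
  then have cont_H: "continuous_on UNIV (\<lambda>y. (- 2 * (1 + 2 * k * \<rho> y)) *\<^sub>R mat 1 + (8 * k) *\<^sub>R outer (y - z))"
    using cont by (intro continuous_intros)
  have cont_g: "continuous_on UNIV (\<lambda>y. (- 2 * (1 + 2 * k * \<rho> y)) *\<^sub>R (y - z))"
    using cont by (intro continuous_intros)
  have "((\<lambda>y. \<rho> y + k * (\<rho> y)\<^sup>2) has_derivative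
      (\<lambda>v. ((- 2 * (1 + 2 * k * \<rho> y)) *\<^sub>R (y - z)) \<bullet> v)) (at y)" for y
    by (rule derivative_eq_intros \<rho>' refl | simp add: fun_eq_iff algebra_simps)+
  moreover have "((\<lambda>y. ((- 2 * (1 + 2 * k * \<rho> y)) *\<^sub>R (y - z)) \<bullet> v) has_derivative
      (\<lambda>u. u \<bullet> (((- 2 * (1 + 2 * k * \<rho> y)) *\<^sub>R mat 1 + (8 * k) *\<^sub>R outer (y - z)) *v v))) (at y)" for y v
    by (rule derivative_eq_intros \<rho>' refl |
        simp add: fun_eq_iff matrix_vector_mult_add_rdistrib scaleR_matrix_vector_assoc[symmetric]
          outer_vec inner_add_right inner_commute algebra_simps)+
  ultimately show ?thesis
    by (intro has_jet2I cont_g cont_H)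
qed

text \<open>A solution \<open>f\<close> and a subsolution \<open>f\<^sub>s\<close> of an equation \<open>F y Df D\<^sup>2f = 0\<close> which does not involve the
  value of the unknown. Ellipticity enters in two forms: infinitesimally in rank-one directions
  at the solution, and as monotonicity in the Hessian at the subsolution. These are the forms in
  which admissibility of the two functions provides it for the \<open>p\<close>-Hessian equation.\<close>

locale elliptic_comparison =
  fixes S :: "(real^'n) set"
    and F :: "real^'n \<Rightarrow> real^'n \<Rightarrow> real^'n^'n \<Rightarrow> real"
    and F' :: "real^'n \<Rightarrow> real^'n \<Rightarrow> real^'n^'n \<Rightarrow> real^'n \<Rightarrow> real^'n^'n \<Rightarrow> real"
    and f f\<^sub>s :: "real^'n \<Rightarrow> real" and g g\<^sub>s :: "real^'n \<Rightarrow> real^'n" and H H\<^sub>s :: "real^'n \<Rightarrow> real^'n^'n"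
  assumes open_S: "open S"
    and jet: "has_jet2 f g H S" and jet_s: "has_jet2 f\<^sub>s g\<^sub>s H\<^sub>s S"
    and sym: "\<And>y. y \<in> S \<Longrightarrow> transpose (H y) = H y" and sym_s: "\<And>y. y \<in> S \<Longrightarrow> transpose (H\<^sub>s y) = H\<^sub>s y"
    and deriv: "\<And>y \<eta> Q. y \<in> S \<Longrightarrow>
          ((\<lambda>(\<eta>, Q). F y \<eta> Q) has_derivative (\<lambda>(\<theta>, X). F' y \<eta> Q \<theta> X)) (at (\<eta>, Q))"
    and cont: "continuous_on (S \<times> UNIV) (\<lambda>(y, \<eta>, Q, \<theta>, X). F' y \<eta> Q \<theta> X)"
    and elliptic: "\<And>y v. y \<in> S \<Longrightarrow> v \<noteq> 0 \<Longrightarrow> 0 < F' y (g y) (H y) 0 (outer v)"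
    and mono: "\<And>y P. y \<in> S \<Longrightarrow> transpose P = P \<Longrightarrow> (\<And>v. 0 \<le> v \<bullet> (P *v v)) \<Longrightarrow>
          F y (g\<^sub>s y) (H\<^sub>s y) \<le> F y (g\<^sub>s y) (H\<^sub>s y + P)"
    and solution: "\<And>y. y \<in> S \<Longrightarrow> F y (g y) (H y) = 0"
    and subsolution: "\<And>y. y \<in> S \<Longrightarrow> 0 \<le> F y (g\<^sub>s y) (H\<^sub>s y)"
begin

text \<open>The contact set cannot be touched by a ball at exactly one boundary point. The values of \<open>F\<close> along
  the jets of \<open>f - s b\<close> for the barrier \<open>b\<close> decrease from \<open>0\<close>, whereas monotonicity makes \<open>F\<close>
  nonnegative at the jet of \<open>f - \<epsilon> b\<close> in an interior maximum of \<open>f\<^sub>s - f + \<epsilon> b\<close>.\<close>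

lemma hopf_boundary_point:
  assumes R: "0 < R" "cball z R \<subseteq> S" and y\<^sub>0: "y\<^sub>0 \<in> sphere z R"
    and below: "\<And>y. y \<in> S \<Longrightarrow> f\<^sub>s y - f y \<le> K"
    and touch: "f\<^sub>s y\<^sub>0 - f y\<^sub>0 = K"
    and strict: "\<And>y. y \<in> cball z R - {y\<^sub>0} \<Longrightarrow> f\<^sub>s y - f y < K"
  shows False
proof -
  define w where "w y = f\<^sub>s y - f y" for y
  define \<rho> where "\<rho> y = R\<^sup>2 - (y - z) \<bullet> (y - z)" for y
  define \<xi> where "\<xi> = y\<^sub>0 - z"
  have y\<^sub>0S: "y\<^sub>0 \<in> S" using y\<^sub>0 R by auto
  have \<xi>: "\<xi> \<noteq> 0" "\<xi> \<bullet> \<xi> = R\<^sup>2"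
    using y\<^sub>0 R(1) by (auto simp: \<xi>_def dist_norm norm_minus_commute dot_square_norm)
  define L where "L = (\<lambda>(\<theta>, X). F' y\<^sub>0 (g y\<^sub>0) (H y\<^sub>0) \<theta> X)"
  have linL: "linear L"
    using deriv[OF y\<^sub>0S, of "g y\<^sub>0" "H y\<^sub>0"] has_derivative_linear unfolding L_def by blast
  define \<tau> where "\<tau> = L (0, outer \<xi>)"
  have \<tau>: "0 < \<tau>" using elliptic[OF y\<^sub>0S \<xi>(1)] by (simp add: \<tau>_def L_def)
  \<comment> \<open>The radial part of the Hessian of the barrier contributes \<open>- 8 k \<tau>\<close>, which this choice lets
    dominate the \<open>k\<close>-independent contribution of its gradient and of the rest of its Hessian.\<close>
  define k where "k = (\<bar>L (2 *\<^sub>R \<xi>, 2 *\<^sub>R mat 1)\<bar> + 1) / (8 * \<tau>)"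
  have k: "0 < k" using \<tau> by (simp add: k_def)
  define b where "b y = \<rho> y + k * (\<rho> y)\<^sup>2" for y
  define gb where "gb y = (- 2 * (1 + 2 * k * \<rho> y)) *\<^sub>R (y - z)" for y
  define Hb where "Hb y = (- 2 * (1 + 2 * k * \<rho> y)) *\<^sub>R mat 1 + (8 * k) *\<^sub>R outer (y - z)" for y
  have "has_jet2 b gb Hb UNIV"
    unfolding b_def gb_def Hb_def \<rho>_def by (rule has_jet2_barrier)
  then have jet_b: "has_jet2 b gb Hb S"
    unfolding has_jet2_def by (auto intro: continuous_on_subset)
  have \<rho>0: "\<rho> y\<^sub>0 = 0" using \<xi> by (simp add: \<rho>_def \<xi>_def)
  have neg: "F' y\<^sub>0 (g y\<^sub>0) (H y\<^sub>0) (- gb y\<^sub>0) (- Hb y\<^sub>0) < 0"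
  proof -
    have "(- gb y\<^sub>0, - Hb y\<^sub>0) = (2 *\<^sub>R \<xi>, 2 *\<^sub>R mat 1) + (- (8 * k)) *\<^sub>R (0, outer \<xi>)"
      by (simp add: gb_def Hb_def \<rho>0 \<xi>_def)
    then have "L (- gb y\<^sub>0, - Hb y\<^sub>0) = L (2 *\<^sub>R \<xi>, 2 *\<^sub>R mat 1) + (- (8 * k)) *\<^sub>R \<tau>"
      unfolding \<tau>_def by (simp only: linear_add[OF linL] linear_scale[OF linL])
    also have "\<dots> = L (2 *\<^sub>R \<xi>, 2 *\<^sub>R mat 1) - (\<bar>L (2 *\<^sub>R \<xi>, 2 *\<^sub>R mat 1)\<bar> + 1)"
      using \<tau> by (simp add: k_def field_simps)
    finally show ?thesis by (simp add: L_def)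
  qed
  define \<Phi> where "\<Phi> = (\<lambda>(y, s). F' y (g y - s *\<^sub>R gb y) (H y - s *\<^sub>R Hb y) (- gb y) (- Hb y))"
  have cont_g: "continuous_on S g" "continuous_on S H" "continuous_on S gb" "continuous_on S Hb"
    using jet jet_b by (auto simp: has_jet2_def)
  have "continuous_on (S \<times> UNIV) \<Phi>"
  proof -
    have "continuous_on (S \<times> (UNIV :: real set)) (\<lambda>p. (fst p, g (fst p) - snd p *\<^sub>R gb (fst p),
        H (fst p) - snd p *\<^sub>R Hb (fst p), - gb (fst p), - Hb (fst p)))"
      by (intro continuous_intros continuous_on_compose2[OF cont_g(1)] continuous_on_compose2[OF cont_g(2)]
          continuous_on_compose2[OF cont_g(3)] continuous_on_compose2[OF cont_g(4)]) auto
    moreover have "(\<lambda>p. (fst p, g (fst p) - snd p *\<^sub>R gb (fst p), H (fst p) - snd p *\<^sub>R Hb (fst p),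
        - gb (fst p), - Hb (fst p))) ` (S \<times> UNIV) \<subseteq> S \<times> UNIV"
      by auto
    ultimately have "continuous_on (S \<times> UNIV) (\<lambda>p. (\<lambda>(y, \<eta>, Q, \<theta>, X). F' y \<eta> Q \<theta> X) (fst p,
        g (fst p) - snd p *\<^sub>R gb (fst p), H (fst p) - snd p *\<^sub>R Hb (fst p), - gb (fst p), - Hb (fst p)))"
      by (rule continuous_on_compose2[OF cont])
    then show ?thesis
      by (simp add: \<Phi>_def case_prod_beta)
  qed
  moreover have "open (S \<times> (UNIV :: real set))" using open_S by (intro open_Times) auto
  moreover have "\<Phi> (y\<^sub>0, 0) < 0" using neg by (simp add: \<Phi>_def)
  ultimately obtain \<delta> where \<delta>: "0 < \<delta>" "\<And>p. dist p (y\<^sub>0, 0) < \<delta> \<Longrightarrow> \<Phi> p < 0"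
  proof -
    from \<open>continuous_on (S \<times> UNIV) \<Phi>\<close> \<open>open (S \<times> (UNIV :: real set))\<close>
    have "open ((S \<times> UNIV) \<inter> \<Phi> -` {..<0})"
      by (intro continuous_open_preimage) auto
    moreover have "(y\<^sub>0, 0) \<in> (S \<times> UNIV) \<inter> \<Phi> -` {..<0}"
      using y\<^sub>0S \<open>\<Phi> (y\<^sub>0, 0) < 0\<close> by simp
    ultimately obtain \<delta> where "0 < \<delta>" "ball (y\<^sub>0, 0) \<delta> \<subseteq> (S \<times> UNIV) \<inter> \<Phi> -` {..<0}"
      using openE by blast
    then show thesis using that by (force simp: dist_commute)
  qed
  \<comment> \<open>The last condition makes \<open>b = \<rho> (1 + k \<rho>)\<close> negative outside the ball around \<open>z\<close>.\<close>
  have "\<exists>r>0. r < \<delta> / 2 \<and> cball y\<^sub>0 r \<subseteq> S \<and> (\<forall>y\<in>cball y\<^sub>0 r. \<bar>k * \<rho> y\<bar> < 1)"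
  proof -
    have "open (S \<inter> (\<lambda>y. \<bar>k * \<rho> y\<bar>) -` {..<1})"
      unfolding \<rho>_def by (intro continuous_open_preimage open_S continuous_intros open_lessThan)
    moreover have "y\<^sub>0 \<in> S \<inter> (\<lambda>y. \<bar>k * \<rho> y\<bar>) -` {..<1}"
      using y\<^sub>0S \<rho>0 by simp
    ultimately obtain d where d: "0 < d" "cball y\<^sub>0 d \<subseteq> S \<inter> (\<lambda>y. \<bar>k * \<rho> y\<bar>) -` {..<1}"
      using open_contains_cball by blast
    have "cball y\<^sub>0 (min d (\<delta> / 4)) \<subseteq> cball y\<^sub>0 d" by auto
    then show ?thesis
      using d \<delta>(1) by (intro exI[of _ "min d (\<delta> / 4)"]) (auto simp: subset_iff)
  qed
  then obtain r where r: "0 < r" "r < \<delta> / 2" "cball y\<^sub>0 r \<subseteq> S" "\<And>y. y \<in> cball y\<^sub>0 r \<Longrightarrow> \<bar>k * \<rho> y\<bar> < 1"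
    by blast
  have cont_w: "continuous_on S w" and cont_b: "continuous_on S b"
    using has_jet2_continuous[OF jet] has_jet2_continuous[OF jet_s] has_jet2_continuous[OF jet_b]
    unfolding w_def by (auto intro!: continuous_intros)
  \<comment> \<open>On this part of the small sphere \<open>b\<close> may be positive, but \<open>w\<close> stays away from \<open>K\<close>, because
    the contact point \<open>y\<^sub>0\<close> does not belong to it.\<close>
  define N where "N = sphere y\<^sub>0 r \<inter> cball z R"
  have NS: "N \<subseteq> S" using R(2) by (auto simp: N_def)
  have cN: "compact N" unfolding N_def by (intro compact_Int_closed) auto
  have wN: "w y < K" if "y \<in> N" for y
    using strict[of y] that r(1) by (auto simp: N_def w_def)
  have "\<exists>\<epsilon>>0. \<epsilon> < \<delta> / 2 \<and> (\<forall>y\<in>N. w y + \<epsilon> * b y < K)"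
  proof (cases "N = {}")
    case True
    then show ?thesis using \<delta>(1) by (intro exI[of _ "\<delta> / 4"]) auto
  next
    case False
    obtain y1 where y1: "y1 \<in> N" "\<And>y. y \<in> N \<Longrightarrow> w y \<le> w y1"
      using continuous_attains_sup[OF cN False continuous_on_subset[OF cont_w NS]] by blast
    obtain y2 where y2: "y2 \<in> N" "\<And>y. y \<in> N \<Longrightarrow> b y \<le> b y2"
      using continuous_attains_sup[OF cN False continuous_on_subset[OF cont_b NS]] by blast
    define B where "B = \<bar>b y2\<bar> + 1"
    define \<epsilon> where "\<epsilon> = min (\<delta> / 4) ((K - w y1) / (2 * B))"
    have "b y < B" if "y \<in> N" for y
      using y2(2)[OF that] abs_ge_self[of "b y2"] unfolding B_def by linarith
    then have B: "0 < B" "\<And>y. y \<in> N \<Longrightarrow> b y < B"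
      by (simp_all add: B_def)
    have \<epsilon>: "0 < \<epsilon>" "\<epsilon> < \<delta> / 2" "\<epsilon> \<le> (K - w y1) / (2 * B)"
      using \<delta>(1) wN[OF y1(1)] B(1) by (auto simp: \<epsilon>_def)
    have "w y + \<epsilon> * b y < K" if "y \<in> N" for y
    proof -
      have "\<epsilon> * b y \<le> \<epsilon> * B" using B(2)[OF that] \<epsilon>(1) by (intro mult_left_mono) auto
      also have "\<dots> \<le> (K - w y1) / (2 * B) * B" using \<epsilon>(3) B(1) by (intro mult_right_mono) auto
      also have "\<dots> = (K - w y1) / 2" using B(1) by simp
      also have "\<dots> < K - w y1" using wN[OF y1(1)] by simp
      finally show ?thesis using y1(2)[OF that] by simp
    qed
    then show ?thesis using \<epsilon> by blast
  qed
  then obtain \<epsilon> where \<epsilon>: "0 < \<epsilon>" "\<epsilon> < \<delta> / 2" "\<And>y. y \<in> N \<Longrightarrow> w y + \<epsilon> * b y < K" by blast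
  define \<psi> where "\<psi> y = w y + \<epsilon> * b y" for y
  define g\<psi> where "g\<psi> y = g\<^sub>s y + (-1) *\<^sub>R g y + \<epsilon> *\<^sub>R gb y" for y
  define H\<psi> where "H\<psi> y = H\<^sub>s y + (-1) *\<^sub>R H y + \<epsilon> *\<^sub>R Hb y" for y
  have jet_\<psi>: "has_jet2 \<psi> g\<psi> H\<psi> S"
    using has_jet2_add[OF has_jet2_add[OF jet_s has_jet2_scaleR[OF jet, of "-1"]] has_jet2_scaleR[OF jet_b, of \<epsilon>]]
    by (simp add: \<psi>_def[abs_def] g\<psi>_def[abs_def] H\<psi>_def[abs_def] w_def)
  obtain y1 where y1: "y1 \<in> cball y\<^sub>0 r" "\<And>y. y \<in> cball y\<^sub>0 r \<Longrightarrow> \<psi> y \<le> \<psi> y1"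
    using continuous_attains_sup[OF compact_cball, of y\<^sub>0 r \<psi>] r(1,3)
      continuous_on_subset[OF has_jet2_continuous[OF jet_\<psi>]] by auto
  have "K \<le> \<psi> y1"
    using y1(2)[of y\<^sub>0] r(1) touch \<rho>0 by (simp add: \<psi>_def w_def b_def)
  have "y1 \<notin> sphere y\<^sub>0 r"
  proof
    assume sph: "y1 \<in> sphere y\<^sub>0 r"
    show False
    proof (cases "y1 \<in> cball z R")
      case True
      then show False using \<epsilon>(3)[of y1] sph \<open>K \<le> \<psi> y1\<close> by (simp add: N_def \<psi>_def)
    next
      case False
      then have "R < norm (y1 - z)" by (simp add: dist_norm norm_minus_commute)
      then have "R\<^sup>2 < (norm (y1 - z))\<^sup>2" using R(1) by (intro power_strict_mono) auto
      then have "\<rho> y1 < 0" by (simp add: \<rho>_def dot_square_norm)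
      moreover have "0 < 1 + k * \<rho> y1" using r(4)[OF y1(1)] by linarith
      ultimately have "\<rho> y1 * (1 + k * \<rho> y1) < 0" by (rule mult_neg_pos)
      then have "b y1 < 0" by (simp add: b_def power2_eq_square algebra_simps)
      then have "\<epsilon> * b y1 < 0" using \<epsilon>(1) by (simp add: mult_less_0_iff)
      moreover have "w y1 \<le> K" using below y1(1) r(3) by (auto simp: w_def)
      ultimately show False using \<open>K \<le> \<psi> y1\<close> by (simp add: \<psi>_def)
    qed
  qed
  with y1(1) have "y1 \<in> ball y\<^sub>0 r" by auto
  then obtain e where e: "0 < e" "ball y1 e \<subseteq> ball y\<^sub>0 r"
    using open_ball openE by blast
  have sub: "ball y1 e \<subseteq> S" using e(2) r(3) by force
  have le: "\<psi> x \<le> \<psi> y1" if "x \<in> ball y1 e" for x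
    using y1(2)[of x] e(2) that by force
  have y1S: "y1 \<in> S" using y1(1) r(3) by blast
  have "g\<psi> y1 = 0" by (rule jet2_local_max(1)[OF jet_\<psi> e(1) sub le])
  then have g_eq: "g\<^sub>s y1 = g y1 - \<epsilon> *\<^sub>R gb y1"
    by (simp add: g\<psi>_def algebra_simps eq_neg_iff_add_eq_0)
  define P where "P = - H\<psi> y1"
  have "0 \<le> v \<bullet> (P *v v)" for v
  proof -
    have "P *v v = - (H\<psi> y1 *v v)"
      by (simp add: P_def matrix_vector_mult_def vec_eq_iff sum_negf)
    then show ?thesis using jet2_local_max(2)[OF jet_\<psi> e(1) sub le, of v] by simp
  qed
  moreover have "transpose P = P"
  proof -
    have "Hb y1 $ i $ j = Hb y1 $ j $ i" for i j
      by (simp add: Hb_def outer_def mat_def mult.commute)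
    moreover have "H y1 $ i $ j = H y1 $ j $ i" "H\<^sub>s y1 $ i $ j = H\<^sub>s y1 $ j $ i" for i j
      using sym[OF y1S] sym_s[OF y1S] by (auto simp: transpose_def vec_eq_iff)
    ultimately show ?thesis by (simp add: P_def H\<psi>_def transpose_def vec_eq_iff)
  qed
  ultimately have "F y1 (g\<^sub>s y1) (H\<^sub>s y1) \<le> F y1 (g\<^sub>s y1) (H\<^sub>s y1 + P)"
    by (intro mono[OF y1S])
  also have "H\<^sub>s y1 + P = H y1 - \<epsilon> *\<^sub>R Hb y1"
    by (simp add: P_def H\<psi>_def)
  finally have ge: "0 \<le> F y1 (g y1 - \<epsilon> *\<^sub>R gb y1) (H y1 - \<epsilon> *\<^sub>R Hb y1)"
    using subsolution[OF y1S] g_eq by simp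
  have "((\<lambda>s. F y1 (g y1 - s *\<^sub>R gb y1) (H y1 - s *\<^sub>R Hb y1)) has_real_derivative \<Phi> (y1, s)) (at s)" for s
  proof -
    have line: "((\<lambda>s. (g y1 - s *\<^sub>R gb y1, H y1 - s *\<^sub>R Hb y1)) has_derivative
        (\<lambda>t. t *\<^sub>R (- gb y1, - Hb y1))) (at s)"
      by (auto intro!: derivative_eq_intros simp: fun_eq_iff)
    have D: "((\<lambda>(\<eta>, Q). F y1 \<eta> Q) has_derivative
        (\<lambda>(\<theta>, X). F' y1 (g y1 - s *\<^sub>R gb y1) (H y1 - s *\<^sub>R Hb y1) \<theta> X))
        (at (g y1 - s *\<^sub>R gb y1, H y1 - s *\<^sub>R Hb y1))" (is "(_ has_derivative ?D) _")
      by (rule deriv[OF y1S])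
    have lin: "linear ?D" using D has_derivative_linear by blast
    have "?D (t *\<^sub>R (- gb y1, - Hb y1)) = t * \<Phi> (y1, s)" for t
      by (subst linear_scale[OF lin]) (simp add: \<Phi>_def)
    with has_derivative_compose[OF line D] show ?thesis
      by (simp add: has_field_derivative_def mult_commute_abs)
  qed
  moreover have "\<Phi> (y1, s) < 0" if "0 \<le> s" "s \<le> \<epsilon>" for s
  proof (rule \<delta>(2))
    have "dist (y1, s) (y\<^sub>0, 0) \<le> dist y1 y\<^sub>0 + dist s 0"
      using sqrt_sum_squares_le_sum_abs[of "dist y1 y\<^sub>0" s] by (simp add: dist_Pair_Pair)
    also have "\<dots> < \<delta> / 2 + \<delta> / 2"
      using that \<epsilon>(2) r(2) y1(1) by (intro add_strict_mono) (auto simp: dist_commute)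
    finally show "dist (y1, s) (y\<^sub>0, 0) < \<delta>" by simp
  qed
  ultimately have "F y1 (g y1 - \<epsilon> *\<^sub>R gb y1) (H y1 - \<epsilon> *\<^sub>R Hb y1)
      < F y1 (g y1 - 0 *\<^sub>R gb y1) (H y1 - 0 *\<^sub>R Hb y1)"
    by (intro DERIV_neg_imp_decreasing[OF \<epsilon>(1)]) blast
  then show False using ge solution[OF y1S] by simp
qed

text \<open>Near a contact point, a noncontact point \<open>z'\<close> has a nearest contact point \<open>y\<^sub>0\<close>. The ball around
  \<open>z'\<close> through \<open>y\<^sub>0\<close> has no contact point inside but may have several on its boundary. The smaller
  ball whose diameter is the segment from \<open>z'\<close> to \<open>y\<^sub>0\<close> meets this boundary only in \<open>y\<^sub>0\<close>, so that the
  previous lemma applies to it.\<close>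

theorem contact_set_open:
  assumes below: "\<And>y. y \<in> S \<Longrightarrow> f\<^sub>s y - f y \<le> K"
  shows "open {y \<in> S. f\<^sub>s y - f y = K}"
proof (rule openI)
  fix y1 assume "y1 \<in> {y \<in> S. f\<^sub>s y - f y = K}"
  then have y1: "y1 \<in> S" "f\<^sub>s y1 - f y1 = K" by auto
  obtain r where r: "0 < r" "cball y1 r \<subseteq> S"
    using open_S y1(1) open_contains_cball by blast
  define Z where "Z = {y \<in> cball y1 r. f\<^sub>s y - f y = K}"
  have "closed Z"
    unfolding Z_def
    by (intro continuous_closed_preimage_constant continuous_intros continuous_on_subset[OF _ r(2)]
        has_jet2_continuous[OF jet] has_jet2_continuous[OF jet_s]) auto
  have "y1 \<in> Z" using y1 r by (simp add: Z_def)
  have "f\<^sub>s z' - f z' = K" if z': "z' \<in> ball y1 (r / 2)" for z'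
  proof (rule ccontr)
    assume ne: "f\<^sub>s z' - f z' \<noteq> K"
    obtain y\<^sub>0 where y\<^sub>0: "y\<^sub>0 \<in> Z" "\<And>y. y \<in> Z \<Longrightarrow> dist z' y\<^sub>0 \<le> dist z' y"
      using distance_attains_inf[OF \<open>closed Z\<close>, of z'] \<open>y1 \<in> Z\<close> by blast
    define R where "R = dist z' y\<^sub>0 / 2"
    define z where "z = midpoint z' y\<^sub>0"
    have "z' \<noteq> y\<^sub>0" using y\<^sub>0(1) ne by (auto simp: Z_def)
    then have R: "0 < R" by (simp add: R_def)
    have near: "dist z' y\<^sub>0 < r / 2"
      using y\<^sub>0(2)[OF \<open>y1 \<in> Z\<close>] z' by (simp add: dist_commute)
    have zz: "norm (z - z') = R" "norm (y\<^sub>0 - z) = R" "z - z' = y\<^sub>0 - z"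
      using dist_midpoint[of z' y\<^sub>0] by (auto simp: z_def R_def dist_norm norm_minus_commute midpoint_def
          scaleR_2[symmetric] algebra_simps scaleR_add_left[symmetric])
    have in_cball: "y \<in> cball y1 r" if "dist z' y \<le> dist z' y\<^sub>0" for y
      using dist_triangle[of y1 y z'] that near z' by (simp add: dist_commute)
    have inner_ball: "dist z' y \<le> dist z' y\<^sub>0" if "y \<in> cball z R" for y
      using dist_triangle[of z' y z] that zz(1) by (simp add: R_def dist_norm norm_minus_commute)
    have "f\<^sub>s y - f y < K" if y: "y \<in> cball z R - {y\<^sub>0}" for y
    proof -
      have "dist z' y \<noteq> dist z' y\<^sub>0"
      proof
        \<comment> \<open>Equality in the triangle inequality, by the parallelogram law.\<close>
        assume eq: "dist z' y = dist z' y\<^sub>0"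
        have "(y - z') \<bullet> (y - z') = (2 * R)\<^sup>2"
          using eq by (simp add: dot_square_norm dist_norm norm_minus_commute R_def)
        moreover have "(y - z) \<bullet> (y - z) \<le> R\<^sup>2"
          using y R by (auto simp: dot_square_norm dist_norm norm_minus_commute intro!: power_mono)
        moreover have "(z - z') \<bullet> (z - z') = R\<^sup>2"
          using zz(1) by (simp add: dot_square_norm)
        moreover have "(a + b) \<bullet> (a + b) + (a - b) \<bullet> (a - b) = 2 * (a \<bullet> a) + 2 * (b \<bullet> b)" for a b :: "real^'n"
          by (simp add: inner_add_left inner_add_right inner_diff_left inner_diff_right)
        from this[of "y - z" "z - z'"]
        have "(y - z') \<bullet> (y - z') + ((y - z) - (z - z')) \<bullet> ((y - z) - (z - z'))
            = 2 * ((y - z) \<bullet> (y - z)) + 2 * ((z - z') \<bullet> (z - z'))"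
          by simp
        ultimately have "((y - z) - (z - z')) \<bullet> ((y - z) - (z - z')) \<le> 0"
          by (simp add: power2_eq_square)
        then have "(y - z) - (z - z') = 0"
          by (metis inner_eq_zero_iff inner_ge_zero order_antisym)
        then show False using y zz(3) by simp
      qed
      then have lt: "dist z' y < dist z' y\<^sub>0" using inner_ball[of y] y by simp
      then have "y \<notin> Z" using y\<^sub>0(2)[of y] by auto
      then show ?thesis
        using in_cball[of y] lt below[of y] r(2) by (force simp: Z_def)
    qed
    moreover have "cball z R \<subseteq> S" using inner_ball in_cball r(2) by blast
    moreover have "y\<^sub>0 \<in> sphere z R" using zz(2) by (simp add: dist_norm norm_minus_commute)
    ultimately show False
      using hopf_boundary_point[OF R, of z y\<^sub>0 K] below y\<^sub>0(1) by (auto simp: Z_def)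
  qed
  moreover have "ball y1 (r / 2) \<subseteq> S" using r by force
  ultimately show "\<exists>e>0. ball y1 e \<subseteq> {y \<in> S. f\<^sub>s y - f y = K}"
    using r(1) by (intro exI[of _ "r / 2"]) auto
qed

end

section \<open>Derivatives of twice continuously differentiable functions, and continuity of matrix functions\<close>

lemma Ck_on_imp_continuous_on: "Ck_on k f S \<Longrightarrow> continuous_on S f"
  by (cases k) (auto intro!: continuous_at_imp_continuous_on differentiable_imp_continuous_within)

lemma linear_vec_expand:
  fixes f :: "real^'n \<Rightarrow> 'b::real_vector"
  assumes "linear f"
  shows "f v = (\<Sum>i\<in>UNIV. v $ i *\<^sub>R f (axis i 1))"
proof -
  have "f v = f (\<Sum>i\<in>UNIV. v $ i *\<^sub>R axis i 1)"
    using basis_expansion[of v] by (simp add: scalar_mult_eq_scaleR)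
  then show ?thesis
    by (simp add: linear_sum[OF assms] linear_scale[OF assms])
qed

lemma Ck_on_Suc_derivative_continuous:
  fixes f :: "'a::euclidean_space \<Rightarrow> 'b::real_normed_vector"
  assumes "Ck_on (Suc k) f S"
  shows "continuous_on (S \<times> UNIV) (\<lambda>(x, v). frechet_derivative f (at x) v)"
proof -
  have expand: "frechet_derivative f (at x) v = (\<Sum>b\<in>Basis. (v \<bullet> b) *\<^sub>R frechet_derivative f (at x) b)" if "x \<in> S" for x v
  proof -
    have lin: "linear (frechet_derivative f (at x))"
      using assms that by (intro linear_frechet_derivative) simp
    have "frechet_derivative f (at x) v = frechet_derivative f (at x) (\<Sum>b\<in>Basis. (v \<bullet> b) *\<^sub>R b)"
      by (simp add: euclidean_representation)
    then show ?thesis by (simp add: linear_sum[OF lin] linear_scale[OF lin])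
  qed
  have cont: "continuous_on S (\<lambda>x. frechet_derivative f (at x) b)" for b
    using assms Ck_on_imp_continuous_on[of k "\<lambda>x. frechet_derivative f (at x) b" S] by simp
  have "continuous_on (S \<times> UNIV) (\<lambda>p. frechet_derivative f (at (fst p)) b)" for b
    by (rule continuous_on_compose2[OF cont]) (auto intro: continuous_intros)
  then have "continuous_on (S \<times> UNIV) (\<lambda>p. \<Sum>b\<in>Basis. (snd p \<bullet> b) *\<^sub>R frechet_derivative f (at (fst p)) b)"
    by (intro continuous_intros)
  then show ?thesis
    by (rule continuous_on_eq) (auto simp: expand)
qed

text \<open>The mean value theorem applied twice. The second difference is symmetric in \<open>a\<close> and \<open>b\<close>, so
  letting \<open>r\<close> tend to \<open>0\<close> proves the theorem of Schwarz below.\<close>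

lemma second_difference:
  fixes f :: "'a::real_normed_vector \<Rightarrow> real"
  assumes C2: "Ck_on 2 f S" and r: "0 < r"
    and sub: "\<And>s t. 0 \<le> s \<Longrightarrow> s \<le> r \<Longrightarrow> 0 \<le> t \<Longrightarrow> t \<le> r \<Longrightarrow> y + s *\<^sub>R a + t *\<^sub>R b \<in> S"
  obtains s t where "0 < s" "s < r" "0 < t" "t < r"
    "f (y + r *\<^sub>R a + r *\<^sub>R b) - f (y + r *\<^sub>R a) - f (y + r *\<^sub>R b) + f y =
       r\<^sup>2 * frechet_derivative (\<lambda>x. frechet_derivative f (at x) a) (at (y + s *\<^sub>R a + t *\<^sub>R b)) b"
proof -
  define Da where "Da x = frechet_derivative f (at x) a" for x
  have d1: "(f has_derivative frechet_derivative f (at x)) (at x)" if "x \<in> S" for x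
    using C2 that by (simp add: numeral_2_eq_2 frechet_derivative_works[symmetric])
  have d2: "(Da has_derivative frechet_derivative Da (at x)) (at x)" if "x \<in> S" for x
    using C2 that by (simp add: Da_def[abs_def] numeral_2_eq_2 frechet_derivative_works[symmetric])
  have along: "((\<lambda>s. h (x + s *\<^sub>R v)) has_real_derivative frechet_derivative h (at (x + s *\<^sub>R v)) v) (at s)"
    if "(h has_derivative frechet_derivative h (at (x + s *\<^sub>R v))) (at (x + s *\<^sub>R v))" for h :: "'a \<Rightarrow> real" and x v s
  proof -
    have line: "((\<lambda>s. x + s *\<^sub>R v) has_derivative (\<lambda>t. t *\<^sub>R v)) (at s)"
      by (auto intro!: derivative_eq_intros)
    show ?thesis
      using has_derivative_compose[OF line that] has_derivative_linear[OF that]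
      by (simp add: has_field_derivative_def linear_scale mult_commute_abs)
  qed
  have "DERIV (\<lambda>s. f (y + r *\<^sub>R b + s *\<^sub>R a) - f (y + s *\<^sub>R a)) s :> Da (y + r *\<^sub>R b + s *\<^sub>R a) - Da (y + s *\<^sub>R a)"
    if "0 \<le> s" "s \<le> r" for s
    unfolding Da_def using sub[OF that, of r] sub[OF that, of 0] r
    by (intro DERIV_diff along d1) (auto simp: algebra_simps)
  from MVT2[OF r this] obtain s where s: "0 < s" "s < r"
    "f (y + r *\<^sub>R b + r *\<^sub>R a) - f (y + r *\<^sub>R a) - (f (y + r *\<^sub>R b) - f y) =
       r * (Da (y + r *\<^sub>R b + s *\<^sub>R a) - Da (y + s *\<^sub>R a))"
    by auto
  have "DERIV (\<lambda>t. Da (y + s *\<^sub>R a + t *\<^sub>R b)) t :> frechet_derivative Da (at (y + s *\<^sub>R a + t *\<^sub>R b)) b"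
    if "0 \<le> t" "t \<le> r" for t
    using sub[of s t] s that by (intro along d2) auto
  from MVT2[OF r this] obtain t where t: "0 < t" "t < r"
    "Da (y + s *\<^sub>R a + r *\<^sub>R b) - Da (y + s *\<^sub>R a) = r * frechet_derivative Da (at (y + s *\<^sub>R a + t *\<^sub>R b)) b"
    by auto
  have "y + r *\<^sub>R b + s *\<^sub>R a = y + s *\<^sub>R a + r *\<^sub>R b" "y + r *\<^sub>R b + r *\<^sub>R a = y + r *\<^sub>R a + r *\<^sub>R b"
    by simp_all
  with s(3) t(3) have "f (y + r *\<^sub>R a + r *\<^sub>R b) - f (y + r *\<^sub>R a) - f (y + r *\<^sub>R b) + f y =
      r\<^sup>2 * frechet_derivative Da (at (y + s *\<^sub>R a + t *\<^sub>R b)) b"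
    by (simp add: power2_eq_square)
  then show thesis using that s(1,2) t(1,2) unfolding Da_def[abs_def] by blast
qed

text \<open>Needed for the Hessian to be a symmetric matrix, without which its eigenvalues need not be real.\<close>

lemma second_derivative_symmetric:
  fixes f :: "'a::real_normed_vector \<Rightarrow> real"
  assumes C2: "Ck_on 2 f S" and S: "open S" and y: "y \<in> S"
  shows "frechet_derivative (\<lambda>x. frechet_derivative f (at x) a) (at y) b =
         frechet_derivative (\<lambda>x. frechet_derivative f (at x) b) (at y) a"
proof (rule ccontr)
  define D where "D a b x = frechet_derivative (\<lambda>x. frechet_derivative f (at x) a) (at x) b" for a b x
  assume "\<not> ?thesis"
  then have ne: "D a b y \<noteq> D b a y" by (simp add: D_def)
  define e where "e = \<bar>D a b y - D b a y\<bar> / 2"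
  have e: "0 < e" using ne by (simp add: e_def)
  have cont: "continuous_on S (D a b)" for a b
    using C2 by (simp add: D_def[abs_def] numeral_2_eq_2)
  define U where "U = {x \<in> S. \<bar>D a b x - D a b y\<bar> < e \<and> \<bar>D b a x - D b a y\<bar> < e}"
  have "U = (S \<inter> (\<lambda>x. \<bar>D a b x - D a b y\<bar>) -` {..<e}) \<inter> (S \<inter> (\<lambda>x. \<bar>D b a x - D b a y\<bar>) -` {..<e})"
    by (auto simp: U_def)
  moreover have "open (S \<inter> (\<lambda>x. \<bar>D a b x - D a b y\<bar>) -` {..<e})" for a b
    by (intro continuous_open_preimage S continuous_intros cont open_lessThan)
  ultimately have "open U" by (simp add: open_Int)
  moreover have "y \<in> U" using y e by (simp add: U_def)
  ultimately obtain \<delta> where \<delta>: "0 < \<delta>" "ball y \<delta> \<subseteq> U" by (meson openE)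
  define r where "r = \<delta> / (2 * (norm a + norm b + 1))"
  have r: "0 < r" using \<delta>(1) by (simp add: r_def add_nonneg_pos)
  have near: "y + s *\<^sub>R a + t *\<^sub>R b \<in> U" if "0 \<le> s" "s \<le> r" "0 \<le> t" "t \<le> r" for s t
  proof -
    have "norm (s *\<^sub>R a + t *\<^sub>R b) \<le> s * norm a + t * norm b"
      using norm_triangle_ineq[of "s *\<^sub>R a" "t *\<^sub>R b"] that by simp
    also have "\<dots> \<le> r * norm a + r * norm b"
      using that by (intro add_mono mult_right_mono) auto
    also have "\<dots> \<le> r * (norm a + norm b + 1)"
      using r by (simp add: algebra_simps)
    also have "\<dots> = \<delta> / 2"
    proof -
      have "\<delta> / (2 * m) * m = \<delta> / 2" if "0 < m" for m :: real
        using that by simp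
      moreover have "0 < norm a + norm b + 1" by (simp add: add_nonneg_pos)
      ultimately show ?thesis unfolding r_def by blast
    qed
    also have "\<dots> < \<delta>" using \<delta>(1) by simp
    finally have "dist y (y + (s *\<^sub>R a + t *\<^sub>R b)) < \<delta>"
      by (metis add_diff_cancel_left' dist_commute dist_norm)
    then show ?thesis using \<delta>(2) by (auto simp: add.assoc)
  qed
  obtain s t where st: "0 < s" "s < r" "0 < t" "t < r"
    "f (y + r *\<^sub>R a + r *\<^sub>R b) - f (y + r *\<^sub>R a) - f (y + r *\<^sub>R b) + f y = r\<^sup>2 * D a b (y + s *\<^sub>R a + t *\<^sub>R b)"
    using second_difference[OF C2 r, of y a b] near unfolding D_def U_def by blast
  have near': "y + s *\<^sub>R b + t *\<^sub>R a \<in> U" if "0 \<le> s" "s \<le> r" "0 \<le> t" "t \<le> r" for s t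
    using near[of t s] that by (simp add: algebra_simps)
  obtain s' t' where st': "0 < s'" "s' < r" "0 < t'" "t' < r"
    "f (y + r *\<^sub>R b + r *\<^sub>R a) - f (y + r *\<^sub>R b) - f (y + r *\<^sub>R a) + f y = r\<^sup>2 * D b a (y + s' *\<^sub>R b + t' *\<^sub>R a)"
    using second_difference[OF C2 r, of y b a] near' unfolding D_def U_def by blast
  have "r\<^sup>2 * D a b (y + s *\<^sub>R a + t *\<^sub>R b) = r\<^sup>2 * D b a (y + s' *\<^sub>R b + t' *\<^sub>R a)"
    using st(5) st'(5) by (simp add: algebra_simps)
  then have "D a b (y + s *\<^sub>R a + t *\<^sub>R b) = D b a (y + s' *\<^sub>R b + t' *\<^sub>R a)"
    using r by simp
  moreover have "\<bar>D a b (y + s *\<^sub>R a + t *\<^sub>R b) - D a b y\<bar> < e"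
    using near[of s t] st by (simp add: U_def)
  moreover have "\<bar>D b a (y + s' *\<^sub>R b + t' *\<^sub>R a) - D b a y\<bar> < e"
    using near'[of s' t'] st' by (simp add: U_def)
  ultimately have "\<bar>D a b y - D b a y\<bar> < 2 * e" by linarith
  then show False by (simp add: e_def)
qed

definition grad :: "(real^'n \<Rightarrow> real) \<Rightarrow> real^'n \<Rightarrow> real^'n" where
  "grad f y = (\<chi> i. partial_deriv i f y)"

definition hess :: "(real^'n \<Rightarrow> real) \<Rightarrow> real^'n \<Rightarrow> real^'n^'n" where
  "hess f y = (\<chi> i j. partial_deriv i (partial_deriv j f) y)"

lemma partial_deriv_fun: "partial_deriv j f = (\<lambda>y. frechet_derivative f (at y) (axis j 1))"
  by (simp add: fun_eq_iff partial_deriv_def)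

lemma frechet_derivative_eq_grad:
  assumes "f differentiable (at y)"
  shows "frechet_derivative f (at y) v = grad f y \<bullet> v"
  by (subst linear_vec_expand[OF linear_frechet_derivative[OF assms]])
    (simp add: grad_def partial_deriv_def inner_vec_def mult.commute)

lemma Ck_on_2_has_jet2:
  assumes "Ck_on 2 f S"
  shows "has_jet2 f (grad f) (hess f) S"
proof (rule has_jet2I)
  have C1: "Ck_on (Suc 0) (partial_deriv j f) S" for j
    using assms by (simp add: numeral_2_eq_2 partial_deriv_fun)
  show "continuous_on S (grad f)"
    unfolding grad_def[abs_def] by (intro continuous_on_vec_lambda Ck_on_imp_continuous_on[OF C1])
  have "continuous_on S (partial_deriv i (partial_deriv j f))" for i j
    using C1[of j] by (simp add: partial_deriv_fun[of i])
  then show "continuous_on S (hess f)"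
    unfolding hess_def[abs_def] by (intro continuous_on_vec_lambda)
  fix y v assume y: "y \<in> S"
  have "f differentiable (at y)"
    using assms y by (simp add: numeral_2_eq_2)
  then show "(f has_derivative (\<lambda>v. grad f y \<bullet> v)) (at y)"
    using frechet_derivative_eq_grad[of f y] by (metis (no_types, lifting) ext frechet_derivative_works)
  have dj: "partial_deriv j f differentiable (at y)" for j
    using C1[of j] y by simp
  have "(partial_deriv j f has_derivative (\<lambda>u. \<Sum>i\<in>UNIV. u $ i * hess f y $ i $ j)) (at y)" for j
  proof -
    have "frechet_derivative (partial_deriv j f) (at y) = (\<lambda>u. \<Sum>i\<in>UNIV. u $ i * hess f y $ i $ j)"
      by (rule ext, subst linear_vec_expand[OF linear_frechet_derivative[OF dj]])
        (simp add: hess_def partial_deriv_def)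
    then show ?thesis using dj[of j] by (simp add: frechet_derivative_works)
  qed
  then have "((\<lambda>y. \<Sum>j\<in>UNIV. partial_deriv j f y * v $ j) has_derivative
      (\<lambda>u. \<Sum>j\<in>UNIV. (\<Sum>i\<in>UNIV. u $ i * hess f y $ i $ j) * v $ j)) (at y)"
    by (intro has_derivative_sum has_derivative_mult_left)
  moreover have "(\<Sum>j\<in>UNIV. (\<Sum>i\<in>UNIV. u $ i * hess f y $ i $ j) * v $ j) = u \<bullet> (hess f y *v v)" for u
    unfolding inner_vec_def matrix_vector_mult_def
    by (simp add: sum_distrib_right sum_distrib_left mult.assoc) (rule sum.swap)
  ultimately show "((\<lambda>y. grad f y \<bullet> v) has_derivative (\<lambda>u. u \<bullet> (hess f y *v v))) (at y)"
    by (simp add: inner_vec_def grad_def)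
qed

lemma transpose_hess:
  assumes "Ck_on 2 f S" "open S" "y \<in> S"
  shows "transpose (hess f y) = hess f y"
  using second_derivative_symmetric[OF assms]
  by (simp add: transpose_def hess_def vec_eq_iff partial_deriv_fun)

text \<open>The comparison principle asks for a linearization that is jointly continuous in the point and the
  direction; this supplies it for symmetric functions of the eigenvalues.\<close>

lemma real_polynomial_function_C1:
  fixes f :: "'a::real_normed_vector \<Rightarrow> real"
  assumes "real_polynomial_function f"
  shows "\<exists>f'. (\<forall>x. (f has_derivative f' x) (at x)) \<and> continuous_on UNIV (\<lambda>(x, v). f' x v)"
  using assms
proof (induction rule: real_polynomial_function.induct)
  case (linear f)
  have "continuous_on UNIV (\<lambda>p :: 'a \<times> 'a. f (snd p))"
    by (rule bounded_linear.continuous_on[OF linear continuous_on_snd[OF continuous_on_id]])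
  then show ?case
    using bounded_linear_imp_has_derivative[OF linear]
    by (intro exI[of _ "\<lambda>x. f"]) (simp add: case_prod_beta)
next
  case (const c)
  then show ?case by (intro exI[of _ "\<lambda>x v. 0"]) auto
next
  case (add f g)
  then obtain f' g' where "\<forall>x. (f has_derivative f' x) (at x)" "continuous_on UNIV (\<lambda>(x, v). f' x v)"
    "\<forall>x. (g has_derivative g' x) (at x)" "continuous_on UNIV (\<lambda>(x, v). g' x v)" by blast
  then show ?case
    by (intro exI[of _ "\<lambda>x v. f' x v + g' x v"])
      (auto simp: case_prod_beta intro!: has_derivative_add continuous_intros)
next
  case (mult f g)
  then obtain f' g' where f: "\<forall>x. (f has_derivative f' x) (at x)" "continuous_on UNIV (\<lambda>(x, v). f' x v)"
    and g: "\<forall>x. (g has_derivative g' x) (at x)" "continuous_on UNIV (\<lambda>(x, v). g' x v)" by blast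
  have c: "continuous_on UNIV f" "continuous_on UNIV g"
    using f(1) g(1) by (meson has_derivative_continuous continuous_at_imp_continuous_on)+
  have c1: "continuous_on UNIV (\<lambda>p :: 'a \<times> 'a. f (fst p))" "continuous_on UNIV (\<lambda>p :: 'a \<times> 'a. g (fst p))"
    by (rule continuous_on_compose2[OF c(1) continuous_on_fst[OF continuous_on_id]], simp,
        rule continuous_on_compose2[OF c(2) continuous_on_fst[OF continuous_on_id]], simp)
  have "continuous_on UNIV (\<lambda>p. f (fst p) * g' (fst p) (snd p) + f' (fst p) (snd p) * g (fst p))"
    using f(2) g(2) c1 by (intro continuous_on_add continuous_on_mult) (simp_all add: case_prod_beta)
  moreover have "((\<lambda>x. f x * g x) has_derivative (\<lambda>v. f x * g' x v + f' x v * g x)) (at x)" for x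
    using f(1) g(1) by (intro has_derivative_mult) blast+
  ultimately show ?case
    by (intro exI[of _ "\<lambda>x v. f x * g' x v + f' x v * g x"]) (simp add: case_prod_beta)
qed

lemma real_polynomial_function_matrix_sigma: "real_polynomial_function (matrix_sigma p :: real^'n^'n \<Rightarrow> real)"
proof -
  have entry: "real_polynomial_function (\<lambda>B :: real^'n^'n. B $ i $ j)" for i j
    by (intro real_polynomial_function.intros(1) bounded_linear_compose[OF bounded_linear_vec_nth bounded_linear_vec_nth])
  have prod: "real_polynomial_function (\<lambda>B :: real^'n^'n. coeff (\<Prod>i\<in>J. [:if i = \<pi> i then 1 else 0, B $ i $ \<pi> i:]) q)"
    if "finite J" for J q and \<pi> :: "'n \<Rightarrow> 'n"
    using that
  proof (induction J arbitrary: q rule: finite_induct)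
    case empty
    show ?case by (simp add: real_polynomial_function.intros(2))
  next
    case (insert i J)
    define P where "P B = (\<Prod>i\<in>J. [:if i = \<pi> i then 1 else 0, B $ i $ \<pi> i:])" for B :: "real^'n^'n"
    have IH: "real_polynomial_function (\<lambda>B. coeff (P B) q)" for q
      unfolding P_def by (rule insert.IH)
    have step: "(\<lambda>B. coeff (\<Prod>i\<in>insert i J. [:if i = \<pi> i then 1 else 0, B $ i $ \<pi> i:]) q) =
        (\<lambda>B. (if i = \<pi> i then 1 else 0) * coeff (P B) q + B $ i $ \<pi> i * (case q of 0 \<Rightarrow> 0 | Suc r \<Rightarrow> coeff (P B) r))"
      using insert.hyps by (cases q) (simp_all add: P_def fun_eq_iff)
    have "real_polynomial_function (\<lambda>B. case q of 0 \<Rightarrow> 0 | Suc r \<Rightarrow> coeff (P B) r)"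
      using IH by (cases q) (simp_all add: real_polynomial_function.intros(2))
    then show ?case
      unfolding step
      by (intro real_polynomial_function.intros(3) real_polynomial_function.intros(4)[OF real_polynomial_function.intros(2) IH]
          real_polynomial_function.intros(4)[OF entry])
  qed
  have "matrix_sigma p = (\<lambda>B :: real^'n^'n. \<Sum>\<pi> | \<pi> permutes UNIV. of_int (sign \<pi>) *
      coeff (\<Prod>i\<in>UNIV. [:if i = \<pi> i then 1 else 0, B $ i $ \<pi> i:]) p)"
    by (simp add: fun_eq_iff matrix_sigma_def det_def coeff_sum of_int_poly)
  moreover have "real_polynomial_function \<dots>"
    by (intro real_polynomial_function_sum finite_permutations finite_class.finite_UNIV
        real_polynomial_function.intros(4)[OF real_polynomial_function.intros(2) prod])
  ultimately show ?thesis by simp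
qed

text \<open>Rational expressions for the entries of the inverse, as a source of its continuity.\<close>

lemma matrix_inv_cramer:
  fixes A :: "real^'n^'n"
  assumes "det A \<noteq> 0"
  shows "matrix_inv A $ k $ l =
    det (\<chi> i j. if j = k then (if i = l then 1 else 0) else A $ i $ j) / det A"
proof -
  obtain B where B: "A ** B = mat 1" "B ** A = mat 1"
    using assms invertible_det_nz[of A] unfolding invertible_def by blast
  then have inv: "matrix_inv A = B" by (rule matrix_inv_unique)
  have "A *v (B *v axis l 1) = axis l 1"
    using B by (simp add: matrix_vector_mul_assoc)
  then have "B *v axis l 1 = (\<chi> k. det (\<chi> i j. if j = k then axis l 1 $ i else A $ i $ j) / det A)"
    using cramer[OF assms] by blast
  moreover have "(B *v axis l 1) $ k = B $ k $ l"
    by (simp add: matrix_vector_mult_basis column_def)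
  moreover have "(\<chi> i j. if j = k then axis l 1 $ i else A $ i $ j) =
      (\<chi> i j. if j = k then (if i = l then 1 else 0) else A $ i $ j)"
    by (simp add: vec_eq_iff axis_def)
  ultimately show ?thesis using inv by simp
qed

lemma continuous_on_det:
  fixes A :: "'a::topological_space \<Rightarrow> real^'n^'n"
  assumes "\<And>i j. continuous_on S (\<lambda>x. A x $ i $ j)"
  shows "continuous_on S (\<lambda>x. det (A x))"
  unfolding det_def
  by (intro continuous_on_sum continuous_on_mult continuous_on_const continuous_on_prod assms)

lemma continuous_on_matrix_inv:
  fixes A :: "'a::topological_space \<Rightarrow> real^'n^'n"
  assumes "continuous_on S A" "\<And>x. x \<in> S \<Longrightarrow> det (A x) \<noteq> 0"
  shows "continuous_on S (\<lambda>x. matrix_inv (A x))"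
proof -
  have entry: "continuous_on S (\<lambda>x. A x $ i $ j)" for i j
    using assms(1) by (intro continuous_intros)
  have "continuous_on S (\<lambda>x. matrix_inv (A x) $ k $ l)" for k l
  proof -
    have "continuous_on S (\<lambda>x. det (\<chi> i j. if j = k then (if i = l then 1 else 0) else A x $ i $ j) / det (A x))"
    proof (intro continuous_on_divide continuous_on_det entry ballI assms(2))
      fix i j
      show "continuous_on S (\<lambda>x. (\<chi> i j. if j = k then if i = l then 1 else 0 else A x $ i $ j) $ i $ j)"
        using entry by (cases "j = k"; cases "i = l") auto
    qed
    then show ?thesis
      using assms(2) by (simp add: matrix_inv_cramer cong: continuous_on_cong)
  qed
  then have "continuous_on S (\<lambda>x. \<chi> k l. matrix_inv (A x) $ k $ l)"
    by (intro continuous_on_vec_lambda)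
  then show ?thesis by simp
qed

lemma continuous_on_matrix_mult:
  fixes A B :: "'a::topological_space \<Rightarrow> real^'n^'n"
  assumes "continuous_on S A" "continuous_on S B"
  shows "continuous_on S (\<lambda>x. A x ** B x)"
  unfolding matrix_matrix_mult_def using assms by (intro continuous_intros)

section \<open>Charts, tangent vectors and covectors\<close>

text \<open>Tangent vectors are families of coordinate vectors, so every statement about them comes down to
  the chain rule for transition maps.\<close>

locale smooth_manifold_charts =
  fixes X :: "'a topology" and Atl :: "('a, 'n::finite) chart set"
  assumes mfd: "smooth_manifold X Atl"
begin

lemma chart:
  assumes "c \<in> Atl"
  shows "openin X (fst c)" "open (chart_image c)"
    "homeomorphic_map (subtopology X (fst c)) (top_of_set (chart_image c)) (snd c)"
  using mfd assms by (auto simp: smooth_manifold_def)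

lemma chart_topspace: "c \<in> Atl \<Longrightarrow> topspace (subtopology X (fst c)) = fst c"
  using chart(1) openin_subset by (metis topspace_subtopology_subset)

lemma chart_inv_chart [simp]:
  assumes "c \<in> Atl" "x \<in> fst c"
  shows "chart_inv c (snd c x) = x"
proof -
  have "inj_on (snd c) (fst c)"
    using homeomorphic_imp_injective_map[OF chart(3)[OF assms(1)]] chart_topspace[OF assms(1)] by simp
  then show ?thesis using assms(2) by (simp add: chart_inv_def)
qed

lemma chart_chart_inv [simp]:
  assumes "c \<in> Atl" "y \<in> chart_image c"
  shows "chart_inv c y \<in> fst c" "snd c (chart_inv c y) = y"
  using assms(2) by (auto simp: chart_image_def chart_inv_def inv_into_into f_inv_into_f)

lemma chart_in_image: "x \<in> fst c \<Longrightarrow> snd c x \<in> chart_image c"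
  by (simp add: chart_image_def)

lemma overlap_open:
  assumes "c \<in> Atl" "d \<in> Atl"
  shows "open (snd c ` (fst c \<inter> fst d))"
proof -
  have "openin (subtopology X (fst c)) (fst c \<inter> fst d)"
    using chart(1)[OF assms(2)] by (auto simp: openin_subtopology)
  then have "openin (top_of_set (chart_image c)) (snd c ` (fst c \<inter> fst d))"
    using homeomorphic_imp_open_map[OF chart(3)[OF assms(1)]] by (simp add: open_map_def)
  then show ?thesis
    using chart(2)[OF assms(1)] openin_open_trans by blast
qed

lemma transition_derivative:
  assumes "c \<in> Atl" "d \<in> Atl" "x \<in> fst c" "x \<in> fst d"
  shows "(snd d \<circ> chart_inv c has_derivative frechet_derivative (snd d \<circ> chart_inv c) (at (snd c x))) (at (snd c x))"
proof -
  have "smooth_on (snd d \<circ> chart_inv c) (snd c ` (fst c \<inter> fst d))"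
    using mfd assms(1,2) unfolding smooth_manifold_def by blast
  then have "Ck_on (Suc 0) (snd d \<circ> chart_inv c) (snd c ` (fst c \<inter> fst d))"
    unfolding smooth_on_def by blast
  then have "(snd d \<circ> chart_inv c) differentiable (at (snd c x))"
    using assms(3,4) by auto
  then show ?thesis by (simp only: frechet_derivative_works)
qed

lemma through_transition:
  fixes h :: "'a \<Rightarrow> 'b::real_normed_vector"
  assumes "c \<in> Atl" "d \<in> Atl" "x \<in> fst c" "x \<in> fst d"
    and D: "(h \<circ> chart_inv d) differentiable (at (snd d x))"
  shows "frechet_derivative (h \<circ> chart_inv c) (at (snd c x)) =
    frechet_derivative (h \<circ> chart_inv d) (at (snd d x)) \<circ> frechet_derivative (snd d \<circ> chart_inv c) (at (snd c x))"
proof -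
  have "(snd d \<circ> chart_inv c) (snd c x) = snd d x" using assms by simp
  then have "((h \<circ> chart_inv d) \<circ> (snd d \<circ> chart_inv c) has_derivative
      frechet_derivative (h \<circ> chart_inv d) (at (snd d x)) \<circ> frechet_derivative (snd d \<circ> chart_inv c) (at (snd c x)))
      (at (snd c x))"
    using D by (intro diff_chain_at transition_derivative assms(1-4)) (simp add: frechet_derivative_works)
  then have "(h \<circ> chart_inv c has_derivative
      frechet_derivative (h \<circ> chart_inv d) (at (snd d x)) \<circ> frechet_derivative (snd d \<circ> chart_inv c) (at (snd c x)))
      (at (snd c x))"
    by (rule has_derivative_transform_within_open[OF _ overlap_open[OF assms(1,2)]]) (use assms in auto)
  then show ?thesis by (metis frechet_derivative_at)
qed

lemma transition_cocycle:
  assumes "c \<in> Atl" "d \<in> Atl" "e \<in> Atl" "x \<in> fst c" "x \<in> fst d" "x \<in> fst e"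
  shows "frechet_derivative (snd e \<circ> chart_inv c) (at (snd c x)) v =
    frechet_derivative (snd e \<circ> chart_inv d) (at (snd d x)) (frechet_derivative (snd d \<circ> chart_inv c) (at (snd c x)) v)"
  using through_transition[of c d x "snd e"] transition_derivative[of d e x] assms
  by (metis comp_apply differentiableI)

lemma transition_self:
  assumes "c \<in> Atl" "x \<in> fst c"
  shows "frechet_derivative (snd c \<circ> chart_inv c) (at (snd c x)) v = v"
proof -
  have "((\<lambda>y. y) has_derivative (\<lambda>v. v)) (at (snd c x))" by simp
  then have "(snd c \<circ> chart_inv c has_derivative (\<lambda>v. v)) (at (snd c x))"
    by (rule has_derivative_transform_within_open[OF _ chart(2)[OF assms(1)] chart_in_image[OF assms(2)]])
      (simp add: assms(1))
  then show ?thesis by (metis frechet_derivative_at)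
qed

lemma tangent_spaceD:
  assumes "v \<in> tangent_space Atl x"
  shows "d \<notin> charts_at Atl x \<Longrightarrow> v d = 0"
    and "c \<in> charts_at Atl x \<Longrightarrow> d \<in> charts_at Atl x \<Longrightarrow>
      v d = frechet_derivative (snd d \<circ> chart_inv c) (at (snd c x)) (v c)"
  using assms unfolding tangent_space_def by blast+

lemma coord_vec_apply:
  assumes "c \<in> Atl" "x \<in> fst c"
  shows "coord_vec Atl c x w c = w"
  using assms by (simp add: coord_vec_def charts_at_def transition_self)

text \<open>This is the cocycle property of the differentials of transition maps.\<close>

lemma coord_vec_tangent:
  assumes "c \<in> Atl" "x \<in> fst c"
  shows "coord_vec Atl c x w \<in> tangent_space Atl x"
proof -
  have transforms: "coord_vec Atl c x w e = frechet_derivative (snd e \<circ> chart_inv d) (at (snd d x)) (coord_vec Atl c x w d)"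
    if "d \<in> charts_at Atl x" "e \<in> charts_at Atl x" for d e
  proof -
    have "d \<in> Atl" "x \<in> fst d" "e \<in> Atl" "x \<in> fst e" using that by (simp_all add: charts_at_def)
    from transition_cocycle[OF assms(1) this(1,3) assms(2) this(2,4), of w] show ?thesis
      using that by (simp only: coord_vec_def if_True)
  qed
  show ?thesis
    unfolding tangent_space_def mem_Collect_eq
  proof (intro conjI allI impI ballI)
    show "coord_vec Atl c x w d = 0" if "d \<notin> charts_at Atl x" for d
      using that by (simp only: coord_vec_def if_False)
  qed (rule transforms)
qed

lemma tangent_eq_coord_vec:
  assumes "c \<in> Atl" "x \<in> fst c" "v \<in> tangent_space Atl x"
  shows "v = coord_vec Atl c x (v c)"
proof
  fix d
  have c: "c \<in> charts_at Atl x" using assms by (simp add: charts_at_def)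
  show "v d = coord_vec Atl c x (v c) d"
  proof (cases "d \<in> charts_at Atl x")
    case True
    then show ?thesis
      using tangent_spaceD(2)[OF assms(3) c True] by (simp only: coord_vec_def if_True)
  next
    case False
    then show ?thesis
      using tangent_spaceD(1)[OF assms(3) False] by (simp only: coord_vec_def if_False)
  qed
qed

lemma coord_vec_linear:
  assumes "c \<in> Atl" "x \<in> fst c"
  shows "coord_vec Atl c x (a *\<^sub>R v + b *\<^sub>R w) = tlincomb a (coord_vec Atl c x v) b (coord_vec Atl c x w)"
proof
  fix d
  show "coord_vec Atl c x (a *\<^sub>R v + b *\<^sub>R w) d = tlincomb a (coord_vec Atl c x v) b (coord_vec Atl c x w) d"
  proof (cases "d \<in> charts_at Atl x")
    case True
    then have "linear (frechet_derivative (snd d \<circ> chart_inv c) (at (snd c x)))"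
      using transition_derivative[of c d x] assms has_derivative_linear by (auto simp: charts_at_def)
    then show ?thesis
      using True by (simp add: coord_vec_def tlincomb_def linear_add linear_scale)
  qed (simp add: coord_vec_def tlincomb_def)
qed

lemma tlincomb_tangent:
  assumes "c \<in> Atl" "x \<in> fst c" "v \<in> tangent_space Atl x" "w \<in> tangent_space Atl x"
  shows "tlincomb a v b w \<in> tangent_space Atl x"
proof -
  have "tlincomb a v b w = coord_vec Atl c x (a *\<^sub>R v c + b *\<^sub>R w c)"
    unfolding coord_vec_linear[OF assms(1,2)]
    using tangent_eq_coord_vec[OF assms(1-3)] tangent_eq_coord_vec[OF assms(1,2,4)] by simp
  then show ?thesis using coord_vec_tangent[OF assms(1,2)] by simp
qed

lemma coord_covec_cotangent:
  assumes "c \<in> Atl" "x \<in> fst c"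
  shows "coord_covec Atl c x \<xi> \<in> cotangent_space Atl x"
  unfolding cotangent_space_def coord_covec_def
  using tlincomb_tangent[OF assms] by (auto simp: tlincomb_def inner_add_right)

lemma coord_covec_bundle:
  assumes "c \<in> Atl" "x \<in> fst c"
  shows "(x, coord_covec Atl c x \<xi>) \<in> cotangent_bundle X Atl"
  using coord_covec_cotangent[OF assms] chart(1)[OF assms(1)] assms(2) openin_subset
  by (fastforce simp: cotangent_bundle_def)

lemma C2_function_chart:
  assumes "C2_function Atl u" "c \<in> Atl"
  shows "Ck_on 2 (u \<circ> chart_inv c) (chart_image c)"
  using assms by (simp add: C2_function_def)

text \<open>The differential is defined through an arbitrarily chosen chart; here its components are
  identified in any given one.\<close>

lemma differential_eq_coord_covec:
  assumes u: "C2_function Atl u" and c: "c \<in> Atl" "x \<in> fst c"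
  shows "differential Atl u x = coord_covec Atl c x (grad (u \<circ> chart_inv c) (snd c x))"
proof -
  define d where "d = chart_at Atl x"
  have "\<exists>d. d \<in> charts_at Atl x" using c unfolding charts_at_def by blast
  then have "d \<in> charts_at Atl x" unfolding d_def chart_at_def by (rule someI_ex)
  then have d: "d \<in> Atl" "x \<in> fst d" by (auto simp: charts_at_def)
  have diff: "(u \<circ> chart_inv e) differentiable (at (snd e x))" if "e \<in> Atl" "x \<in> fst e" for e
    using C2_function_chart[OF u that(1)] chart_in_image[OF that(2)] by (simp add: numeral_2_eq_2)
  have "frechet_derivative (u \<circ> chart_inv d) (at (snd d x)) (v d) = grad (u \<circ> chart_inv c) (snd c x) \<bullet> v c"
    if v: "v \<in> tangent_space Atl x" for v
  proof -
    have "v d = frechet_derivative (snd d \<circ> chart_inv c) (at (snd c x)) (v c)"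
      by (rule tangent_spaceD(2)[OF v]) (use c d in \<open>simp_all add: charts_at_def\<close>)
    then have "frechet_derivative (u \<circ> chart_inv d) (at (snd d x)) (v d)
        = frechet_derivative (u \<circ> chart_inv c) (at (snd c x)) (v c)"
      using through_transition[OF c(1) d(1) c(2) d(2) diff[OF d]] by simp
    then show ?thesis by (simp add: frechet_derivative_eq_grad[OF diff[OF c]])
  qed
  then show ?thesis
    by (auto simp: differential_def coord_covec_def Let_def d_def[symmetric])
qed

lemma components_apply:
  assumes B: "sym_bilinear_at Atl x B" and c: "c \<in> Atl" "x \<in> fst c"
  shows "B (coord_vec Atl c x v) (coord_vec Atl c x w) = v \<bullet> (components Atl c x B *v w)"
    and "transpose (components Atl c x B) = components Atl c x B"
proof -
  let ?e = "coord_vec Atl c x"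
  have sym: "B (?e v) (?e w) = B (?e w) (?e v)" for v w
    using B coord_vec_tangent[OF c] by (simp add: sym_bilinear_at_def)
  have lin: "B (?e (a *\<^sub>R v + b *\<^sub>R v')) (?e w) = a * B (?e v) (?e w) + b * B (?e v') (?e w)" for a b v v' w
    using B coord_vec_tangent[OF c] unfolding coord_vec_linear[OF c] by (simp add: sym_bilinear_at_def)
  have linear1: "linear (\<lambda>v. B (?e v) (?e w))" for w
  proof (rule linearI)
    show "B (?e (v + v')) (?e w) = B (?e v) (?e w) + B (?e v') (?e w)" for v v'
      using lin[of 1 v 1 v' w] by simp
    show "B (?e (r *\<^sub>R v)) (?e w) = r *\<^sub>R B (?e v) (?e w)" for r v
      using lin[of r v 0 0 w] by simp
  qed
  have "B (?e v) (?e w) = (\<Sum>i\<in>UNIV. v $ i * B (?e (axis i 1)) (?e w))"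
    using linear_vec_expand[OF linear1, of v w] by simp
  also have "\<dots> = (\<Sum>i\<in>UNIV. v $ i * (\<Sum>j\<in>UNIV. w $ j * B (?e (axis j 1)) (?e (axis i 1))))"
    using linear_vec_expand[OF linear1, of w] by (simp add: sym[of "axis _ 1" w])
  also have "\<dots> = v \<bullet> (components Atl c x B *v w)"
    by (simp add: inner_vec_def matrix_vector_mult_def components_def sym[of "axis _ 1" "axis _ 1"] mult.commute)
  finally show "B (?e v) (?e w) = v \<bullet> (components Atl c x B *v w)" .
  show "transpose (components Atl c x B) = components Atl c x B"
    using sym by (simp add: transpose_def components_def vec_eq_iff)
qed

end

section \<open>The equation on a manifold\<close>

context smooth_manifold_charts
begin

lemma chart_preimage_open:
  assumes "c \<in> Atl" "open V"
  shows "openin X {x \<in> fst c. snd c x \<in> V}"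
proof -
  have "openin (subtopology X (fst c)) {x \<in> topspace (subtopology X (fst c)). snd c x \<in> chart_image c \<inter> V}"
    by (rule openin_continuous_map_preimage[OF homeomorphic_imp_continuous_map[OF chart(3)[OF assms(1)]]
        openin_open_Int[OF assms(2)]])
  also have "{x \<in> topspace (subtopology X (fst c)). snd c x \<in> chart_image c \<inter> V} = {x \<in> fst c. snd c x \<in> V}"
    unfolding chart_topspace[OF assms(1)] by (simp add: chart_in_image cong: conj_cong)
  finally show ?thesis
    using chart(1)[OF assms(1)] openin_trans_full by blast
qed

lemma topspace_charts: "topspace X = (\<Union>c\<in>Atl. fst c)"
  using mfd by (simp add: smooth_manifold_def)

lemma chartwise_open:
  assumes "M \<subseteq> topspace X" and "\<And>c. c \<in> Atl \<Longrightarrow> open {y \<in> chart_image c. chart_inv c y \<in> M}"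
  shows "openin X M"
proof -
  have "M = (\<Union>c\<in>Atl. {x \<in> fst c. snd c x \<in> {y \<in> chart_image c. chart_inv c y \<in> M}})"
  proof (intro set_eqI iffI)
    fix x assume "x \<in> M"
    then obtain c where "c \<in> Atl" "x \<in> fst c" using assms(1) topspace_charts by auto
    then show "x \<in> (\<Union>c\<in>Atl. {x \<in> fst c. snd c x \<in> {y \<in> chart_image c. chart_inv c y \<in> M}})"
      using \<open>x \<in> M\<close> chart_in_image[of x c] by (intro UN_I[of c]) simp_all
  next
    fix x assume "x \<in> (\<Union>c\<in>Atl. {x \<in> fst c. snd c x \<in> {y \<in> chart_image c. chart_inv c y \<in> M}})"
    then obtain c where "c \<in> Atl" "x \<in> fst c" "chart_inv c (snd c x) \<in> M" by blast
    then show "x \<in> M" by simp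
  qed
  also have "openin X \<dots>"
    using chart_preimage_open assms(2) by blast
  finally show ?thesis .
qed

lemma C2_function_continuous_map:
  assumes "C2_function Atl u"
  shows "continuous_map X euclideanreal u"
proof -
  have "openin X {x \<in> topspace X. u x \<in> U}" if "open U" for U
  proof (rule chartwise_open)
    fix c assume c: "c \<in> Atl"
    have "continuous_on (chart_image c) (u \<circ> chart_inv c)"
      using C2_function_chart[OF assms c] by (rule Ck_on_imp_continuous_on)
    then have "open (chart_image c \<inter> (u \<circ> chart_inv c) -` U)"
      using chart(2)[OF c] that by (rule continuous_open_preimage)
    also have "chart_image c \<inter> (u \<circ> chart_inv c) -` U = {y \<in> chart_image c. chart_inv c y \<in> {x \<in> topspace X. u x \<in> U}}"
    proof -
      have "chart_inv c y \<in> topspace X" if "y \<in> chart_image c" for y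
        using chart_chart_inv(1)[OF c that] c unfolding topspace_charts by blast
      then show ?thesis by auto
    qed
    finally show "open {y \<in> chart_image c. chart_inv c y \<in> {x \<in> topspace X. u x \<in> U}}" .
  qed auto
  then show ?thesis by (simp add: continuous_map_def)
qed

end

lemma positive_definite_det:
  fixes G :: "real^'n^'n"
  assumes "transpose G = G" "\<And>v. v \<noteq> 0 \<Longrightarrow> 0 < v \<bullet> (G *v v)"
  shows "det G \<noteq> 0"
proof -
  obtain C :: "real^'n^'n" and l where "transpose C ** G ** C = mat 1" "transpose C ** G ** C = diag l"
    using simultaneous_diagonalization[OF assms assms(1)] by metis
  then have "det (transpose C) * det G * det C = 1"
    by (metis det_I det_mul)
  then show ?thesis by auto
qed

text \<open>The coefficients \<open>A\<close> and \<open>\<phi>\<close> are smooth in \<open>(y, \<xi>, t)\<close>; the linearization of the equation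
  uses their derivatives in \<open>\<xi>\<close> at a fixed \<open>t\<close>.\<close>

lemma C1_at_parameter:
  fixes \<Psi> :: "'a::euclidean_space \<times> 'b::euclidean_space \<times> real \<Rightarrow> 'c::real_normed_vector"
  assumes "\<forall>k. Ck_on k \<Psi> (S \<times> UNIV \<times> UNIV)"
  shows "\<exists>D. (\<forall>y\<in>S. \<forall>\<eta>. ((\<lambda>\<eta>. \<Psi> (y, \<eta>, t)) has_derivative D y \<eta>) (at \<eta>)) \<and>
    continuous_on (S \<times> UNIV) (\<lambda>(y, \<eta>). \<Psi> (y, \<eta>, t)) \<and>
    continuous_on (S \<times> UNIV) (\<lambda>(y, \<eta>, \<theta>). D y \<eta> \<theta>)"
proof -
  let ?T = "S \<times> (UNIV :: 'b set) \<times> (UNIV :: real set)"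
  define D where "D y \<eta> \<theta> = frechet_derivative \<Psi> (at (y, \<eta>, t)) (0, \<theta>, 0)" for y \<eta> \<theta>
  have C1: "Ck_on (Suc 0) \<Psi> ?T" using assms by blast
  have "((\<lambda>\<eta>. \<Psi> (y, \<eta>, t)) has_derivative D y \<eta>) (at \<eta>)" if "y \<in> S" for y \<eta>
  proof -
    have emb: "((\<lambda>\<eta>. (y, \<eta>, t)) has_derivative (\<lambda>\<theta>. (0, \<theta>, 0))) (at \<eta>)"
      by (intro has_derivative_Pair has_derivative_const has_derivative_ident)
    have "\<Psi> differentiable (at (y, \<eta>, t))"
      using C1 that by auto
    then have "(\<Psi> has_derivative frechet_derivative \<Psi> (at (y, \<eta>, t))) (at (y, \<eta>, t))"
      by (simp only: frechet_derivative_works)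
    from has_derivative_compose[OF emb this] show ?thesis by (simp add: D_def[abs_def])
  qed
  moreover have "continuous_on (S \<times> UNIV) (\<lambda>q. \<Psi> (fst q, snd q, t))"
    by (rule continuous_on_compose2[OF Ck_on_imp_continuous_on[OF C1]]) (auto intro!: continuous_intros)
  moreover have "continuous_on (S \<times> UNIV) (\<lambda>q. (\<lambda>(z, v). frechet_derivative \<Psi> (at z) v)
      ((fst q, fst (snd q), t), (0, snd (snd q), 0)))"
    by (rule continuous_on_compose2[OF Ck_on_Suc_derivative_continuous[OF C1]]) (auto intro!: continuous_intros)
  ultimately show ?thesis
    by (intro exI[of _ D]) (simp add: case_prod_beta D_def)
qed

locale p_hessian = smooth_manifold_charts X Atl
  for X :: "'a topology" and Atl :: "('a, 'n::finite) chart set" +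
  fixes g :: "'a \<Rightarrow> ('a, 'n) bform"
    and A :: "'a \<times> ('a, 'n) covec \<Rightarrow> real \<Rightarrow> ('a, 'n) bform"
    and \<phi> :: "'a \<times> ('a, 'n) covec \<Rightarrow> real \<Rightarrow> real"
    and p :: nat
  assumes metric: "riemannian_metric X Atl g"
    and p: "1 \<le> p"
    and A_sym: "\<And>x \<alpha> t. (x, \<alpha>) \<in> cotangent_bundle X Atl \<Longrightarrow> sym_bilinear_at Atl x (A (x, \<alpha>) t)"
    and A_smooth: "smooth_cotangent_bform Atl A"
    and \<phi>_pos: "\<And>x \<alpha> t. (x, \<alpha>) \<in> cotangent_bundle X Atl \<Longrightarrow> \<phi> (x, \<alpha>) t > 0"
    and \<phi>_smooth: "smooth_cotangent_scalar Atl \<phi>"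
    and A_indep: "\<And>x \<alpha> s t v w. (x, \<alpha>) \<in> cotangent_bundle X Atl \<Longrightarrow>
           v \<in> tangent_space Atl x \<Longrightarrow> w \<in> tangent_space Atl x \<Longrightarrow>
           A (x, \<alpha>) s v w = A (x, \<alpha>) t v w"
    and \<phi>_indep: "\<And>x \<alpha> s t. (x, \<alpha>) \<in> cotangent_bundle X Atl \<Longrightarrow> \<phi> (x, \<alpha>) s = \<phi> (x, \<alpha>) t"
begin

definition metric_chart where "metric_chart c y = metric_matrix Atl g c (chart_inv c y)"

definition christoffel_term :: "('a, 'n) chart \<Rightarrow> real^'n \<Rightarrow> real^'n \<Rightarrow> real^'n^'n" where
  "christoffel_term c y \<eta> = (\<chi> i j. \<Sum>k\<in>UNIV. christoffel Atl g c (chart_inv c y) k i j * \<eta> $ k)"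

text \<open>Since \<open>A\<close> and \<open>\<phi>\<close> do not depend on their last argument, it is set to \<open>0\<close>.\<close>

definition A_chart where
  "A_chart c y \<eta> = components Atl c (chart_inv c y) (A (chart_inv c y, coord_covec Atl c (chart_inv c y) \<eta>) 0)"

definition phi_chart where
  "phi_chart c y \<eta> = \<phi> (chart_inv c y, coord_covec Atl c (chart_inv c y) \<eta>) 0"

lemma metric_chart_pos_def:
  assumes "c \<in> Atl" "y \<in> chart_image c"
  shows "transpose (metric_chart c y) = metric_chart c y" and "v \<noteq> 0 \<Longrightarrow> 0 < v \<bullet> (metric_chart c y *v v)"
proof -
  let ?x = "chart_inv c y"
  have x: "?x \<in> fst c" using assms by simp
  then have "?x \<in> topspace X" using assms(1) topspace_charts by auto
  then have B: "sym_bilinear_at Atl ?x (g ?x)"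
    and pos: "\<And>v. v \<in> tangent_space Atl ?x \<Longrightarrow> v \<noteq> (\<lambda>_. 0) \<Longrightarrow> g ?x v v > 0"
    using metric by (auto simp: riemannian_metric_def)
  show "transpose (metric_chart c y) = metric_chart c y"
    unfolding metric_chart_def metric_matrix_def by (rule components_apply(2)[OF B assms(1) x])
  assume "v \<noteq> 0"
  then have "coord_vec Atl c ?x v \<noteq> (\<lambda>_. 0)"
    using coord_vec_apply[OF assms(1) x, of v] by metis
  then show "0 < v \<bullet> (metric_chart c y *v v)"
    using pos[OF coord_vec_tangent[OF assms(1) x]] components_apply(1)[OF B assms(1) x]
    by (simp add: metric_chart_def metric_matrix_def)
qed

lemma metric_chart_Ck: "c \<in> Atl \<Longrightarrow> Ck_on k (metric_chart c) (chart_image c)"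
  using metric by (simp add: riemannian_metric_def smooth_on_def metric_chart_def[abs_def] metric_matrix_def)

lemma metric_chart_inv_continuous:
  assumes "c \<in> Atl"
  shows "continuous_on (chart_image c) (\<lambda>y. matrix_inv (metric_chart c y))"
  using positive_definite_det[OF metric_chart_pos_def[OF assms]] Ck_on_imp_continuous_on[OF metric_chart_Ck[OF assms]]
  by (intro continuous_on_matrix_inv)

lemma partial_deriv_metric_chart:
  assumes "c \<in> Atl" "y \<in> chart_image c"
  shows "partial_deriv l (\<lambda>z. metric_chart c z $ i $ j) y = frechet_derivative (metric_chart c) (at y) (axis l 1) $ i $ j"
proof -
  have "(metric_chart c has_derivative frechet_derivative (metric_chart c) (at y)) (at y)"
    using metric_chart_Ck[OF assms(1), of "Suc 0"] assms(2) by (simp add: frechet_derivative_works[symmetric])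
  then have "((\<lambda>z. metric_chart c z $ i $ j) has_derivative (\<lambda>v. frechet_derivative (metric_chart c) (at y) v $ i $ j)) (at y)"
    by (intro bounded_linear.has_derivative[OF bounded_linear_vec_nth])
  then show ?thesis
    unfolding partial_deriv_def by (metis frechet_derivative_at)
qed

lemma christoffel_chart:
  assumes "c \<in> Atl" "y \<in> chart_image c"
  shows "christoffel Atl g c (chart_inv c y) k i j =
    (1/2) * (\<Sum>l\<in>UNIV. matrix_inv (metric_chart c y) $ k $ l *
      (frechet_derivative (metric_chart c) (at y) (axis i 1) $ j $ l + frechet_derivative (metric_chart c) (at y) (axis j 1) $ i $ l
       - frechet_derivative (metric_chart c) (at y) (axis l 1) $ i $ j))"
  using assms partial_deriv_metric_chart[OF assms]
  by (simp add: christoffel_def Let_def metric_chart_def[symmetric])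

lemma christoffel_continuous:
  assumes "c \<in> Atl"
  shows "continuous_on (chart_image c) (\<lambda>y. christoffel Atl g c (chart_inv c y) k i j)"
proof -
  have "continuous_on (chart_image c) (\<lambda>y. frechet_derivative (metric_chart c) (at y) v)" for v
    using metric_chart_Ck[OF assms, of "Suc 0"] by simp
  then have "continuous_on (chart_image c) (\<lambda>y. (1/2) * (\<Sum>l\<in>UNIV. matrix_inv (metric_chart c y) $ k $ l *
      (frechet_derivative (metric_chart c) (at y) (axis i 1) $ j $ l + frechet_derivative (metric_chart c) (at y) (axis j 1) $ i $ l
       - frechet_derivative (metric_chart c) (at y) (axis l 1) $ i $ j)))"
    by (intro continuous_intros continuous_on_component metric_chart_inv_continuous[OF assms]) 
  then show ?thesis
    by (rule continuous_on_eq) (simp add: christoffel_chart[OF assms])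
qed

lemma christoffel_sym:
  assumes "c \<in> Atl" "y \<in> chart_image c"
  shows "christoffel Atl g c (chart_inv c y) k i j = christoffel Atl g c (chart_inv c y) k j i"
proof -
  have diff: "(\<lambda>z. metric_chart c z $ i $ j) differentiable (at y)" for i j
  proof -
    have "(metric_chart c has_derivative frechet_derivative (metric_chart c) (at y)) (at y)"
      using metric_chart_Ck[OF assms(1), of "Suc 0"] assms(2) by (simp add: frechet_derivative_works[symmetric])
    from bounded_linear.has_derivative[OF bounded_linear_vec_nth bounded_linear.has_derivative[OF bounded_linear_vec_nth this]]
    show ?thesis by (rule differentiableI)
  qed
  have "metric_chart c z $ i $ j = metric_chart c z $ j $ i" if "z \<in> chart_image c" for i j z
    using arg_cong[OF metric_chart_pos_def(1)[OF assms(1) that], of "\<lambda>M. M $ j $ i"] by (simp add: transpose_def)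
  then have "partial_deriv l (\<lambda>z. metric_chart c z $ i $ j) y = partial_deriv l (\<lambda>z. metric_chart c z $ j $ i) y" for l i j
    unfolding partial_deriv_def
    using frechet_derivative_transform_within_open[OF diff chart(2)[OF assms(1)] assms(2)] by metis
  then have "frechet_derivative (metric_chart c) (at y) (axis l 1) $ i $ j = frechet_derivative (metric_chart c) (at y) (axis l 1) $ j $ i" for l i j
    by (simp only: partial_deriv_metric_chart[OF assms])
  note swap = this
  show ?thesis
    unfolding christoffel_chart[OF assms] using swap[of _ i j] by (simp add: add.commute)
qed

lemma christoffel_term_linear: "linear (christoffel_term c y)"
  by (rule linearI)
    (simp_all add: christoffel_term_def vec_eq_iff algebra_simps sum.distrib sum_distrib_left)

lemma christoffel_term_continuous:
  assumes "c \<in> Atl"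
  shows "continuous_on (chart_image c \<times> UNIV) (\<lambda>(y, \<eta>). christoffel_term c y \<eta>)"
proof -
  have "continuous_on (chart_image c \<times> UNIV) (\<lambda>q. christoffel Atl g c (chart_inv c (fst q)) k i j)" for k i j
    by (rule continuous_on_compose2[OF christoffel_continuous[OF assms] continuous_on_fst[OF continuous_on_id]]) auto
  then show ?thesis
    unfolding christoffel_term_def case_prod_beta by (intro continuous_intros continuous_on_vec_lambda)
qed

lemma hessian_chart:
  assumes "c \<in> Atl" "y \<in> chart_image c"
  shows "hessian Atl g u c (chart_inv c y) =
    hess (u \<circ> chart_inv c) y - christoffel_term c y (grad (u \<circ> chart_inv c) y)"
  using assms by (simp add: hessian_def hess_def christoffel_term_def grad_def Let_def vec_eq_iff)

definition augmented_hessian where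
  "augmented_hessian c y \<eta> Q = A_chart c y \<eta> + Q - christoffel_term c y \<eta>"

lemma A_chart_sym:
  assumes "c \<in> Atl" "y \<in> chart_image c"
  shows "transpose (A_chart c y \<eta>) = A_chart c y \<eta>"
proof -
  have x: "chart_inv c y \<in> fst c" using assms by simp
  show ?thesis
    unfolding A_chart_def
    by (rule components_apply(2)[OF A_sym[OF coord_covec_bundle[OF assms(1) x]] assms(1) x])
qed

text \<open>Symmetry of the Christoffel symbols expresses that the Levi-Civita connection is torsion-free.\<close>

lemma augmented_hessian_sym:
  assumes "c \<in> Atl" "y \<in> chart_image c" "transpose Q = Q"
  shows "transpose (augmented_hessian c y \<eta> Q) = augmented_hessian c y \<eta> Q"
proof -
  have "A_chart c y \<eta> $ i $ j = A_chart c y \<eta> $ j $ i" "Q $ i $ j = Q $ j $ i" "christoffel_term c y \<eta> $ i $ j = christoffel_term c y \<eta> $ j $ i" for i j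
    using arg_cong[OF A_chart_sym[OF assms(1,2)], of "\<lambda>M. M $ j $ i"] arg_cong[OF assms(3), of "\<lambda>M. M $ j $ i"]
      christoffel_sym[OF assms(1,2), of _ i j]
    by (simp_all add: transpose_def christoffel_term_def)
  then show ?thesis by (simp add: transpose_def augmented_hessian_def vec_eq_iff)
qed

lemma hessian_eigenvalues_chart:
  assumes u: "C2_function Atl u" and c: "c \<in> Atl" "y \<in> chart_image c"
  defines "f \<equiv> u \<circ> chart_inv c"
  shows "hessian_eigenvalues Atl g A u c (chart_inv c y) =
    eigenvalues (matrix_inv (metric_chart c y) ** augmented_hessian c y (grad f y) (hess f y))"
proof -
  let ?x = "chart_inv c y"
  have x: "?x \<in> fst c" using c by simp
  have d: "differential Atl u ?x = coord_covec Atl c ?x (grad f y)"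
    using differential_eq_coord_covec[OF u c(1) x] c by (simp add: f_def)
  have "components Atl c ?x (A (?x, differential Atl u ?x) (u ?x)) = A_chart c y (grad f y)"
    unfolding A_chart_def d components_def vec_eq_iff vec_lambda_beta
    using A_indep[OF coord_covec_bundle[OF c(1) x] coord_vec_tangent[OF c(1) x] coord_vec_tangent[OF c(1) x]]
    by blast
  then show ?thesis
    unfolding hessian_eigenvalues_def hessian_chart[OF c] augmented_hessian_def f_def metric_chart_def by (simp add: add_diff_eq)
qed

lemma hessian_eigenvalues_matrix_sigma:
  assumes u: "C2_function Atl u" and c: "c \<in> Atl" "y \<in> chart_image c"
  defines "f \<equiv> u \<circ> chart_inv c"
  shows "sigma q (hessian_eigenvalues Atl g A u c (chart_inv c y)) =
      matrix_sigma q (matrix_inv (metric_chart c y) ** augmented_hessian c y (grad f y) (hess f y))"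
    and "hessian_eigenvalues Atl g A u c (chart_inv c y) \<in> Gamma_cone CARD('n) p \<longleftrightarrow>
      (\<forall>q\<in>{1..p}. 0 < matrix_sigma q (matrix_inv (metric_chart c y) ** augmented_hessian c y (grad f y) (hess f y)))"
proof -
  have "transpose (hess f y) = hess f y"
    unfolding f_def by (rule transpose_hess[OF C2_function_chart[OF u c(1)] chart(2)[OF c(1)] c(2)])
  from augmented_hessian_sym[OF c this] have sym: "transpose (augmented_hessian c y (grad f y) (hess f y)) = augmented_hessian c y (grad f y) (hess f y)" .
  note eig = hessian_eigenvalues_chart[OF u c, folded f_def]
  show "sigma q (hessian_eigenvalues Atl g A u c (chart_inv c y)) =
      matrix_sigma q (matrix_inv (metric_chart c y) ** augmented_hessian c y (grad f y) (hess f y))" for q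
    unfolding eig by (rule sigma_eigenvalues(2)[OF metric_chart_pos_def[OF c] sym])
  then show "hessian_eigenvalues Atl g A u c (chart_inv c y) \<in> Gamma_cone CARD('n) p \<longleftrightarrow>
      (\<forall>q\<in>{1..p}. 0 < matrix_sigma q (matrix_inv (metric_chart c y) ** augmented_hessian c y (grad f y) (hess f y)))"
    using sigma_eigenvalues(1)[OF metric_chart_pos_def[OF c] sym] by (simp add: Gamma_cone_def eig)
qed

lemma differential_phi_chart:
  assumes u: "C2_function Atl u" and c: "c \<in> Atl" "y \<in> chart_image c"
  shows "\<phi> (chart_inv c y, differential Atl u (chart_inv c y)) t = phi_chart c y (grad (u \<circ> chart_inv c) y)"
    and "0 < phi_chart c y \<eta>"
proof -
  have x: "chart_inv c y \<in> fst c" using c by simp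
  show "\<phi> (chart_inv c y, differential Atl u (chart_inv c y)) t = phi_chart c y (grad (u \<circ> chart_inv c) y)"
    using differential_eq_coord_covec[OF u c(1) x] \<phi>_indep[OF coord_covec_bundle[OF c(1) x]] c
    unfolding phi_chart_def by simp
  show "0 < phi_chart c y \<eta>"
    unfolding phi_chart_def by (rule \<phi>_pos[OF coord_covec_bundle[OF c(1) x]])
qed

text \<open>Taking \<open>p\<close>-th powers turns the equation into a polynomial one in the Hessian, and thereby avoids
  differentiating the root.\<close>

definition residual where
  "residual c y \<eta> Q = matrix_sigma p (matrix_inv (metric_chart c y) ** augmented_hessian c y \<eta> Q) - (phi_chart c y \<eta>) ^ p"

lemma residual_solution:
  assumes u: "C2_function Atl u" and sol: "p_hessian_solution p Atl g A \<phi> u"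
    and c: "c \<in> Atl" "y \<in> chart_image c"
  shows "residual c y (grad (u \<circ> chart_inv c) y) (hess (u \<circ> chart_inv c) y) = 0"
    and "\<forall>q\<in>{1..p}. 0 < matrix_sigma q (matrix_inv (metric_chart c y) **
      augmented_hessian c y (grad (u \<circ> chart_inv c) y) (hess (u \<circ> chart_inv c) y))"
proof -
  let ?e = "matrix_sigma p (matrix_inv (metric_chart c y) ** augmented_hessian c y (grad (u \<circ> chart_inv c) y) (hess (u \<circ> chart_inv c) y))"
  show pos: "\<forall>q\<in>{1..p}. 0 < matrix_sigma q (matrix_inv (metric_chart c y) **
      augmented_hessian c y (grad (u \<circ> chart_inv c) y) (hess (u \<circ> chart_inv c) y))"
    using sol c hessian_eigenvalues_matrix_sigma(2)[OF u c] unfolding p_hessian_solution_def by simp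
  have "root p ?e = phi_chart c y (grad (u \<circ> chart_inv c) y)"
    using sol[unfolded p_hessian_solution_def, rule_format, OF c(1) chart_chart_inv(1)[OF c]]
    by (simp only: hessian_eigenvalues_matrix_sigma(1)[OF u c] differential_phi_chart(1)[OF u c])
  moreover have "root p ?e ^ p = ?e"
    using pos p by (intro real_root_pow_pos2) (auto intro: less_imp_le)
  ultimately show "residual c y (grad (u \<circ> chart_inv c) y) (hess (u \<circ> chart_inv c) y) = 0"
    by (simp add: residual_def)
qed

lemma A_chart_C1:
  assumes c: "c \<in> Atl"
  shows "\<exists>D. (\<forall>y\<in>chart_image c. \<forall>\<eta>. (A_chart c y has_derivative D y \<eta>) (at \<eta>)) \<and>
    continuous_on (chart_image c \<times> UNIV) (\<lambda>(y, \<eta>). A_chart c y \<eta>) \<and>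
    continuous_on (chart_image c \<times> UNIV) (\<lambda>(y, \<eta>, \<theta>). D y \<eta> \<theta>)"
proof -
  have "\<forall>k. Ck_on k (\<lambda>(y, \<xi>, t). let x = chart_inv c y in components Atl c x (A (x, coord_covec Atl c x \<xi>) t))
      (chart_image c \<times> UNIV \<times> UNIV)"
    using A_smooth c by (simp add: smooth_cotangent_bform_def smooth_on_def)
  from C1_at_parameter[OF this, of 0] show ?thesis by (simp add: A_chart_def[abs_def] Let_def)
qed

lemma phi_chart_C1:
  assumes c: "c \<in> Atl"
  shows "\<exists>D. (\<forall>y\<in>chart_image c. \<forall>\<eta>. (phi_chart c y has_derivative D y \<eta>) (at \<eta>)) \<and>
    continuous_on (chart_image c \<times> UNIV) (\<lambda>(y, \<eta>). phi_chart c y \<eta>) \<and>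
    continuous_on (chart_image c \<times> UNIV) (\<lambda>(y, \<eta>, \<theta>). D y \<eta> \<theta>)"
proof -
  have "\<forall>k. Ck_on k (\<lambda>(y, \<xi>, t). let x = chart_inv c y in \<phi> (x, coord_covec Atl c x \<xi>) t)
      (chart_image c \<times> UNIV \<times> UNIV)"
    using \<phi>_smooth c by (simp add: smooth_cotangent_scalar_def smooth_on_def)
  from C1_at_parameter[OF this, of 0] show ?thesis by (simp add: phi_chart_def[abs_def] Let_def)
qed

lemma residual_subsolution:
  assumes u: "C2_function Atl u" and sub: "p_hessian_subsolution p Atl g A \<phi> u"
    and c: "c \<in> Atl" "y \<in> chart_image c"
  shows "0 \<le> residual c y (grad (u \<circ> chart_inv c) y) (hess (u \<circ> chart_inv c) y)"
    and "\<forall>q\<in>{1..p}. 0 < matrix_sigma q (matrix_inv (metric_chart c y) **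
      augmented_hessian c y (grad (u \<circ> chart_inv c) y) (hess (u \<circ> chart_inv c) y))"
proof -
  let ?e = "matrix_sigma p (matrix_inv (metric_chart c y) ** augmented_hessian c y (grad (u \<circ> chart_inv c) y) (hess (u \<circ> chart_inv c) y))"
  show pos: "\<forall>q\<in>{1..p}. 0 < matrix_sigma q (matrix_inv (metric_chart c y) **
      augmented_hessian c y (grad (u \<circ> chart_inv c) y) (hess (u \<circ> chart_inv c) y))"
    using sub c hessian_eigenvalues_matrix_sigma(2)[OF u c] unfolding p_hessian_subsolution_def by simp
  have "phi_chart c y (grad (u \<circ> chart_inv c) y) \<le> root p ?e"
    using sub[unfolded p_hessian_subsolution_def, rule_format, OF c(1) chart_chart_inv(1)[OF c]]
    by (simp only: hessian_eigenvalues_matrix_sigma(1)[OF u c] differential_phi_chart(1)[OF u c])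
  then have "phi_chart c y (grad (u \<circ> chart_inv c) y) ^ p \<le> root p ?e ^ p"
    using differential_phi_chart(2)[OF u c] by (intro power_mono) (auto intro: less_imp_le)
  moreover have "root p ?e ^ p = ?e"
    using pos p by (intro real_root_pow_pos2) (auto intro: less_imp_le)
  ultimately show "0 \<le> residual c y (grad (u \<circ> chart_inv c) y) (hess (u \<circ> chart_inv c) y)"
    by (simp add: residual_def)
qed

text \<open>Here the analytic hypotheses of the comparison principle meet the algebra: ellipticity at the
  solution and monotonicity at the subsolution hold because both augmented Hessians lie in the
  positivity cone, by \<open>matrix_sigma_rank_one\<close> and \<open>matrix_sigma_mono_psd\<close>.\<close>

lemma residual_elliptic_comparison:
  assumes u: "C2_function Atl u" "p_hessian_solution p Atl g A \<phi> u"
    and us: "C2_function Atl us" "p_hessian_subsolution p Atl g A \<phi> us"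
    and c: "c \<in> Atl"
  defines "f \<equiv> u \<circ> chart_inv c" and "fs \<equiv> us \<circ> chart_inv c"
  shows "\<exists>F'. elliptic_comparison (chart_image c) (residual c) F' f fs (grad f) (grad fs) (hess f) (hess fs)"
proof -
  let ?S = "chart_image c"
  obtain E where E: "\<And>B. (matrix_sigma p has_derivative E B) (at (B :: real^'n^'n))"
    and contE: "continuous_on UNIV (\<lambda>(B, V). E B V)"
    using real_polynomial_function_C1[OF real_polynomial_function_matrix_sigma[of p]] by blast
  obtain DA where DA: "\<And>y \<eta>. y \<in> ?S \<Longrightarrow> (A_chart c y has_derivative DA y \<eta>) (at \<eta>)"
    and contA: "continuous_on (?S \<times> UNIV) (\<lambda>(y, \<eta>). A_chart c y \<eta>)"
      "continuous_on (?S \<times> UNIV) (\<lambda>(y, \<eta>, \<theta>). DA y \<eta> \<theta>)"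
    using A_chart_C1[OF c] by blast
  obtain DP where DP: "\<And>y \<eta>. y \<in> ?S \<Longrightarrow> (phi_chart c y has_derivative DP y \<eta>) (at \<eta>)"
    and contP: "continuous_on (?S \<times> UNIV) (\<lambda>(y, \<eta>). phi_chart c y \<eta>)"
      "continuous_on (?S \<times> UNIV) (\<lambda>(y, \<eta>, \<theta>). DP y \<eta> \<theta>)"
    using phi_chart_C1[OF c] by blast
  define B where "B y \<eta> Q = matrix_inv (metric_chart c y) ** augmented_hessian c y \<eta> Q" for y \<eta> Q
  define dB where "dB y \<eta> \<theta> V = matrix_inv (metric_chart c y) ** (DA y \<eta> \<theta> + V - christoffel_term c y \<theta>)" for y \<eta> \<theta> V
  define F' where "F' y \<eta> Q \<theta> V = E (B y \<eta> Q) (dB y \<eta> \<theta> V) - of_nat p * DP y \<eta> \<theta> * phi_chart c y \<eta> ^ (p - 1)"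
    for y \<eta> Q \<theta> V
  have C2: "Ck_on 2 f ?S" "Ck_on 2 fs ?S"
    unfolding f_def fs_def by (rule C2_function_chart[OF u(1) c] C2_function_chart[OF us(1) c])+
  have linDA: "linear (DA y \<eta>)" "linear (DP y \<eta>)" if "y \<in> ?S" for y \<eta>
    using DA[OF that] DP[OF that] has_derivative_linear by blast+
  have deriv: "((\<lambda>(\<eta>, Q). residual c y \<eta> Q) has_derivative (\<lambda>(\<theta>, V). F' y \<eta> Q \<theta> V)) (at (\<eta>, Q))"
    if y: "y \<in> ?S" for y \<eta> Q
  proof -
    have "((\<lambda>q. A_chart c y (fst q)) has_derivative (\<lambda>h. DA y \<eta> (fst h))) (at (\<eta>, Q))"
      using has_derivative_compose[OF has_derivative_fst[OF has_derivative_ident], of "A_chart c y" "DA y \<eta>" "(\<eta>, Q)"]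
        DA[OF y] by simp
    moreover have "bounded_linear (christoffel_term c y)"
      using christoffel_term_linear by (simp add: linear_conv_bounded_linear)
    then have "((\<lambda>q. christoffel_term c y (fst q)) has_derivative (\<lambda>h. christoffel_term c y (fst h))) (at (\<eta>, Q))"
      by (rule bounded_linear.has_derivative[OF _ has_derivative_fst[OF has_derivative_ident]])
    ultimately have "((\<lambda>q. augmented_hessian c y (fst q) (snd q)) has_derivative (\<lambda>h. DA y \<eta> (fst h) + snd h - christoffel_term c y (fst h))) (at (\<eta>, Q))"
      unfolding augmented_hessian_def by (intro has_derivative_add has_derivative_diff has_derivative_snd has_derivative_ident)
    moreover have "bounded_linear ((**) M)" for M :: "real^'n^'n"
      unfolding linear_conv_bounded_linear[symmetric]
      by (rule linearI) (simp_all add: matrix_add_ldistrib scaleR_matrix_mult)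
    ultimately have "((\<lambda>q. B y (fst q) (snd q)) has_derivative (\<lambda>h. dB y \<eta> (fst h) (snd h))) (at (\<eta>, Q))"
      unfolding B_def dB_def by (rule bounded_linear.has_derivative[rotated])
    moreover have "(matrix_sigma p has_derivative E (B y \<eta> Q)) (at (B y (fst (\<eta>, Q)) (snd (\<eta>, Q))))"
      using E by simp
    ultimately have 1: "((\<lambda>q. matrix_sigma p (B y (fst q) (snd q))) has_derivative (\<lambda>h. E (B y \<eta> Q) (dB y \<eta> (fst h) (snd h)))) (at (\<eta>, Q))"
      by (rule has_derivative_compose)
    have "((\<lambda>q. phi_chart c y (fst q)) has_derivative (\<lambda>h. DP y \<eta> (fst h))) (at (\<eta>, Q))"
      using has_derivative_compose[OF has_derivative_fst[OF has_derivative_ident], of "phi_chart c y" "DP y \<eta>" "(\<eta>, Q)"]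
        DP[OF y] by simp
    from has_derivative_power[OF this, of p]
    have 2: "((\<lambda>q. phi_chart c y (fst q) ^ p) has_derivative (\<lambda>h. of_nat p * DP y \<eta> (fst h) * phi_chart c y \<eta> ^ (p - 1))) (at (\<eta>, Q))"
      by simp
    from has_derivative_diff[OF 1 2] show ?thesis
      unfolding residual_def F'_def B_def case_prod_unfold by simp
  qed
  have cont: "continuous_on (?S \<times> UNIV) (\<lambda>(y, \<eta>, Q, \<theta>, V). F' y \<eta> Q \<theta> V)"
  proof -
    let ?T = "?S \<times> (UNIV :: ((real^'n) \<times> (real^'n^'n) \<times> (real^'n) \<times> (real^'n^'n)) set)"
    have proj: "continuous_on ?T (\<lambda>q. (fst q, fst (snd q)))"
      "continuous_on ?T (\<lambda>q. (fst q, fst (snd (snd (snd q)))))"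
      "continuous_on ?T (\<lambda>q. (fst q, fst (snd q), fst (snd (snd (snd q)))))"
      by (intro continuous_intros)+
    have comp: "continuous_on ?T (\<lambda>q. h (k q))"
      if "continuous_on (?S \<times> UNIV) h" "continuous_on ?T k" "\<And>q. fst (k q) = fst q" for h k
    proof (rule continuous_on_compose2[OF that(1,2)])
      show "k ` ?T \<subseteq> ?S \<times> UNIV"
        using that(3) by (simp add: image_subset_iff mem_Times_iff)
    qed
    have inv: "continuous_on ?T (\<lambda>q. matrix_inv (metric_chart c (fst q)))"
      by (rule continuous_on_compose2[OF metric_chart_inv_continuous[OF c] continuous_on_fst[OF continuous_on_id]]) auto
    have A1: "continuous_on ?T (\<lambda>q. A_chart c (fst q) (fst (snd q)))"
      using comp[OF contA(1) proj(1)] by (simp add: case_prod_beta)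
    have A2: "continuous_on ?T (\<lambda>q. DA (fst q) (fst (snd q)) (fst (snd (snd (snd q)))))"
      using comp[OF contA(2) proj(3)] by (simp add: case_prod_beta)
    have P1: "continuous_on ?T (\<lambda>q. phi_chart c (fst q) (fst (snd q)))"
      using comp[OF contP(1) proj(1)] by (simp add: case_prod_beta)
    have P2: "continuous_on ?T (\<lambda>q. DP (fst q) (fst (snd q)) (fst (snd (snd (snd q)))))"
      using comp[OF contP(2) proj(3)] by (simp add: case_prod_beta)
    have G1: "continuous_on ?T (\<lambda>q. christoffel_term c (fst q) (fst (snd q)))"
      using comp[OF christoffel_term_continuous[OF c] proj(1)] by (simp add: case_prod_beta)
    have G2: "continuous_on ?T (\<lambda>q. christoffel_term c (fst q) (fst (snd (snd (snd q)))))"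
      using comp[OF christoffel_term_continuous[OF c] proj(2)] by (simp add: case_prod_beta)
    have B1: "continuous_on ?T (\<lambda>q. B (fst q) (fst (snd q)) (fst (snd (snd q))))"
      unfolding B_def augmented_hessian_def by (intro continuous_on_matrix_mult inv continuous_on_add continuous_on_diff A1 G1 continuous_intros)
    have B2: "continuous_on ?T (\<lambda>q. dB (fst q) (fst (snd q)) (fst (snd (snd (snd q)))) (snd (snd (snd (snd q)))))"
      unfolding dB_def by (intro continuous_on_matrix_mult inv continuous_on_add continuous_on_diff A2 G2 continuous_intros)
    have "continuous_on ?T (\<lambda>q. E (B (fst q) (fst (snd q)) (fst (snd (snd q))))
        (dB (fst q) (fst (snd q)) (fst (snd (snd (snd q)))) (snd (snd (snd (snd q))))))"
      using continuous_on_compose2[OF contE continuous_on_Pair[OF B1 B2]] by (simp add: case_prod_beta)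
    then show ?thesis
      unfolding F'_def case_prod_beta by (intro continuous_on_diff continuous_on_mult continuous_on_power continuous_on_const P1 P2)
  qed
  have elliptic: "0 < F' y (grad f y) (hess f y) 0 (outer v)" if y: "y \<in> ?S" and v: "v \<noteq> 0" for y v
  proof -
    let ?W = "augmented_hessian c y (grad f y) (hess f y)" and ?M = "matrix_inv (metric_chart c y)"
    have sym: "transpose ?W = ?W"
      by (rule augmented_hessian_sym[OF c y transpose_hess[OF C2(1) chart(2)[OF c] y]])
    have pos: "\<forall>q\<in>{1..p}. 0 < matrix_sigma q (?M ** ?W)"
      unfolding f_def by (rule residual_solution(2)[OF u c y])
    obtain T where T: "\<And>q s. q \<in> {1..p} \<Longrightarrow> matrix_sigma q (?M ** (?W + s *\<^sub>R outer v)) = matrix_sigma q (?M ** ?W) + s * T q"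
      "\<And>q. q \<in> {1..p} \<Longrightarrow> v \<noteq> 0 \<Longrightarrow> 0 < T q"
      using matrix_sigma_rank_one[OF metric_chart_pos_def[OF c y] sym pos, of v] by metis
    have pp: "p \<in> {1..p}" using p by simp
    have "((\<lambda>s. ?M ** ?W + s *\<^sub>R (?M ** outer v)) has_derivative (\<lambda>t. t *\<^sub>R (?M ** outer v))) (at 0)"
      by (auto intro!: derivative_eq_intros)
    from has_derivative_compose[OF this, of "matrix_sigma p"] E
    have chain: "((\<lambda>s. matrix_sigma p (?M ** ?W + s *\<^sub>R (?M ** outer v))) has_derivative
        (\<lambda>t. E (?M ** ?W) (t *\<^sub>R (?M ** outer v)))) (at 0)"
      by simp
    have "(\<lambda>s. matrix_sigma p (?M ** ?W + s *\<^sub>R (?M ** outer v))) = (\<lambda>s. matrix_sigma p (?M ** ?W) + s * T p)"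
      using T(1)[OF pp] by (simp add: matrix_add_ldistrib scaleR_matrix_mult)
    moreover have "((\<lambda>s. matrix_sigma p (?M ** ?W) + s * T p) has_derivative (\<lambda>t. t * T p)) (at 0)"
      by (auto intro!: derivative_eq_intros)
    ultimately have "((\<lambda>s. matrix_sigma p (?M ** ?W + s *\<^sub>R (?M ** outer v))) has_derivative (\<lambda>t. t * T p)) (at 0)"
      by (simp only:)
    from has_derivative_unique[OF chain this]
    have "(\<lambda>t. E (?M ** ?W) (t *\<^sub>R (?M ** outer v))) = (\<lambda>t. t * T p)" .
    from fun_cong[OF this, of 1] have "E (?M ** ?W) (?M ** outer v) = T p" by simp
    moreover have "F' y (grad f y) (hess f y) 0 (outer v) = E (?M ** ?W) (?M ** outer v)"
      using linear_0[OF linDA(1)[OF y]] linear_0[OF linDA(2)[OF y]] linear_0[OF christoffel_term_linear]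
      by (simp add: F'_def B_def dB_def)
    ultimately show ?thesis using T(2)[OF pp v] by simp
  qed
  have mono: "residual c y (grad fs y) (hess fs y) \<le> residual c y (grad fs y) (hess fs y + P)"
    if y: "y \<in> ?S" and P: "transpose P = P" "\<And>v. 0 \<le> v \<bullet> (P *v v)" for y P
  proof -
    let ?W = "augmented_hessian c y (grad fs y) (hess fs y)" and ?M = "matrix_inv (metric_chart c y)"
    have sym: "transpose ?W = ?W"
      by (rule augmented_hessian_sym[OF c y transpose_hess[OF C2(2) chart(2)[OF c] y]])
    have pos: "\<forall>q\<in>{1..p}. 0 < matrix_sigma q (?M ** ?W)"
      unfolding fs_def by (rule residual_subsolution(2)[OF us c y])
    have "matrix_sigma p (?M ** ?W) \<le> matrix_sigma p (?M ** (?W + P))"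
      by (rule matrix_sigma_mono_psd[OF metric_chart_pos_def[OF c y] sym pos P]) (use p in auto)
    moreover have "augmented_hessian c y (grad fs y) (hess fs y + P) = ?W + P"
      by (simp add: augmented_hessian_def)
    ultimately show ?thesis by (simp add: residual_def)
  qed
  have "elliptic_comparison ?S (residual c) F' f fs (grad f) (grad fs) (hess f) (hess fs)"
  proof (unfold_locales)
    show "open ?S" by (rule chart(2)[OF c])
    then show "transpose (hess f y) = hess f y" "transpose (hess fs y) = hess fs y" if "y \<in> ?S" for y
      using transpose_hess[OF C2(1)] transpose_hess[OF C2(2)] that by blast+
    show "has_jet2 f (grad f) (hess f) ?S" "has_jet2 fs (grad fs) (hess fs) ?S"
      by (rule Ck_on_2_has_jet2[OF C2(1)] Ck_on_2_has_jet2[OF C2(2)])+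
    show "residual c y (grad f y) (hess f y) = 0" if "y \<in> ?S" for y
      unfolding f_def by (rule residual_solution(1)[OF u c that])
    show "0 \<le> residual c y (grad fs y) (hess fs y)" if "y \<in> ?S" for y
      unfolding fs_def by (rule residual_subsolution(1)[OF us c that])
  qed (rule deriv cont elliptic mono; assumption)+
  then show ?thesis by blast
qed

lemma difference_constant:
  assumes u: "C2_function Atl u" "p_hessian_solution p Atl g A \<phi> u"
    and us: "C2_function Atl us" "p_hessian_subsolution p Atl g A \<phi> us"
    and X: "compact_space X" "connected_space X"
  shows "\<exists>K. \<forall>x\<in>topspace X. us x - u x = K"
proof (cases "topspace X = {}")
  case False
  define w where "w x = us x - u x" for x
  have cont: "continuous_map X euclideanreal w"
    unfolding w_def using C2_function_continuous_map[OF u(1)] C2_function_continuous_map[OF us(1)]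
    by (rule continuous_map_diff[rotated])
  have "compactin euclideanreal (w ` topspace X)"
    using X(1) cont unfolding compact_space_def by (rule image_compactin)
  then obtain K where K: "K \<in> w ` topspace X" "\<And>x. x \<in> topspace X \<Longrightarrow> w x \<le> K"
    using compact_attains_sup[of "w ` topspace X"] False by auto
  define M where "M = {x \<in> topspace X. w x = K}"
  have "openin X M"
  proof (rule chartwise_open)
    fix c assume c: "c \<in> Atl"
    have top: "chart_inv c y \<in> topspace X" if "y \<in> chart_image c" for y
      using chart_chart_inv(1)[OF c that] c unfolding topspace_charts by blast
    obtain F' where "elliptic_comparison (chart_image c) (residual c) F' (u \<circ> chart_inv c) (us \<circ> chart_inv c)
        (grad (u \<circ> chart_inv c)) (grad (us \<circ> chart_inv c)) (hess (u \<circ> chart_inv c)) (hess (us \<circ> chart_inv c))"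
      using residual_elliptic_comparison[OF u us c] by blast
    from elliptic_comparison.contact_set_open[OF this, of K]
    have "open {y \<in> chart_image c. (us \<circ> chart_inv c) y - (u \<circ> chart_inv c) y = K}"
      using K(2) top by (simp add: w_def)
    also have "{y \<in> chart_image c. (us \<circ> chart_inv c) y - (u \<circ> chart_inv c) y = K}
        = {y \<in> chart_image c. chart_inv c y \<in> M}"
      using top by (auto simp: M_def w_def)
    finally show "open {y \<in> chart_image c. chart_inv c y \<in> M}" .
  qed (auto simp: M_def)
  moreover have "closedin X M"
  proof -
    have "closedin X {x \<in> topspace X. w x \<in> {K}}"
      by (rule closedin_continuous_map_preimage[OF cont]) simp
    then show ?thesis by (simp add: M_def)
  qed
  ultimately have "M = topspace X"
    using X(2) K(1) unfolding connected_space_clopen_in M_def by blast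
  then show ?thesis by (auto simp: M_def w_def)
qed auto

text \<open>Gradient and Hessian ignore constants, and the coefficients see nothing else of the function.\<close>

lemma solution_plus_constant:
  assumes u: "C2_function Atl u" "p_hessian_solution p Atl g A \<phi> u"
    and us: "C2_function Atl us" and K: "\<And>x. x \<in> topspace X \<Longrightarrow> us x - u x = K"
  shows "p_hessian_solution p Atl g A \<phi> us"
proof -
  have same: "grad (us \<circ> chart_inv c) y = grad (u \<circ> chart_inv c) y"
    "hess (us \<circ> chart_inv c) y = hess (u \<circ> chart_inv c) y" if c: "c \<in> Atl" "y \<in> chart_image c" for c y
  proof -
    let ?f = "u \<circ> chart_inv c" and ?fs = "us \<circ> chart_inv c" and ?S = "chart_image c"
    note C2 = C2_function_chart[OF u(1) c(1)]
    have S: "open ?S" by (rule chart(2)[OF c(1)])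
    have eq: "?f z + K = ?fs z" if "z \<in> ?S" for z
    proof -
      have "chart_inv c z \<in> topspace X"
        using chart_chart_inv(1)[OF c(1) that] c(1) unfolding topspace_charts by blast
      from K[OF this] show ?thesis by simp
    qed
    have pd: "partial_deriv j ?fs z = partial_deriv j ?f z" if z: "z \<in> ?S" for j z
    proof -
      have "?f differentiable (at z)" using C2 z by (simp add: numeral_2_eq_2)
      then have "((\<lambda>z. ?f z + K) has_derivative frechet_derivative ?f (at z)) (at z)"
        by (intro has_derivative_add_const) (simp only: frechet_derivative_works)
      then have "(?fs has_derivative frechet_derivative ?f (at z)) (at z)"
        by (rule has_derivative_transform_within_open[OF _ S z]) (rule eq)
      then show ?thesis unfolding partial_deriv_def by (metis frechet_derivative_at)
    qed
    show "grad ?fs y = grad ?f y"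
      using pd[OF c(2)] by (simp add: grad_def)
    have "partial_deriv i (partial_deriv j ?f) y = partial_deriv i (partial_deriv j ?fs) y" for i j
    proof -
      have "partial_deriv j ?f differentiable (at y)"
        using C2 c(2) by (simp add: numeral_2_eq_2 partial_deriv_fun)
      from frechet_derivative_transform_within_open[OF this S c(2), of "partial_deriv j ?fs"] pd
      show ?thesis unfolding partial_deriv_def[of i] by simp
    qed
    then show "hess ?fs y = hess ?f y" by (simp add: hess_def)
  qed
  show ?thesis
    unfolding p_hessian_solution_def
  proof (intro ballI)
    fix c x assume c: "c \<in> Atl" "x \<in> fst c"
    define y where "y = snd c x"
    have y: "y \<in> chart_image c" "chart_inv c y = x"
      using c chart_in_image[OF c(2)] unfolding y_def by simp_all
    note [simp] = same[OF c(1) y(1)]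
    have eig: "hessian_eigenvalues Atl g A us c x = hessian_eigenvalues Atl g A u c x"
      using hessian_eigenvalues_chart[OF us c(1) y(1)] hessian_eigenvalues_chart[OF u(1) c(1) y(1)]
      unfolding y(2) by simp
    have "\<phi> (x, differential Atl us x) (us x) = \<phi> (x, differential Atl u x) (u x)"
      using differential_phi_chart(1)[OF us c(1) y(1), of "us x"] differential_phi_chart(1)[OF u(1) c(1) y(1), of "u x"]
      unfolding y(2) by simp
    then show "root p (sigma p (hessian_eigenvalues Atl g A us c x)) = \<phi> (x, differential Atl us x) (us x) \<and>
        hessian_eigenvalues Atl g A us c x \<in> Gamma_cone CARD('n) p"
      using u(2) c unfolding p_hessian_solution_def eig by simp
  qed
qed

end

theorem proposition3p5:
  fixes X :: "'a topology"
    and Atl :: "('a, 'n::finite) chart set"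
    and g :: "'a \<Rightarrow> ('a, 'n) bform"
    and A :: "'a \<times> ('a, 'n) covec \<Rightarrow> real \<Rightarrow> ('a, 'n) bform"
    and \<phi> :: "'a \<times> ('a, 'n) covec \<Rightarrow> real \<Rightarrow> real"
    and u u_sub :: "'a \<Rightarrow> real"
    and p :: nat
  assumes "smooth_manifold X Atl" and "compact_space X" and "connected_space X"
    and "riemannian_metric X Atl g"
    and "p \<in> {1..CARD('n)}"
    and "\<And>x \<alpha> t. (x, \<alpha>) \<in> cotangent_bundle X Atl \<Longrightarrow> sym_bilinear_at Atl x (A (x, \<alpha>) t)"
    and "smooth_cotangent_bform Atl A"
    and "\<And>x \<alpha> t. (x, \<alpha>) \<in> cotangent_bundle X Atl \<Longrightarrow> \<phi> (x, \<alpha>) t > 0"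
    and "smooth_cotangent_scalar Atl \<phi>"
    and "\<And>x \<alpha> s t v w. (x, \<alpha>) \<in> cotangent_bundle X Atl \<Longrightarrow>
           v \<in> tangent_space Atl x \<Longrightarrow> w \<in> tangent_space Atl x \<Longrightarrow>
           A (x, \<alpha>) s v w = A (x, \<alpha>) t v w"
    and "\<And>x \<alpha> s t. (x, \<alpha>) \<in> cotangent_bundle X Atl \<Longrightarrow> \<phi> (x, \<alpha>) s = \<phi> (x, \<alpha>) t"
    and "\<And>x t \<alpha> \<beta> v. x \<in> topspace X \<Longrightarrow>
           \<alpha> \<in> cotangent_space Atl x \<Longrightarrow> \<beta> \<in> cotangent_space Atl x \<Longrightarrow>
           v \<in> tangent_space Atl x \<Longrightarrow>
           fiber_second_deriv Atl x (\<lambda>\<eta>. A (x, \<eta>) t v v) \<alpha> \<beta> \<beta> \<le> 0"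
    and "C2_function Atl u" and "p_hessian_solution p Atl g A \<phi> u"
    and "C2_function Atl u_sub" and "p_hessian_subsolution p Atl g A \<phi> u_sub"
  shows "(\<exists>k. \<forall>x\<in>topspace X. u x - u_sub x = k) \<and> p_hessian_solution p Atl g A \<phi> u_sub"
proof -
  interpret p_hessian X Atl g A \<phi> p
  proof unfold_locales
    show "1 \<le> p" using assms(5) by simp
  qed (rule assms(1) assms(4) assms(6) assms(7) assms(8) assms(9) assms(10) assms(11); assumption)+
  obtain K where K: "\<And>x. x \<in> topspace X \<Longrightarrow> u_sub x - u x = K"
    using difference_constant[OF assms(13-16) assms(2,3)] by blast
  have "u x - u_sub x = - K" if "x \<in> topspace X" for x
    using K[OF that] by simp
  moreover have "p_hessian_solution p Atl g A \<phi> u_sub"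
    by (rule solution_plus_constant[OF assms(13-15) K])
  ultimately show ?thesis by blast
qed

end
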